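(* Let $P \in \mathcal M_N(\mathbb R)$ be a stochastic matrix, $\nu$ a probability vector of $\mathbb R^N$, $\mu>0$, and $A=(A_1,\dots,A_N)\in\mathcal M_d(\mathbb R)^N$. Then the following statements are equivalent: (a) $\lambda_{\mathrm d}(A)=\lambda_{\mathrm p}(\nu,\mu,P,A)$. (b) For every recurrence class $\mathcal I$ of $P$ which is accessible from $\nu$, every $k\in\mathbb N$, every $i_1,\dots,i_k\in\mathcal I$, and every $t_1,\dots,t_k\geq 0$, it holds $$\rho\bigl(e^{A_{i_k}t_k}\cdots e^{A_{i_1}t_1}\bigr)=e^{\lambda_{\mathrm d}(A)(t_1+\dots+t_k)}.$$
   Context: $\mathbb N$ is the set of positive integers; $d,N\in\mathbb N$; $\mathcal M_d(\mathbb R)$ is the space of real $d\times d$ matrices; $\rho(\cdot)$ is the spectral radius; $\|\cdot\|$ is an operator norm on $\mathcal M_d(\mathbb R)$ induced by a norm on $\mathbb R^d$. $\Sigma$ is the set of piecewise constant right-continuous functions $\sigma:[0,\infty)\to\{1,\dots,N\}$. For $\sigma\in\Sigma$, $\Phi_\sigma(t)$ is the flow of $\dot x=A_{\sigma(t)}x$ with $\Phi_\sigma(0)=\mathrm{Id}$. Deterministic Lyapunov exponent: $\lambda_{\mathrm d}(A)=\limsup_{t\to\infty}\frac1t\sup_{\sigma\in\Sigma}\log\|\Phi_\sigma(t)\|$. For $P=(p_{ij})$ a stochastic $N\times N$ matrix, $\mu>0$ and $\nu$ a probability (row) vector, the Markov process with parameters $(\nu,\mu,P)$ is the continuous-time Markov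 chain $\sigma$ on $\{1,\dots,N\}$ with initial law $\nu$, transition matrix $P$ and jump rate $\mu$: the times between successive jumps are independent exponential variables of parameter $\mu$, and at each jump time the chain goes from $i$ to $j$ with probability $p_{ij}$ (trivial jumps $i\to i$ are allowed). $\mathbb P_\nu$ denotes probability when $\sigma(0)$ has law $\nu$. Probabilistic Lyapunov exponent: $\lambda_{\mathrm p}(\nu,\mu,P,A)=\limsup_{t\to+\infty}\frac1t\mathbb E[\log\|\Phi_\sigma(t)\|]$, with $\sigma$ distributed according to $(\nu,\mu,P)$. Both exponents are independent of the choice of norm. A stochastic matrix is strongly connected if its associated directed graph is strongly connected. Up to a permutation of indices, every stochastic $P$ has the form $$P=\begin{pmatrix}P_1&&&0\\&\ddots&&\vdots\\&&P_R&0\\ *&\cdots&*&Q\end{pmatrix}$$ (zero blocks elsewhere) with $\rho(Q)<1$ and $P_1,\dots,P_R$ stochastic and strongly connected. The recurrence classes of $P$ are the index sets $\mathcal I(1),\dots,\mathcal I(R)$ of the blocks $P_1,\dots,P_R$, and $\mathcal T$, the set of indices of the block $Q$ (possibly empty), is the set of transient states. With $\tau=\inf\{t\geq 0\mid\sigma(t)\notin\mathcal T\}$, a recurrence class $\mathcal I(i)$ is accessible from $\nu$ if $\mathbb P_\nu(\sigma(\tau)\in\mathcal I(i))>0$. *)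

theory Defs
  imports "HOL-Probability.Probability"
begin

section \<open>Matrices\<close>

text \<open>The index types are finite types: \<open>'d\<close> for \<open>{1..d}\<close> and \<open>'n\<close> for the modes \<open>{1..N}\<close>.
  On vectors of vectors the type class operations \<open>*\<close> and \<open>^\<close> are componentwise, so matrix
  powers are iterated \<open>**\<close>.\<close>

definition mat_pow :: "real ^ 'd ^ 'd \<Rightarrow> nat \<Rightarrow> real ^ 'd ^ 'd" where
  "mat_pow A m = (((**) A) ^^ m) (mat 1)"

definition mat_exp :: "real ^ 'd ^ 'd \<Rightarrow> real ^ 'd ^ 'd" where
  "mat_exp A = (\<Sum>m. (1 / fact m) *\<^sub>R mat_pow A m)"

definition mat_spectrum :: "real ^ 'd ^ 'd \<Rightarrow> complex set" where
  "mat_spectrum A = {z. \<exists>v. v \<noteq> 0 \<and> map_matrix complex_of_real A *v v = z *s v}"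

definition spectral_radius :: "real ^ 'd ^ 'd \<Rightarrow> real" where
  "spectral_radius A = Max (cmod ` mat_spectrum A)"

definition is_norm :: "('a::real_vector \<Rightarrow> real) \<Rightarrow> bool" where
  "is_norm nrm \<longleftrightarrow>
     (\<forall>x. 0 \<le> nrm x) \<and>
     (\<forall>x. nrm x = 0 \<longleftrightarrow> x = 0) \<and>
     (\<forall>c x. nrm (c *\<^sub>R x) = \<bar>c\<bar> * nrm x) \<and>
     (\<forall>x y. nrm (x + y) \<le> nrm x + nrm y)"

definition op_norm :: "(real ^ 'd \<Rightarrow> real) \<Rightarrow> real ^ 'd ^ 'd \<Rightarrow> real" where
  "op_norm nrm A = (SUP x\<in>{x. nrm x = 1}. nrm (A *v x))"

text \<open>The product with factor \<open>k\<close> leftmost and factor \<open>1\<close> rightmost.\<close>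

primrec exp_prod :: "('n \<Rightarrow> real ^ 'd ^ 'd) \<Rightarrow> (nat \<Rightarrow> 'n) \<Rightarrow> (nat \<Rightarrow> real) \<Rightarrow> nat \<Rightarrow> real ^ 'd ^ 'd"
where
  "exp_prod A i t 0 = mat 1"
| "exp_prod A i t (Suc k) = mat_exp (t (Suc k) *\<^sub>R A (i (Suc k))) ** exp_prod A i t k"

section \<open>Switched systems and the deterministic exponent\<close>

text \<open>Signals are functions on all of the reals, of which only the values on \<open>[0,\<infinity>)\<close> matter.
  The breakpoints \<open>b k\<close> need not be discontinuities, so a signal with finitely many
  switches is included.\<close>

definition switching_signals :: "(real \<Rightarrow> 'n) set" where
  "switching_signals = {\<sigma>. \<exists>b :: nat \<Rightarrow> real.
     b 0 = 0 \<and> strict_mono b \<and> filterlim b at_top sequentially \<and>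
     (\<forall>k. \<forall>s\<in>{b k..<b (Suc k)}. \<sigma> s = \<sigma> (b k))}"

text \<open>A fundamental solution is continuous and satisfies the differential equation at every
  positive time that is not a switching time. For a signal in \<open>switching_signals\<close> it exists
  and is unique on \<open>[0,\<infinity>)\<close>.\<close>

definition fundamental_solution ::
  "('n \<Rightarrow> real ^ 'd ^ 'd) \<Rightarrow> (real \<Rightarrow> 'n) \<Rightarrow> (real \<Rightarrow> real ^ 'd ^ 'd) \<Rightarrow> bool" where
  "fundamental_solution A \<sigma> \<Phi> \<longleftrightarrow>
     continuous_on {0..} \<Phi> \<and> \<Phi> 0 = mat 1 \<and>
     (\<forall>t>0. (\<forall>\<^sub>F s in at t. \<sigma> s = \<sigma> t) \<longrightarrow>
        (\<Phi> has_vector_derivative A (\<sigma> t) ** \<Phi> t) (at t))"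

definition flow :: "('n \<Rightarrow> real ^ 'd ^ 'd) \<Rightarrow> (real \<Rightarrow> 'n) \<Rightarrow> real \<Rightarrow> real ^ 'd ^ 'd" where
  "flow A \<sigma> t = (THE X. \<exists>\<Phi>. fundamental_solution A \<sigma> \<Phi> \<and> \<Phi> t = X)"

text \<open>Both exponents are taken in \<open>ereal\<close>, where suprema and upper limits always exist;
  for finitely many matrices they are finite.\<close>

definition lyap_det :: "(real ^ 'd \<Rightarrow> real) \<Rightarrow> ('n \<Rightarrow> real ^ 'd ^ 'd) \<Rightarrow> ereal" where
  "lyap_det nrm A = Limsup at_top (\<lambda>t::real.
     ereal (1 / t) * (SUP \<sigma>\<in>switching_signals. ereal (ln (op_norm nrm (flow A \<sigma> t)))))"

section \<open>Stochastic matrices\<close>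

definition stochastic_matrix :: "real ^ 'n ^ 'n \<Rightarrow> bool" where
  "stochastic_matrix P \<longleftrightarrow> (\<forall>i j. 0 \<le> P $ i $ j) \<and> (\<forall>i. (\<Sum>j\<in>UNIV. P $ i $ j) = 1)"

definition probability_vector :: "real ^ 'n \<Rightarrow> bool" where
  "probability_vector \<nu> \<longleftrightarrow> (\<forall>i. 0 \<le> \<nu> $ i) \<and> (\<Sum>i\<in>UNIV. \<nu> $ i) = 1"

text \<open>The next two notions concern the diagonal block of \<open>P\<close> with index set \<open>I\<close>.\<close>

definition stochastic_block :: "real ^ 'n ^ 'n \<Rightarrow> 'n set \<Rightarrow> bool" where
  "stochastic_block P I \<longleftrightarrow>
     (\<forall>i\<in>I. \<forall>j\<in>I. 0 \<le> P $ i $ j) \<and> (\<forall>i\<in>I. (\<Sum>j\<in>I. P $ i $ j) = 1)"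

definition strongly_connected_block :: "real ^ 'n ^ 'n \<Rightarrow> 'n set \<Rightarrow> bool" where
  "strongly_connected_block P I \<longleftrightarrow>
     (\<forall>i\<in>I. \<forall>j\<in>I. (i, j) \<in> {(a, b). a \<in> I \<and> b \<in> I \<and> P $ a $ b \<noteq> 0}\<^sup>*)"

text \<open>The block with index set \<open>I\<close>, padded by zeros to a full matrix. The padding adds at most
  the eigenvalue \<open>0\<close>, so it does not change the spectral radius; for empty \<open>I\<close> the spectral
  radius is \<open>0\<close>.\<close>

definition padded_block :: "real ^ 'n ^ 'n \<Rightarrow> 'n set \<Rightarrow> real ^ 'n ^ 'n" where
  "padded_block P I = (\<chi> i j. if i \<in> I \<and> j \<in> I then P $ i $ j else 0)"

text \<open>The block triangular form, up to permutation of indices: \<open>C\<close> is the set of index sets of the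
  blocks \<open>P\<^sub>1, \<dots>, P\<^sub>R\<close> and \<open>T\<close> is the index set of the block \<open>Q\<close>.\<close>

definition block_form :: "real ^ 'n ^ 'n \<Rightarrow> 'n set set \<Rightarrow> 'n set \<Rightarrow> bool" where
  "block_form P C T \<longleftrightarrow>
     {} \<notin> C \<and> disjoint C \<and> T = UNIV - \<Union>C \<and>
     (\<forall>I\<in>C. (\<forall>i\<in>I. \<forall>j\<in>-I. P $ i $ j = 0) \<and>
        stochastic_block P I \<and> strongly_connected_block P I) \<and>
     spectral_radius (padded_block P T) < 1"

definition recurrence_classes :: "real ^ 'n ^ 'n \<Rightarrow> 'n set set" where
  "recurrence_classes P = {I. \<exists>C T. block_form P C T \<and> I \<in> C}"

definition transient_states :: "real ^ 'n ^ 'n \<Rightarrow> 'n set" where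
  "transient_states P = {i. \<exists>C T. block_form P C T \<and> i \<in> T}"

section \<open>The Markov process and the probabilistic exponent\<close>

definition jump_chain ::
  "'w measure \<Rightarrow> real ^ 'n \<Rightarrow> real ^ 'n ^ 'n \<Rightarrow> (nat \<Rightarrow> 'w \<Rightarrow> 'n) \<Rightarrow> bool" where
  "jump_chain M \<nu> P X \<longleftrightarrow>
     (\<forall>k. X k \<in> measurable M (count_space UNIV)) \<and>
     (\<forall>m x. measure M {\<omega> \<in> space M. \<forall>k\<le>m. X k \<omega> = x k} =
        \<nu> $ x 0 * (\<Prod>k<m. P $ x k $ x (Suc k)))"

definition holding_times :: "'w measure \<Rightarrow> real \<Rightarrow> (nat \<Rightarrow> 'w \<Rightarrow> real) \<Rightarrow> bool" where
  "holding_times M \<mu> S \<longleftrightarrow>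
     (\<forall>k. distributed M lborel (S k) (exponential_density \<mu>)) \<and>
     prob_space.indep_vars M (\<lambda>_. borel) S UNIV"

text \<open>\<open>\<sigma>\<close> is a realization, on the probability space \<open>M\<close>, of the Markov process with parameters
  \<open>(\<nu>, \<mu>, P)\<close>: it takes the value \<open>X k\<close> from the \<open>k\<close>-th jump time \<open>S 0 + \<dots> + S (k-1)\<close> up to the
  next one. The paths lie in \<open>switching_signals\<close> for every \<open>\<omega>\<close>, while the representation through
  jump chain and holding times is only required almost surely.\<close>

definition markov_process ::
  "'w measure \<Rightarrow> real ^ 'n \<Rightarrow> real \<Rightarrow> real ^ 'n ^ 'n \<Rightarrow> ('w \<Rightarrow> real \<Rightarrow> 'n) \<Rightarrow> bool" where
  "markov_process M \<nu> \<mu> P \<sigma> \<longleftrightarrow>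
     prob_space M \<and>
     (\<forall>\<omega>\<in>space M. \<sigma> \<omega> \<in> switching_signals) \<and>
     (\<forall>t\<ge>0. (\<lambda>\<omega>. \<sigma> \<omega> t) \<in> measurable M (count_space UNIV)) \<and>
     (\<exists>X S. jump_chain M \<nu> P X \<and> holding_times M \<mu> S \<and>
        prob_space.indep_set M
          {(\<lambda>\<omega> k. X k \<omega>) -` B \<inter> space M | B. B \<in> sets (PiM (UNIV :: nat set) (\<lambda>_. count_space UNIV))}
          {(\<lambda>\<omega> k. S k \<omega>) -` B \<inter> space M | B. B \<in> sets (PiM (UNIV :: nat set) (\<lambda>_. borel))} \<and>
        (AE \<omega> in M. \<forall>k t. (\<Sum>j<k. S j \<omega>) \<le> t \<and> t < (\<Sum>j\<le>k. S j \<omega>) \<longrightarrow> \<sigma> \<omega> t = X k \<omega>))"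

definition lyap_prob ::
  "(real ^ 'd \<Rightarrow> real) \<Rightarrow> 'w measure \<Rightarrow> ('w \<Rightarrow> real \<Rightarrow> 'n) \<Rightarrow> ('n \<Rightarrow> real ^ 'd ^ 'd) \<Rightarrow> ereal" where
  "lyap_prob nrm M \<sigma> A = Limsup at_top (\<lambda>t::real.
     ereal (1 / t * (\<integral>\<omega>. ln (op_norm nrm (flow A (\<sigma> \<omega>) t)) \<partial>M)))"

definition exit_time :: "'n set \<Rightarrow> (real \<Rightarrow> 'n) \<Rightarrow> real" where
  "exit_time T s = Inf {t. 0 \<le> t \<and> s t \<notin> T}"

text \<open>The first conjunct says that the exit time is finite; the infimum of the empty set of
  reals carries no information.\<close>

definition accessible :: "'w measure \<Rightarrow> ('w \<Rightarrow> real \<Rightarrow> 'n) \<Rightarrow> 'n set \<Rightarrow> 'n set \<Rightarrow> bool" where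
  "accessible M \<sigma> T I \<longleftrightarrow>
     measure M {\<omega> \<in> space M. (\<exists>t\<ge>0. \<sigma> \<omega> t \<notin> T) \<and> \<sigma> \<omega> (exit_time T (\<sigma> \<omega>)) \<in> I} > 0"

end

theory Submission
  imports Defs "HOL-Computational_Algebra.Fundamental_Theorem_Algebra"
begin

text \<open>
  Write \<open>\<theta>\<close> for the deterministic exponent. Products of duration \<open>t\<close> are bounded by
  \<open>C exp ((\<theta> + \<delta>) t)\<close> for every \<open>\<delta> > 0\<close>, and as a product can be repeated periodically, no product of
  duration \<open>t\<close> has spectral radius above \<open>exp (\<theta> t)\<close> (\<open>spectral_radius_le_growth\<close>). An average is
  at most a supremum, so the probabilistic exponent never exceeds \<open>\<theta>\<close>. The theorem therefore asks
  when the probabilistic exponent reaches \<open>\<theta>\<close>.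

  Suppose first that every product over an accessible class attains the maximal spectral radius. Almost
  surely the signal is absorbed in an accessible class after a finite time. From then on the norm of the
  flow is bounded below by a spectral radius, and what was lost before absorption is bounded in terms of
  the absorption time alone, hence disappears after division by \<open>t\<close> (\<open>lyap_prob_ge\<close>).

  Suppose conversely that some product over an accessible class \<open>I\<close> has a smaller spectral radius. By
  repeating it, its norm falls short of the growth rate by any prescribed factor. Inserting states for
  time zero makes it follow the graph of \<open>P\<close>, and by continuity the gain survives on an open box of
  positive holding times (\<open>contracting_pattern_exists\<close>). The signal runs through this pattern with
  positive density (\<open>expected_completed_ge\<close>).

  It remains to see that the gains add up. Without irreducibility, products may grow faster than
  \<open>exp (\<theta> t)\<close> by a polynomial factor, and this could undo, between two patterns, the gain of one of
  them. Therefore vectors are measured, for each \<open>\<delta>\<close> in \<open>(0, 1]\<close>, in a norm that no product of duration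
  \<open>t\<close> increases by more than \<open>exp ((\<theta> + \<delta>) t)\<close> (\<open>adapted_norm_exists\<close>). These norms may degenerate as
  \<open>\<delta>\<close> tends to zero, but the operator norms that they induce on products are bounded by one and the
  same multiple of a fixed norm: a product is a linear combination of finitely many fixed products, with
  coefficients controlled by its norm (\<open>adapted_uniform_bound\<close>). So one pattern, chosen before \<open>\<delta>\<close>,
  halves all these norms. Its density does not depend on \<open>\<delta>\<close> either, and for small \<open>\<delta>\<close> the gain
  exceeds the loss \<open>\<delta> t\<close> (\<open>lyap_prob_less\<close>), without a reduction to irreducible blocks.
\<close>

section \<open>Matrix norms\<close>

lemma norm_matrix_vector_mult_le:
  fixes A :: "real ^ 'n ^ 'm"
  shows "norm (A *v x) \<le> norm A * norm x"
proof -
  have "norm (A *v x) = L2_set (\<lambda>i. \<bar>A $ i \<bullet> x\<bar>) UNIV"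
    by (simp add: norm_vec_def matrix_vector_mult_def inner_vec_def)
  also have "\<dots> \<le> L2_set (\<lambda>i. norm (A $ i) * norm x) UNIV"
    by (intro L2_set_mono) (auto simp: Cauchy_Schwarz_ineq2)
  also have "\<dots> = norm A * norm x"
    by (simp add: norm_vec_def[of A] L2_set_left_distrib)
  finally show ?thesis .
qed

lemma norm_transpose:
  fixes A :: "real ^ 'n ^ 'm"
  shows "norm (transpose A) = norm A"
proof -
  have "(norm (transpose A))\<^sup>2 = (norm A)\<^sup>2"
    unfolding power2_norm_eq_inner inner_vec_def transpose_def
    by (subst sum.swap) simp
  then show ?thesis by simp
qed

lemma norm_matrix_mult_le:
  fixes A :: "real ^ 'n ^ 'm" and B :: "real ^ 'k ^ 'n"
  shows "norm (A ** B) \<le> norm A * norm B"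
proof -
  have "norm (transpose (A ** B)) = L2_set (\<lambda>j. norm (A *v column j B)) UNIV"
    by (simp add: norm_vec_def transpose_def matrix_matrix_mult_def matrix_vector_mult_def
        column_def)
  also have "\<dots> \<le> L2_set (\<lambda>j. norm A * norm (transpose B $ j)) UNIV"
    by (intro L2_set_mono)
       (auto simp: column_def transpose_def norm_matrix_vector_mult_le)
  also have "\<dots> = norm A * norm B"
    by (metis L2_set_right_distrib norm_ge_zero norm_transpose norm_vec_def)
  finally show ?thesis by (simp add: norm_transpose)
qed

interpretation mat_mult: bounded_bilinear "(**) :: real ^ 'n ^ 'm \<Rightarrow> real ^ 'k ^ 'n \<Rightarrow> real ^ 'k ^ 'm"
proof
  show "\<exists>K. \<forall>a b. norm ((a :: real ^ 'n ^ 'm) ** (b :: real ^ 'k ^ 'n)) \<le> norm a * norm b * K"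
    by (rule exI[of _ 1]) (simp add: norm_matrix_mult_le)
qed (auto simp: vec_eq_iff matrix_matrix_mult_def sum_distrib_left sum.distrib algebra_simps)

interpretation mat_vec: bounded_bilinear "(*v) :: real ^ 'n ^ 'm \<Rightarrow> real ^ 'n \<Rightarrow> real ^ 'm"
proof
  show "\<exists>K. \<forall>a b. norm ((a :: real ^ 'n ^ 'm) *v b) \<le> norm a * norm b * K"
    by (rule exI[of _ 1]) (simp add: norm_matrix_vector_mult_le)
qed (auto simp: vec_eq_iff matrix_vector_mult_def sum_distrib_left sum.distrib algebra_simps)

lemma mat_pow_0 [simp]: "mat_pow A 0 = mat 1"
  by (simp add: mat_pow_def)

lemma mat_pow_Suc: "mat_pow A (Suc m) = A ** mat_pow A m"
  by (simp add: mat_pow_def)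

lemma mat_pow_Suc_vec: "mat_pow A (Suc m) *v x = A *v (mat_pow A m *v x)"
  by (simp add: mat_pow_Suc matrix_vector_mul_assoc)

section \<open>The spectral radius and the growth of powers\<close>

definition char_matrix :: "real ^ 'd ^ 'd \<Rightarrow> complex \<Rightarrow> complex ^ 'd ^ 'd" where
  "char_matrix A z = (\<chi> i j. (if i = j then z else 0) - complex_of_real (A $ i $ j))"

lemma char_matrix_vec:
  "char_matrix A z *v v = z *s v - map_matrix complex_of_real A *v v"
  by (simp add: char_matrix_def vec_eq_iff matrix_vector_mult_def map_matrix_def
      left_diff_distrib sum_subtractf if_distrib[of "\<lambda>a. a * _"] cong: if_cong)

lemma mat_spectrum_iff_det: "z \<in> mat_spectrum A \<longleftrightarrow> det (char_matrix A z) = 0"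
proof -
  have "det (char_matrix A z) = 0 \<longleftrightarrow> \<not> invertible (char_matrix A z)"
    by (simp add: invertible_det_nz)
  also have "\<dots> \<longleftrightarrow> (\<exists>v. v \<noteq> 0 \<and> char_matrix A z *v v = 0)"
    by (auto simp: invertible_left_inverse matrix_left_invertible_ker)
  also have "\<dots> \<longleftrightarrow> z \<in> mat_spectrum A"
    unfolding mat_spectrum_def char_matrix_vec by auto
  finally show ?thesis by blast
qed

lemma char_poly_exists:
  fixes A :: "real ^ 'd ^ 'd"
  obtains p where "\<And>z. poly p z = det (char_matrix A z)"
proof
  define C :: "'d \<Rightarrow> 'd \<Rightarrow> complex poly" where
    "C = (\<lambda>i j. if i = j then [:- complex_of_real (A $ i $ j), 1:] else [:- complex_of_real (A $ i $ j):])"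
  have C: "poly (C i j) z = char_matrix A z $ i $ j" for i j z
    by (simp add: C_def char_matrix_def)
  show "poly (\<Sum>f\<in>{f. f permutes UNIV}. smult (of_int (sign f)) (\<Prod>i\<in>UNIV. C i (f i))) z =
        det (char_matrix A z)" for z
    by (simp add: poly_sum poly_prod C det_def)
qed

text \<open>Dividing \<open>det (z - A)\<close> by the right power of \<open>z\<close> gives \<open>det (1 - A / z)\<close>, which tends to
  \<open>det 1 = 1\<close>; a constant would tend to \<open>0\<close>.\<close>

lemma det_char_matrix_not_constant:
  fixes A :: "real ^ 'd ^ 'd"
  shows "\<not> (\<forall>z. det (char_matrix A z) = c)"
proof
  assume c: "\<forall>z. det (char_matrix A z) = c"
  define D :: "nat \<Rightarrow> complex ^ 'd ^ 'd" where
    "D n = (\<chi> i j. (if i = j then 1 else 0) - complex_of_real (A $ i $ j / real (Suc n)))" for n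
  have "(\<lambda>n. det (D n)) \<longlonglongrightarrow> (\<Sum>f\<in>{f. f permutes (UNIV :: 'd set)}.
      of_int (sign f) * (\<Prod>i\<in>UNIV. ((if i = f i then 1 else 0) - complex_of_real 0)))"
    unfolding det_def D_def vec_lambda_beta
    by (intro tendsto_intros lim_const_over_n[THEN LIMSEQ_Suc])
  moreover have "(\<Sum>f\<in>{f. f permutes (UNIV :: 'd set)}.
      of_int (sign f) * (\<Prod>i\<in>UNIV. ((if i = f i then 1 else 0) - complex_of_real 0)))
      = det (mat 1 :: complex ^ 'd ^ 'd)"
    by (simp add: det_def mat_def)
  ultimately have lim1: "(\<lambda>n. det (D n)) \<longlonglongrightarrow> 1"
    by simp
  have "det (D n) = c * (1 / complex_of_real (real (Suc n))) ^ CARD('d)" for n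
  proof -
    have "D n $ i $ j = (1 / complex_of_real (real (Suc n))) * char_matrix A (of_nat (Suc n)) $ i $ j" for i j
      by (simp add: D_def char_matrix_def field_simps del: of_nat_Suc)
    then have "det (D n) = (1 / complex_of_real (real (Suc n))) ^ CARD('d) * det (char_matrix A (of_nat (Suc n)))"
      by (simp add: det_def prod_dividef sum_distrib_left power_one_over del: of_nat_Suc)
    then show ?thesis using c by simp
  qed
  moreover have "(\<lambda>n. c * (1 / complex_of_real (real (Suc n))) ^ CARD('d)) \<longlonglongrightarrow> c * 0 ^ CARD('d)"
  proof (intro tendsto_intros)
    have "(\<lambda>n. complex_of_real (1 / real (Suc n))) \<longlonglongrightarrow> complex_of_real 0"
      by (intro tendsto_intros lim_const_over_n[THEN LIMSEQ_Suc])
    then show "(\<lambda>n. 1 / complex_of_real (real (Suc n))) \<longlonglongrightarrow> 0" by simp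
  qed
  ultimately have "(\<lambda>n. det (D n)) \<longlonglongrightarrow> 0" by (simp add: power_0_left)
  with lim1 show False using LIMSEQ_unique by fastforce
qed

text \<open>These two facts give meaning to the maximum in \<open>spectral_radius\<close>.\<close>

lemma
  fixes A :: "real ^ 'd ^ 'd"
  shows finite_mat_spectrum: "finite (mat_spectrum A)"
    and mat_spectrum_nonempty: "mat_spectrum A \<noteq> {}"
proof -
  obtain p where p: "\<And>z. poly p z = det (char_matrix A z)"
    using char_poly_exists by blast
  have spec: "mat_spectrum A = {z. poly p z = 0}"
    by (simp add: mat_spectrum_iff_det p set_eq_iff)
  have nc: "\<not> constant (poly p)"
    using det_char_matrix_not_constant[of A "poly p 0"] unfolding constant_def p by metis
  then have "p \<noteq> 0" by (auto simp: constant_def)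
  then show "finite (mat_spectrum A)" by (simp add: spec poly_roots_finite)
  show "mat_spectrum A \<noteq> {}" using fundamental_theorem_of_algebra[OF nc] by (simp add: spec)
qed

lemma cmod_le_spectral_radius: "z \<in> mat_spectrum A \<Longrightarrow> cmod z \<le> spectral_radius A"
  unfolding spectral_radius_def by (intro Max_ge) (auto simp: finite_mat_spectrum)

lemma spectral_radius_attained:
  obtains z where "z \<in> mat_spectrum A" "cmod z = spectral_radius A"
proof -
  have "spectral_radius A \<in> cmod ` mat_spectrum A"
    unfolding spectral_radius_def
    by (intro Max_in) (auto simp: finite_mat_spectrum mat_spectrum_nonempty)
  then show ?thesis using that by auto
qed

lemma map_matrix_complex_mult:
  "map_matrix complex_of_real (A ** B) = map_matrix complex_of_real A ** map_matrix complex_of_real B"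
  by (simp add: vec_eq_iff map_matrix_def matrix_matrix_mult_def)

lemma mat_spectrum_mat_pow:
  assumes "z \<in> mat_spectrum A"
  shows "z ^ m \<in> mat_spectrum (mat_pow A m)"
proof -
  obtain v where v: "v \<noteq> 0" "map_matrix complex_of_real A *v v = z *s v"
    using assms by (auto simp: mat_spectrum_def)
  have "map_matrix complex_of_real (mat_pow A m) *v v = z ^ m *s v"
  proof (induction m)
    case 0
    have "map_matrix complex_of_real (mat 1) = (mat 1 :: complex ^ 'a ^ 'a)"
      by (simp add: vec_eq_iff map_matrix_def mat_def)
    then show ?case by simp
  next
    case (Suc m)
    then show ?case
      by (simp add: mat_pow_Suc map_matrix_complex_mult v vector_scalar_commute mult_ac
          flip: matrix_vector_mul_assoc)
  qed
  with v(1) show ?thesis by (auto simp: mat_spectrum_def)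
qed

lemma norm_vector_smult:
  fixes v :: "complex ^ 'n"
  shows "norm (z *s v) = cmod z * norm v"
  by (simp add: norm_vec_def norm_mult L2_set_right_distrib)

text \<open>A real matrix acts on the real and the imaginary part of a complex vector separately, so its
  real bound is also a bound for its complexification.\<close>

lemma eigenvalue_le_bound:
  fixes A :: "real ^ 'd ^ 'd"
  assumes bound: "\<And>x. norm (A *v x) \<le> c * norm x" and z: "z \<in> mat_spectrum A"
  shows "cmod z \<le> c"
proof -
  obtain v where v: "v \<noteq> 0" "map_matrix complex_of_real A *v v = z *s v"
    using z by (auto simp: mat_spectrum_def)
  define x y where "x = (\<chi> i. Re (v $ i))" and "y = (\<chi> i. Im (v $ i))"
  have split: "(norm w)\<^sup>2 = (norm (\<chi> i. Re (w $ i)))\<^sup>2 + (norm (\<chi> i. Im (w $ i)))\<^sup>2"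
    for w :: "complex ^ 'd"
    unfolding power2_norm_eq_inner inner_vec_def
    by (simp add: inner_complex_def sum.distrib)
  have re: "(\<chi> i. Re ((map_matrix complex_of_real A *v v) $ i)) = A *v x"
    and im: "(\<chi> i. Im ((map_matrix complex_of_real A *v v) $ i)) = A *v y"
    by (simp_all add: vec_eq_iff matrix_vector_mult_def map_matrix_def x_def y_def)
  have nonneg: "0 \<le> c * norm w" for w :: "real ^ 'd"
    using bound[of w] norm_ge_zero order_trans by blast
  have "(norm (z *s v))\<^sup>2 = (norm (A *v x))\<^sup>2 + (norm (A *v y))\<^sup>2"
    using split[of "map_matrix complex_of_real A *v v"] re im v(2) by simp
  also have "\<dots> \<le> (c * norm x)\<^sup>2 + (c * norm y)\<^sup>2"
    by (intro add_mono power_mono bound) auto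
  also have "\<dots> = c\<^sup>2 * (norm v)\<^sup>2"
    using split[of v] by (simp add: x_def y_def power_mult_distrib algebra_simps)
  finally have "(cmod z)\<^sup>2 * (norm v)\<^sup>2 \<le> c\<^sup>2 * (norm v)\<^sup>2"
  proof -
    note norm_vector_smult[of z v]
    moreover assume "(norm (z *s v))\<^sup>2 \<le> c\<^sup>2 * (norm v)\<^sup>2"
    ultimately show ?thesis by (simp add: power_mult_distrib)
  qed
  then have "(cmod z)\<^sup>2 \<le> c\<^sup>2" using v(1) by simp
  moreover have "0 \<le> c" 
    using nonneg[of "axis undefined 1"] by (simp add: norm_axis_1)
  ultimately show ?thesis using power2_le_imp_le by blast
qed

lemma tendsto_0_affine_recursion:
  fixes x y :: "nat \<Rightarrow> 'a::real_normed_vector"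
  assumes rec: "\<And>m. norm (x (Suc m)) \<le> q * norm (x m) + norm (y m)"
    and q: "0 \<le> q" "q < 1" and y: "y \<longlonglongrightarrow> 0"
  shows "x \<longlonglongrightarrow> 0"
proof (rule LIMSEQ_I)
  fix e :: real assume e: "0 < e"
  define \<eta> where "\<eta> = e * (1 - q) / 2"
  have "0 < \<eta>" using e q by (simp add: \<eta>_def)
  then obtain N where N: "\<And>m. m \<ge> N \<Longrightarrow> norm (y m) < \<eta>"
    using LIMSEQ_D[OF y] by force
  have bnd: "norm (x (N + k)) \<le> q ^ k * norm (x N) + e / 2" for k
  proof (induction k)
    case (Suc k)
    have "norm (x (N + Suc k)) \<le> q * norm (x (N + k)) + \<eta>"
      using rec[of "N + k"] N[of "N + k"] by simp
    also have "\<dots> \<le> q * (q ^ k * norm (x N) + e / 2) + \<eta>"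
      using Suc q by (intro add_mono mult_left_mono) auto
    also have "\<dots> = q ^ Suc k * norm (x N) + e / 2" by (simp add: \<eta>_def algebra_simps diff_divide_distrib)
    finally show ?case .
  qed (use e in simp)
  have "(\<lambda>k. q ^ k * norm (x N)) \<longlonglongrightarrow> 0 * norm (x N)"
    by (intro tendsto_intros LIMSEQ_realpow_zero q)
  then have "(\<lambda>k. q ^ k * norm (x N)) \<longlonglongrightarrow> 0" by simp
  then obtain K where K: "\<And>k. k \<ge> K \<Longrightarrow> norm (q ^ k * norm (x N)) < e / 2"
    using LIMSEQ_D[of _ 0 "e/2"] e by (metis diff_zero half_gt_zero)
  show "\<exists>no. \<forall>n\<ge>no. norm (x n - 0) < e"
  proof (intro exI allI impI)
    fix n assume "n \<ge> N + K"
    then obtain k where "n = N + k" "k \<ge> K" by (metis add.assoc le_Suc_ex le_add1)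
    then show "norm (x n - 0) < e" using bnd[of k] K[of k] q by simp
  qed
qed

text \<open>In finite dimension the orbit of a vector is linearly dependent, or it repeats a value. The
  coefficient of highest index is made nonzero, so that the polynomial has degree \<open>n\<close>.\<close>

lemma exists_annihilating_coeffs:
  fixes f :: "'a::euclidean_space \<Rightarrow> 'a"
  obtains c :: "nat \<Rightarrow> real" and n where "c n \<noteq> 0" "(\<Sum>k\<le>n. c k *\<^sub>R (f ^^ k) x) = 0"
proof (cases "inj (\<lambda>k. (f ^^ k) x)")
  case True
  define m where "m = DIM('a)"
  define S where "S = (\<lambda>k. (f ^^ k) x) ` {..m}"
  have "card S = Suc m" unfolding S_def
    using True by (subst card_image) (auto simp: inj_on_def)
  then have "dependent S" by (intro dependent_biggerset) (auto simp: m_def)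
  moreover have "finite S" by (simp add: S_def)
  ultimately obtain u v where u: "v \<in> S" "u v \<noteq> 0" "(\<Sum>w\<in>S. u w *\<^sub>R w) = 0"
    by (auto simp: dependent_finite)
  define c where "c k = (if k \<le> m then u ((f ^^ k) x) else 0)" for k
  have "(\<Sum>k\<le>m. c k *\<^sub>R (f ^^ k) x) = 0"
    using u(3) True unfolding S_def
    by (subst (asm) sum.reindex) (auto simp: inj_on_def c_def)
  moreover obtain k where k: "k \<le> m" "c k \<noteq> 0" using u(1,2) by (auto simp: S_def c_def)
  define n where "n = Max {k. k \<le> m \<and> c k \<noteq> 0}"
  have "n \<in> {k. k \<le> m \<and> c k \<noteq> 0}"
    unfolding n_def by (intro Max_in) (use k in auto)
  moreover have "(\<Sum>k\<le>m. c k *\<^sub>R (f ^^ k) x) = (\<Sum>k\<le>n. c k *\<^sub>R (f ^^ k) x)"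
  proof (rule sum.mono_neutral_right)
    show "\<forall>i\<in>{..m} - {..n}. c i *\<^sub>R (f ^^ i) x = 0"
    proof
      fix i assume i: "i \<in> {..m} - {..n}"
      have "c i = 0"
      proof (rule ccontr)
        assume "c i \<noteq> 0"
        then have "i \<le> n" unfolding n_def using i by (intro Max_ge) auto
        with i show False by simp
      qed
      then show "c i *\<^sub>R (f ^^ i) x = 0" by simp
    qed
  qed (use calculation in auto)
  ultimately show ?thesis using that[of c n] by auto
next
  case False
  then obtain i j where ij: "i < j" "(f ^^ i) x = (f ^^ j) x"
    unfolding inj_def by (metis linorder_neqE_nat)
  define c :: "nat \<Rightarrow> real" where "c k = (if k = j then 1 else if k = i then - 1 else 0)" for k
  have "(\<Sum>k\<le>j. c k *\<^sub>R (f ^^ k) x) = (\<Sum>k\<in>{i, j}. c k *\<^sub>R (f ^^ k) x)"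
    using ij by (intro sum.mono_neutral_right) (auto simp: c_def)
  also have "\<dots> = 0" using ij by (simp add: c_def)
  finally show ?thesis using that[of c j] by (simp add: c_def)
qed


definition poly_act :: "complex poly \<Rightarrow> complex ^ 'n ^ 'n \<Rightarrow> complex ^ 'n \<Rightarrow> complex ^ 'n" where
  "poly_act p B v = (\<Sum>k\<le>degree p. coeff p k *s ((*v) B ^^ k) v)"

lemma poly_act_eq_sum:
  assumes "degree p \<le> n"
  shows "poly_act p B v = (\<Sum>k\<le>n. coeff p k *s ((*v) B ^^ k) v)"
  unfolding poly_act_def using assms
  by (intro sum.mono_neutral_left) (auto simp: coeff_eq_0)

lemma poly_act_linear_factor:
  "poly_act ([:- z, 1:] * q) B v = B *v poly_act q B v - z *s poly_act q B v"
proof -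
  let ?p = "[:- z, 1:] * q" and ?n = "degree q"
  have eq: "?p = pCons 0 q - smult z q" by simp
  have "degree ?p \<le> Suc ?n" using degree_mult_le[of "[:- z, 1:]" q] by simp
  then have "poly_act ?p B v = (\<Sum>k\<le>Suc ?n. coeff ?p k *s ((*v) B ^^ k) v)"
    by (rule poly_act_eq_sum)
  also have "\<dots> = (\<Sum>k\<le>Suc ?n. coeff (pCons 0 q) k *s ((*v) B ^^ k) v)
      - (\<Sum>k\<le>Suc ?n. z *s (coeff q k *s ((*v) B ^^ k) v))"
    unfolding eq by (simp only: coeff_diff coeff_smult vector_sub_rdistrib sum_subtractf
        vector_smult_assoc)
  also have "(\<Sum>k\<le>Suc ?n. coeff (pCons 0 q) k *s ((*v) B ^^ k) v)
      = (\<Sum>k\<le>?n. B *v (coeff q k *s ((*v) B ^^ k) v))"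
    by (subst sum.atMost_Suc_shift) (simp add: vector_scalar_commute)
  also have "\<dots> = B *v poly_act q B v"
    by (simp add: poly_act_def vec.linear_sum[OF matrix_vector_mul_linear_gen, unfolded o_def])
  also have "(\<Sum>k\<le>Suc ?n. z *s (coeff q k *s ((*v) B ^^ k) v)) = z *s poly_act q B v"
    unfolding poly_act_eq_sum[of q "Suc ?n" B v, OF le_SucI[OF order_refl]]
    by (simp add: vec.scale_sum_right)
  finally show ?thesis .
qed

lemma funpow_matrix_linear: 
  fixes B :: "complex ^ 'n ^ 'n"
  shows "((*v) B ^^ m) (B *v x - z *s x) = B *v ((*v) B ^^ m) x - z *s ((*v) B ^^ m) x"
proof (induction m)
  case (Suc m)
  then show ?case
    by (simp add: matrix_vector_mult_diff_distrib vector_scalar_commute)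
qed simp

text \<open>The vectors on which the scaled powers of \<open>B\<close> tend to zero absorb every factor \<open>B - z\<close>: for an
  eigenvalue \<open>z\<close> this is a contracting recursion, and otherwise \<open>B - z\<close> has a continuous left
  inverse.\<close>

lemma scaled_powers_absorb_factor:
  fixes B :: "complex ^ 'n ^ 'n"
  assumes r: "0 < r" and eig: "\<And>v. v \<noteq> 0 \<Longrightarrow> B *v v = z *s v \<Longrightarrow> cmod z < r"
    and lim: "(\<lambda>m. (1 / r ^ m) *\<^sub>R ((*v) B ^^ m) (B *v x - z *s x)) \<longlonglongrightarrow> 0"
  shows "(\<lambda>m. (1 / r ^ m) *\<^sub>R ((*v) B ^^ m) x) \<longlonglongrightarrow> 0"
proof (cases "\<exists>v. v \<noteq> 0 \<and> B *v v = z *s v")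
  case True
  then have z: "cmod z < r" using eig by blast
  let ?a = "\<lambda>m. (1 / r ^ m) *\<^sub>R ((*v) B ^^ m) x"
  let ?y = "\<lambda>m. (1 / r ^ m) *\<^sub>R ((*v) B ^^ m) (B *v x - z *s x)"
  show ?thesis
  proof (rule tendsto_0_affine_recursion[where q = "cmod z / r" and y = "\<lambda>m. (1 / r) *\<^sub>R ?y m"])
    fix m
    have "?a (Suc m) = (1 / r) *\<^sub>R (z *s ?a m) + (1 / r) *\<^sub>R ?y m"
      unfolding funpow_matrix_linear funpow.simps(2) o_apply using r
      by (simp only: vec_eq_iff vector_add_component vector_minus_component
          vector_scaleR_component vector_smult_component) (simp add: scaleR_conv_of_real field_simps)
    also have "norm \<dots> \<le> norm ((1 / r) *\<^sub>R (z *s ?a m)) + norm ((1 / r) *\<^sub>R ?y m)"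
      by (rule norm_triangle_ineq)
    also have "norm ((1 / r) *\<^sub>R (z *s ?a m)) = (cmod z / r) * norm (?a m)"
      using r by (simp add: norm_vector_smult)
    finally show "norm (?a (Suc m)) \<le> (cmod z / r) * norm (?a m) + norm ((1 / r) *\<^sub>R ?y m)" .
  next
    show "(\<lambda>m. (1 / r) *\<^sub>R ?y m) \<longlonglongrightarrow> 0"
      using tendsto_scaleR[OF tendsto_const[of "1 / r"] lim] by simp
  qed (use r z in auto)
next
  case False
  define g where "g v = B *v v - z *s v" for v
  have lin: "linear g"
    unfolding g_def by (intro linearI)
      (auto simp: matrix_vector_right_distrib vector_add_ldistrib vec_eq_iff matrix_vector_mult_def
        scaleR_sum_right sum.distrib algebra_simps)
  have "inj g" unfolding linear_injective_0[OF lin] using False by (auto simp: g_def)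
  then obtain h where h: "linear h" "h \<circ> g = id"
    using linear_injective_left_inverse[OF lin] by blast
  have "(\<lambda>m. h ((1 / r ^ m) *\<^sub>R ((*v) B ^^ m) (B *v x - z *s x))) \<longlonglongrightarrow> h 0"
    using linear_continuous_at[of h 0] h(1) lim
    by (intro isCont_tendsto_compose[of _ h]) (auto simp: linear_conv_bounded_linear)
  moreover have "h ((1 / r ^ m) *\<^sub>R ((*v) B ^^ m) (B *v x - z *s x)) = (1 / r ^ m) *\<^sub>R ((*v) B ^^ m) x" for m
    using h(2) unfolding funpow_matrix_linear
    by (simp add: linear_scale[OF h(1)] fun_eq_iff g_def)
  ultimately show ?thesis using linear_0[OF h(1)] by simp
qed

lemma scaled_powers_absorb_poly:
  fixes B :: "complex ^ 'n ^ 'n"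
  assumes r: "0 < r" and eig: "\<And>z v. v \<noteq> 0 \<Longrightarrow> B *v v = z *s v \<Longrightarrow> cmod z < r"
  shows "p \<noteq> 0 \<Longrightarrow> poly_act p B x = 0 \<Longrightarrow>
    (\<lambda>m. (1 / r ^ m) *\<^sub>R ((*v) B ^^ m) x) \<longlonglongrightarrow> 0"
proof -
  have "(\<lambda>m. (1 / r ^ m) *\<^sub>R ((*v) B ^^ m) x) \<longlonglongrightarrow> 0"
    if "p \<noteq> 0" "(\<lambda>m. (1 / r ^ m) *\<^sub>R ((*v) B ^^ m) (poly_act p B x)) \<longlonglongrightarrow> 0"
    using that
  proof (induction "degree p" arbitrary: p)
    case 0
    then obtain c where p: "p = [:c:]" "c \<noteq> 0" by (metis degree_eq_zeroE pCons_0_0)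
    have "((*v) B ^^ m) (c *s x) = c *s ((*v) B ^^ m) x" for m
      by (induction m) (auto simp: vector_scalar_commute)
    then have "(\<lambda>m. c *s ((1 / r ^ m) *\<^sub>R ((*v) B ^^ m) x)) \<longlonglongrightarrow> 0"
      using 0(3) p by (simp add: poly_act_def vec_eq_iff vector_scalar_mult_def[abs_def] scaleR_vec_def)
    then have "(\<lambda>m. norm (c *s ((1 / r ^ m) *\<^sub>R ((*v) B ^^ m) x))) \<longlonglongrightarrow> 0"
      by (rule tendsto_norm_zero)
    then have "(\<lambda>m. cmod c * norm ((1 / r ^ m) *\<^sub>R ((*v) B ^^ m) x)) \<longlonglongrightarrow> 0"
      by (simp only: norm_vector_smult)
    then have "(\<lambda>m. inverse (cmod c) * (cmod c * norm ((1 / r ^ m) *\<^sub>R ((*v) B ^^ m) x))) \<longlonglongrightarrow> inverse (cmod c) * 0"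
      by (intro tendsto_intros)
    then have "(\<lambda>m. norm ((1 / r ^ m) *\<^sub>R ((*v) B ^^ m) x)) \<longlonglongrightarrow> 0"
      using p(2) by (simp only: mult.assoc[symmetric]) simp
    then show ?case by (rule tendsto_norm_zero_cancel)
  next
    case (Suc n)
    then have "\<not> constant (poly p)" by (simp add: constant_degree)
    then obtain z where "poly p z = 0" using fundamental_theorem_of_algebra by blast
    then obtain q where q: "p = [:- z, 1:] * q" by (metis dvdE poly_eq_0_iff_dvd)
    with Suc have "q \<noteq> 0" by auto
    then have "n = degree q"
      using Suc(2) degree_mult_eq[of "[:- z, 1:]" q] unfolding q by simp
    moreover have "(\<lambda>m. (1 / r ^ m) *\<^sub>R ((*v) B ^^ m) (poly_act q B x)) \<longlonglongrightarrow> 0"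
    proof (rule scaled_powers_absorb_factor[OF r])
      show "cmod z < r" if "v \<noteq> 0" "B *v v = z *s v" for v using eig that by blast
      show "(\<lambda>m. (1 / r ^ m) *\<^sub>R ((*v) B ^^ m)
          (B *v poly_act q B x - z *s poly_act q B x)) \<longlonglongrightarrow> 0"
        using Suc(4) unfolding q poly_act_linear_factor .
    qed
    ultimately show ?case using Suc(1) \<open>q \<noteq> 0\<close> by blast
  qed
  moreover have "((*v) B ^^ m) 0 = 0" for m by (induction m) auto
  ultimately show "p \<noteq> 0 \<Longrightarrow> poly_act p B x = 0 \<Longrightarrow>
    (\<lambda>m. (1 / r ^ m) *\<^sub>R ((*v) B ^^ m) x) \<longlonglongrightarrow> 0" by simp
qed

text \<open>The part of Gelfand's formula that bounds growth by the spectral radius, vector by vector: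
  every vector is annihilated by a polynomial in the matrix, which is a product of linear factors.\<close>

lemma mat_pow_tendsto_0:
  fixes A :: "real ^ 'd ^ 'd"
  assumes r: "spectral_radius A < r"
  shows "(\<lambda>m. (1 / r ^ m) *\<^sub>R (mat_pow A m *v x)) \<longlonglongrightarrow> 0"
proof -
  define B where "B = map_matrix complex_of_real A"
  define cv :: "real ^ 'd \<Rightarrow> complex ^ 'd" where "cv x = (\<chi> i. complex_of_real (x $ i))" for x
  have cv: "((*v) B ^^ m) (cv x) = cv (mat_pow A m *v x)" for m x
  proof (induction m)
    case (Suc m)
    have "B *v cv y = cv (A *v y)" for y
      by (simp add: B_def cv_def vec_eq_iff matrix_vector_mult_def map_matrix_def)
    then show ?case using Suc by (simp add: mat_pow_Suc_vec)
  qed simp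
  have r0: "0 < r"
    using r spectral_radius_attained[of A] by (metis norm_ge_zero order_le_less_trans)
  have eig: "cmod z < r" if "v \<noteq> 0" "B *v v = z *s v" for z v
    using that r cmod_le_spectral_radius[of z A] unfolding mat_spectrum_def B_def
    by (metis (mono_tags, lifting) le_less_trans mem_Collect_eq)
  obtain c :: "nat \<Rightarrow> real" and n where c: "c n \<noteq> 0" "(\<Sum>k\<le>n. c k *\<^sub>R ((*v) A ^^ k) x) = 0"
    using exists_annihilating_coeffs[of "(*v) A" x] by blast
  have iter: "((*v) A ^^ k) x = mat_pow A k *v x" for k
    by (induction k) (auto simp: mat_pow_Suc_vec)
  define p where "p = (\<Sum>k\<le>n. monom (complex_of_real (c k)) k)"
  have coeff: "coeff p k = (if k \<le> n then complex_of_real (c k) else 0)" for k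
    by (simp add: p_def coeff_sum)
  have "p \<noteq> 0" using coeff[of n] c(1) by auto
  moreover have "poly_act p B (cv x) = 0"
  proof -
    have "degree p \<le> n" by (intro degree_le) (simp add: coeff)
    then have "poly_act p B (cv x) = (\<Sum>k\<le>n. complex_of_real (c k) *s cv (mat_pow A k *v x))"
      by (simp add: poly_act_eq_sum coeff cv)
    also have "\<dots> = cv (\<Sum>k\<le>n. c k *\<^sub>R (mat_pow A k *v x))"
      by (simp add: cv_def vec_eq_iff)
    finally show ?thesis using c(2) by (simp add: iter) (simp add: cv_def vec_eq_iff)
  qed
  ultimately have "(\<lambda>m. (1 / r ^ m) *\<^sub>R ((*v) B ^^ m) (cv x)) \<longlonglongrightarrow> 0"
    using scaled_powers_absorb_poly[OF r0, of B p] eig by blast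
  then have "(\<lambda>m. norm ((1 / r ^ m) *\<^sub>R cv (mat_pow A m *v x))) \<longlonglongrightarrow> 0"
    unfolding cv by (rule tendsto_norm_zero)
  moreover have "norm (cv y) = norm y" for y by (simp add: norm_vec_def cv_def)
  ultimately have "(\<lambda>m. norm ((1 / r ^ m) *\<^sub>R (mat_pow A m *v x))) \<longlonglongrightarrow> 0"
    by simp
  then show ?thesis by (rule tendsto_norm_zero_cancel)
qed

section \<open>The matrix exponential\<close>

lemma norm_mat_pow_le: "norm (mat_pow A m) \<le> norm A ^ m * norm (mat 1 :: real ^ 'd ^ 'd)"
  for A :: "real ^ 'd ^ 'd"
proof (induction m)
  case (Suc m)
  have "norm (mat_pow A (Suc m)) \<le> norm A * norm (mat_pow A m)"
    by (simp add: mat_pow_Suc norm_matrix_mult_le)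
  also have "\<dots> \<le> norm A * (norm A ^ m * norm (mat 1 :: real ^ 'd ^ 'd))"
    using Suc by (intro mult_left_mono) auto
  finally show ?case by simp
qed simp

lemma norm_mat_pow_vec_le: "norm (mat_pow A m *v x) \<le> norm A ^ m * norm x"
proof (induction m)
  case (Suc m)
  have "norm (mat_pow A (Suc m) *v x) \<le> norm A * norm (mat_pow A m *v x)"
    by (simp add: mat_pow_Suc_vec norm_matrix_vector_mult_le)
  also have "\<dots> \<le> norm A * (norm A ^ m * norm x)"
    using Suc by (intro mult_left_mono) auto
  finally show ?case by simp
qed simp

lemma summable_power_over_fact: "summable (\<lambda>m. c ^ m / fact m :: real)"
  using summable_exp[of c] by (simp add: field_simps)

lemma summable_mat_exp: "summable (\<lambda>m. (1 / fact m) *\<^sub>R mat_pow A m)"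
  for A :: "real ^ 'd ^ 'd"
proof (rule summable_comparison_test)
  show "summable (\<lambda>m. norm (mat 1 :: real ^ 'd ^ 'd) * (norm A ^ m / fact m))"
    by (intro summable_mult summable_power_over_fact)
  show "\<exists>N. \<forall>m\<ge>N. norm ((1 / fact m) *\<^sub>R mat_pow A m)
      \<le> norm (mat 1 :: real ^ 'd ^ 'd) * (norm A ^ m / fact m)"
    using norm_mat_pow_le[of A] by (intro exI[of _ 0]) (simp add: divide_simps mult.commute)
qed

lemma mat_pow_commute: "mat_pow A m ** A = A ** mat_pow A m"
  by (induction m) (simp_all add: mat_pow_Suc flip: matrix_mul_assoc)

lemma mat_pow_scaleR: "mat_pow (t *\<^sub>R A) m = t ^ m *\<^sub>R mat_pow A m" for A :: "real ^ 'd ^ 'd"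
  by (induction m)
     (simp_all add: mat_pow_Suc mat_mult.scaleR_left
        mat_mult.scaleR_right)

lemma mat_exp_0 [simp]: "mat_exp 0 = (mat 1 :: real ^ 'd ^ 'd)"
proof -
  have "mat_pow (0 :: real ^ 'd ^ 'd) m = (if m = 0 then mat 1 else 0)" for m
    by (cases m) (auto simp: mat_pow_Suc mat_mult.zero_left)
  then have "(\<lambda>m. (1 / fact m) *\<^sub>R mat_pow (0 :: real ^ 'd ^ 'd) m)
      = (\<lambda>m. if m = 0 then mat 1 else 0)"
    by (auto simp: fun_eq_iff)
  then show ?thesis
    unfolding mat_exp_def using suminf_finite[of "{0}" "\<lambda>m. if m = 0 then mat 1 else (0 :: real ^ 'd ^ 'd)"]
    by simp
qed

lemma mat_exp_commute: "mat_exp A ** A = A ** mat_exp A" for A :: "real ^ 'd ^ 'd"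
proof -
  have "mat_exp A ** A = (\<Sum>m. ((1 / fact m) *\<^sub>R mat_pow A m) ** A)"
    unfolding mat_exp_def
    by (rule bounded_linear.suminf[OF mat_mult.bounded_linear_left summable_mat_exp])
  also have "\<dots> = (\<Sum>m. A ** ((1 / fact m) *\<^sub>R mat_pow A m))"
    by (simp add: mat_pow_commute mat_mult.scaleR_left
        mat_mult.scaleR_right)
  also have "\<dots> = A ** mat_exp A"
    unfolding mat_exp_def
    by (rule bounded_linear.suminf[OF mat_mult.bounded_linear_right summable_mat_exp, symmetric])
  finally show ?thesis .
qed

lemma norm_mat_exp_vec_le: "norm (mat_exp A *v x) \<le> exp (norm A) * norm x"
  for A :: "real ^ 'd ^ 'd"
proof -
  have "mat_exp A *v x = (\<Sum>m. ((1 / fact m) *\<^sub>R mat_pow A m) *v x)"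
    unfolding mat_exp_def
    by (rule bounded_linear.suminf[OF mat_vec.bounded_linear_left summable_mat_exp])
  also have "norm \<dots> \<le> (\<Sum>m. norm A ^ m / fact m * norm x)"
  proof (rule norm_suminf_le)
    show "norm (((1 / fact m) *\<^sub>R mat_pow A m) *v x) \<le> norm A ^ m / fact m * norm x" for m
      using norm_mat_pow_vec_le[of A m x]
      by (simp add: mat_vec.scaleR_left divide_simps)
    show "summable (\<lambda>m. norm A ^ m / fact m * norm x)"
      by (intro summable_mult2 summable_power_over_fact)
  qed
  also have "\<dots> = exp (norm A) * norm x"
    unfolding exp_def by (subst suminf_mult2[symmetric]) (auto simp: summable_power_over_fact field_simps)
  finally show ?thesis .
qed

text \<open>Entry by entry the exponential is an everywhere convergent real power series.\<close>

lemma mat_exp_has_vector_derivative: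
  fixes A :: "real ^ 'd ^ 'd"
  shows "((\<lambda>t. mat_exp (t *\<^sub>R A)) has_vector_derivative A ** mat_exp (t *\<^sub>R A)) (at t within S)"
proof -
  have comp: "((\<lambda>t. mat_exp (t *\<^sub>R A) $ i $ j) has_field_derivative (A ** mat_exp (t *\<^sub>R A)) $ i $ j) (at t)"
    for i j
  proof -
    define c where "c m = mat_pow A m $ i $ j / fact m" for m
    have bl: "bounded_linear (\<lambda>M :: real ^ 'd ^ 'd. M $ i $ j)"
      by (intro bounded_linear_compose[OF bounded_linear_vec_nth bounded_linear_vec_nth])
    have series: "mat_exp (y *\<^sub>R A) $ i $ j = (\<Sum>m. c m * y ^ m)" "summable (\<lambda>m. c m * y ^ m)" for y
    proof -
      have eq: "((1 / fact m) *\<^sub>R mat_pow (y *\<^sub>R A) m) $ i $ j = c m * y ^ m" for m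
        by (simp add: c_def mat_pow_scaleR)
      show "mat_exp (y *\<^sub>R A) $ i $ j = (\<Sum>m. c m * y ^ m)"
        unfolding mat_exp_def bounded_linear.suminf[OF bl summable_mat_exp] eq ..
      show "summable (\<lambda>m. c m * y ^ m)"
        using bounded_linear.summable[OF bl summable_mat_exp[of "y *\<^sub>R A"]] unfolding eq .
    qed
    have "((\<lambda>x. \<Sum>m. c m * x ^ m) has_field_derivative (\<Sum>m. diffs c m * t ^ m)) (at t)"
      by (rule termdiffs_strong_converges_everywhere) (rule series)
    also have "(\<Sum>m. diffs c m * t ^ m) = (A ** mat_exp (t *\<^sub>R A)) $ i $ j"
    proof -
      have bl2: "bounded_linear (\<lambda>M :: real ^ 'd ^ 'd. (A ** M) $ i $ j)"
        by (rule bounded_linear_compose[OF bl mat_mult.bounded_linear_right])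
      have eq: "(A ** ((1 / fact m) *\<^sub>R mat_pow (t *\<^sub>R A) m)) $ i $ j = diffs c m * t ^ m" for m
        by (simp add: diffs_def c_def mat_pow_scaleR mat_pow_Suc
            mat_mult.scaleR_right divide_simps)
      show ?thesis
        unfolding mat_exp_def bounded_linear.suminf[OF bl2 summable_mat_exp] eq ..
    qed
    finally show ?thesis unfolding series(1) .
  qed
  show ?thesis
    unfolding has_vector_derivative_def
  proof (subst has_derivative_componentwise_within, intro ballI)
    fix b :: "real ^ 'd ^ 'd" assume "b \<in> Basis"
    then obtain i j where b: "b = axis i (axis j 1)"
      by (auto simp: Basis_vec_def)
    have "((\<lambda>t. mat_exp (t *\<^sub>R A) $ i $ j) has_vector_derivative (A ** mat_exp (t *\<^sub>R A)) $ i $ j) (at t within S)"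
      using comp[of i j] has_field_derivative_at_within
      by (metis has_real_derivative_iff_has_vector_derivative)
    then show "((\<lambda>t. mat_exp (t *\<^sub>R A) \<bullet> b) has_derivative
        (\<lambda>x. (x *\<^sub>R (A ** mat_exp (t *\<^sub>R A))) \<bullet> b)) (at t within S)"
      by (simp add: b inner_axis has_vector_derivative_def)
  qed
qed

text \<open>The function \<open>exp ((t - u) A) \<Phi> u\<close> of \<open>u\<close> has derivative zero inside the interval.\<close>

lemma linear_ode_solution:
  fixes A :: "real ^ 'd ^ 'd"
  assumes "s \<le> t" and cont: "continuous_on {s..t} \<Phi>"
    and deriv: "\<And>u. s < u \<Longrightarrow> u < t \<Longrightarrow> (\<Phi> has_vector_derivative A ** \<Phi> u) (at u)"
  shows "\<Phi> t = mat_exp ((t - s) *\<^sub>R A) ** \<Phi> s"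
proof -
  define \<Psi> where "\<Psi> u = mat_exp ((t - u) *\<^sub>R A) ** \<Phi> u" for u
  have dE: "((\<lambda>u. mat_exp ((t - u) *\<^sub>R A)) has_vector_derivative - (A ** mat_exp ((t - u) *\<^sub>R A))) (at u within S)"
    for u S
  proof -
    have "((\<lambda>u. t - u) has_vector_derivative - 1) (at u within S)"
      by (auto simp: has_real_derivative_iff_has_vector_derivative[symmetric] intro!: derivative_eq_intros)
    from vector_diff_chain_within[OF this mat_exp_has_vector_derivative]
    show ?thesis by (simp add: o_def)
  qed
  have cE: "continuous_on {s..t} (\<lambda>u. mat_exp ((t - u) *\<^sub>R A))"
    using dE by (intro continuous_on_vector_derivative) blast
  have "\<Psi> t = \<Psi> s"
  proof (rule has_derivative_zero_unique_strong_interval[of "{s, t}" s t \<Psi>])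
    show "continuous_on {s..t} \<Psi>"
      unfolding \<Psi>_def by (intro mat_mult.continuous_on cE cont)
  next
    fix u assume u: "u \<in> {s..t} - {s, t}"
    then have "(\<Phi> has_vector_derivative A ** \<Phi> u) (at u)" using deriv by auto
    then have "(\<Psi> has_vector_derivative
        mat_exp ((t - u) *\<^sub>R A) ** (A ** \<Phi> u) + - (A ** mat_exp ((t - u) *\<^sub>R A)) ** \<Phi> u) (at u)"
      unfolding \<Psi>_def
      by (intro mat_mult.has_vector_derivative dE)
    moreover have "mat_exp ((t - u) *\<^sub>R A) ** A = A ** mat_exp ((t - u) *\<^sub>R A)"
    proof (cases "t = u")
      case False
      then show ?thesis
        using mat_exp_commute[of "(t - u) *\<^sub>R A"]
        by (simp add: mat_mult.scaleR_left
            mat_mult.scaleR_right)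
    qed simp
    ultimately have "(\<Psi> has_vector_derivative 0) (at u)"
      by (simp add: matrix_mul_assoc mat_mult.minus_left)
    then show "(\<Psi> has_derivative (\<lambda>h. 0)) (at u within {s..t})"
      by (simp add: has_vector_derivative_def has_derivative_at_withinI)
  qed (use assms(1) in auto)
  then show ?thesis by (simp add: \<Psi>_def)
qed

lemma mat_exp_add:
  fixes A :: "real ^ 'd ^ 'd"
  assumes "0 \<le> t"
  shows "mat_exp ((t + s) *\<^sub>R A) = mat_exp (t *\<^sub>R A) ** mat_exp (s *\<^sub>R A)"
proof -
  have "mat_exp ((t + s) *\<^sub>R A) = mat_exp ((t + s - s) *\<^sub>R A) ** mat_exp (s *\<^sub>R A)"
  proof (rule linear_ode_solution)
    show "continuous_on {s..t + s} (\<lambda>t. mat_exp (t *\<^sub>R A))"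
      by (rule continuous_on_vector_derivative) (rule mat_exp_has_vector_derivative)
  qed (use assms mat_exp_has_vector_derivative in auto)
  then show ?thesis by simp
qed

lemma mat_exp_minus: "0 \<le> t \<Longrightarrow> mat_exp (t *\<^sub>R A) ** mat_exp (- t *\<^sub>R A) = mat 1"
  for A :: "real ^ 'd ^ 'd"
  using mat_exp_add[of t "- t" A] by simp

lemma mat_exp_minus': "0 \<le> t \<Longrightarrow> mat_exp (- t *\<^sub>R A) ** mat_exp (t *\<^sub>R A) = mat 1"
  for A :: "real ^ 'd ^ 'd"
  using mat_exp_minus[of t A] by (simp add: matrix_left_right_inverse)

lemma tendsto_mat_exp:
  fixes A :: "real ^ 'd ^ 'd"
  assumes "(f \<longlongrightarrow> t) F"
  shows "((\<lambda>x. mat_exp (f x *\<^sub>R A)) \<longlongrightarrow> mat_exp (t *\<^sub>R A)) F"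
proof -
  have "isCont (\<lambda>t. mat_exp (t *\<^sub>R A)) t"
    using mat_exp_has_vector_derivative has_vector_derivative_continuous by blast
  then show ?thesis using assms isCont_tendsto_compose by blast
qed

section \<open>Words and flows\<close>

text \<open>A word lists the modes and durations of consecutive pieces, the first one applied first.\<close>

fun word_flow :: "('n \<Rightarrow> real ^ 'd ^ 'd) \<Rightarrow> ('n \<times> real) list \<Rightarrow> real ^ 'd ^ 'd" where
  "word_flow A [] = mat 1"
| "word_flow A ((i, s) # ws) = word_flow A ws ** mat_exp (s *\<^sub>R A i)"

definition duration :: "('n \<times> real) list \<Rightarrow> real" where
  "duration ws = sum_list (map snd ws)"

definition words :: "'n set \<Rightarrow> ('n \<times> real) list set" where
  "words J = lists (J \<times> {0..})"

lemma duration_simps [simp]: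
  "duration [] = 0" "duration (p # ws) = snd p + duration ws"
  "duration (us @ ws) = duration us + duration ws"
  by (simp_all add: duration_def)

lemma words_simps [simp]:
  "[] \<in> words J" "p # ws \<in> words J \<longleftrightarrow> fst p \<in> J \<and> 0 \<le> snd p \<and> ws \<in> words J"
  "us @ ws \<in> words J \<longleftrightarrow> us \<in> words J \<and> ws \<in> words J"
  by (cases p; auto simp: words_def)+

lemma words_mono: "J \<subseteq> K \<Longrightarrow> ws \<in> words J \<Longrightarrow> ws \<in> words K"
  by (auto simp: words_def lists_eq_set)

lemma duration_nonneg: "ws \<in> words J \<Longrightarrow> 0 \<le> duration ws"
  by (induction ws) auto

lemma word_flow_append: "word_flow A (us @ ws) = word_flow A ws ** word_flow A us"
proof (induction us)
  case (Cons p us)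
  then show ?case by (cases p) (simp add: matrix_mul_assoc)
qed simp

lemma exp_prod_eq_word_flow:
  "exp_prod A i t k = word_flow A (map (\<lambda>j. (i j, t j)) [1..<Suc k])"
  by (induction k) (simp_all add: word_flow_append del: One_nat_def)

lemma duration_upt: "duration (map (\<lambda>j. (i j, t j)) [1..<Suc k]) = (\<Sum>j=1..k. t j)"
  by (induction k) simp_all

lemma fundamental_solution_piece:
  assumes \<Phi>: "fundamental_solution A \<sigma> \<Phi>" and "0 \<le> s" "s \<le> t"
    and const: "\<And>u. s \<le> u \<Longrightarrow> u < t \<Longrightarrow> \<sigma> u = i"
  shows "\<Phi> t = mat_exp ((t - s) *\<^sub>R A i) ** \<Phi> s"
proof (rule linear_ode_solution[OF \<open>s \<le> t\<close>])
  show "continuous_on {s..t} \<Phi>"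
    using \<Phi> \<open>0 \<le> s\<close> unfolding fundamental_solution_def by (auto elim: continuous_on_subset)
  fix u assume u: "s < u" "u < t"
  then have "\<forall>\<^sub>F v in at u. v \<in> {s<..<t}"
    by (intro eventually_at_in_open') auto
  then have "\<forall>\<^sub>F v in at u. \<sigma> v = \<sigma> u"
    by eventually_elim (use const u in auto)
  then show "(\<Phi> has_vector_derivative A i ** \<Phi> u) (at u)"
    using \<Phi> u \<open>0 \<le> s\<close> const[of u] unfolding fundamental_solution_def by fastforce
qed

definition breakpoints :: "(real \<Rightarrow> 'n) \<Rightarrow> (nat \<Rightarrow> real) \<Rightarrow> bool" where
  "breakpoints \<sigma> b \<longleftrightarrow> b 0 = 0 \<and> strict_mono b \<and> filterlim b at_top sequentially \<and>
     (\<forall>k. \<forall>s\<in>{b k..<b (Suc k)}. \<sigma> s = \<sigma> (b k))"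

lemma switching_signals_iff: "\<sigma> \<in> switching_signals \<longleftrightarrow> (\<exists>b. breakpoints \<sigma> b)"
  by (simp add: switching_signals_def breakpoints_def)

lemma
  assumes "breakpoints \<sigma> b"
  shows breakpoints_0: "b 0 = 0"
    and breakpoints_strict_mono: "strict_mono b"
    and breakpoints_const: "b k \<le> s \<Longrightarrow> s < b (Suc k) \<Longrightarrow> \<sigma> s = \<sigma> (b k)"
  using assms unfolding breakpoints_def by (simp, simp, metis atLeastLessThan_iff)

lemma breakpoints_unbounded:
  assumes "breakpoints \<sigma> b" obtains K where "t < b K"
  using assms unfolding breakpoints_def filterlim_at_top_dense eventually_sequentially
  by (metis order_refl)

lemma breakpoints_locate:
  assumes b: "breakpoints \<sigma> b" and "0 \<le> t"
  obtains k where "b k \<le> t" "t < b (Suc k)"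
proof -
  obtain K where K: "t < b K" using breakpoints_unbounded[OF b] .
  define k where "k = (LEAST k. t < b k)"
  have k: "t < b k" unfolding k_def by (rule LeastI, rule K)
  have "k \<noteq> 0" using k \<open>0 \<le> t\<close> b by (auto simp: breakpoints_0[OF b] intro!: Nat.gr0I)
  then obtain l where l: "k = Suc l" by (cases k) auto
  then have "\<not> t < b l" using not_less_Least[of l "\<lambda>k. t < b k"] by (simp add: k_def)
  with k l that[of l] show ?thesis by auto
qed

lemma breakpoints_nonneg: "breakpoints \<sigma> b \<Longrightarrow> 0 \<le> b k"
  unfolding breakpoints_def by (metis le0 strict_mono_less_eq)

text \<open>Induction along the pieces of a signal: it is enough to pass from the left end of a piece to any
  point of its closure.\<close>

lemma breakpoints_induct [consumes 2, case_names zero step]: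
  assumes b: "breakpoints \<sigma> b" and "0 \<le> t"
    and zero: "Q 0"
    and step: "\<And>k t i. b k \<le> t \<Longrightarrow> t \<le> b (Suc k) \<Longrightarrow> (\<And>u. b k \<le> u \<Longrightarrow> u < t \<Longrightarrow> \<sigma> u = i) \<Longrightarrow> Q (b k) \<Longrightarrow> Q t"
  shows "Q t"
proof -
  have Q: "Q (b k)" for k
  proof (induction k)
    case (Suc k)
    have "b k \<le> b (Suc k)" using breakpoints_strict_mono[OF b] by (simp add: strict_mono_less_eq)
    then show ?case using breakpoints_const[OF b] by (intro step[of k "b (Suc k)", OF _ _ _ Suc]) auto
  qed (use zero breakpoints_0[OF b] in simp)
  obtain k where k: "b k \<le> t" "t < b (Suc k)" using breakpoints_locate[OF b \<open>0 \<le> t\<close>] .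
  then show ?thesis using breakpoints_const[OF b] by (intro step[of k t, OF _ _ _ Q[of k]]) auto
qed

lemma fundamental_solution_unique:
  assumes \<sigma>: "\<sigma> \<in> switching_signals"
    and "fundamental_solution A \<sigma> \<Phi>" "fundamental_solution A \<sigma> \<Phi>'" and "0 \<le> t"
  shows "\<Phi> t = \<Phi>' t"
proof -
  obtain b where b: "breakpoints \<sigma> b" using \<sigma> switching_signals_iff by blast
  show ?thesis using b \<open>0 \<le> t\<close>
  proof (induction rule: breakpoints_induct)
    case (step k t i)
    have "\<Phi> t = mat_exp ((t - b k) *\<^sub>R A i) ** \<Phi> (b k)"
      by (rule fundamental_solution_piece[OF assms(2) breakpoints_nonneg[OF b]]) (use step in auto)
    moreover have "\<Phi>' t = mat_exp ((t - b k) *\<^sub>R A i) ** \<Phi>' (b k)"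
      by (rule fundamental_solution_piece[OF assms(3) breakpoints_nonneg[OF b]]) (use step in auto)
    ultimately show ?case using step by simp
  qed (use assms in \<open>simp add: fundamental_solution_def\<close>)
qed

text \<open>The solution is glued from its values \<open>E k\<close> at the breakpoints.\<close>

lemma fundamental_solution_exists:
  assumes \<sigma>: "\<sigma> \<in> switching_signals"
  obtains \<Phi> where "fundamental_solution A \<sigma> \<Phi>"
proof -
  obtain b where b: "breakpoints \<sigma> b" using \<sigma> switching_signals_iff by blast
  have b_less: "b k < b (Suc k)" for k
    using breakpoints_strict_mono[OF b] by (simp add: strict_mono_Suc_iff)
  define E where "E = rec_nat (mat 1) (\<lambda>k X. mat_exp ((b (Suc k) - b k) *\<^sub>R A (\<sigma> (b k))) ** X)"
  have E: "E 0 = mat 1" "E (Suc k) = mat_exp ((b (Suc k) - b k) *\<^sub>R A (\<sigma> (b k))) ** E k" for k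
    by (simp_all add: E_def)
  define \<Phi> where "\<Phi> t = (let k = (LEAST k. t < b (Suc k)) in mat_exp ((t - b k) *\<^sub>R A (\<sigma> (b k))) ** E k)" for t
  have \<Phi>_half: "\<Phi> t = mat_exp ((t - b k) *\<^sub>R A (\<sigma> (b k))) ** E k" if "b k \<le> t" "t < b (Suc k)" for t k
  proof -
    have "(LEAST k. t < b (Suc k)) = k"
    proof (rule Least_equality)
      fix l assume "t < b (Suc l)"
      then have "b k < b (Suc l)" using that by simp
      then show "k \<le> l" using breakpoints_strict_mono[OF b] by (simp add: strict_mono_less)
    qed (use that in simp)
    then show ?thesis by (simp add: \<Phi>_def)
  qed
  have \<Phi>_b: "\<Phi> (b k) = E k" for k using \<Phi>_half[of k "b k"] b_less[of k] by simp
  have \<Phi>_eq: "\<Phi> t = mat_exp ((t - b k) *\<^sub>R A (\<sigma> (b k))) ** E k" if "b k \<le> t" "t \<le> b (Suc k)" for t k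
    using that \<Phi>_half[of k t] \<Phi>_b[of "Suc k"] E(2)[of k] by (cases "t = b (Suc k)") auto
  have deriv: "((\<lambda>t. mat_exp ((t - c) *\<^sub>R A i) ** X) has_vector_derivative
      A i ** (mat_exp ((t - c) *\<^sub>R A i) ** X)) (at t within S)" for t c i X S
  proof -
    have "((\<lambda>t. mat_exp ((t - c) *\<^sub>R A i)) has_vector_derivative A i ** mat_exp ((t - c) *\<^sub>R A i)) (at t within S)"
    proof -
      have "((\<lambda>u. u - c) has_vector_derivative 1) (at t within S)"
        by (auto simp: has_real_derivative_iff_has_vector_derivative[symmetric] intro!: derivative_eq_intros)
      from vector_diff_chain_within[OF this mat_exp_has_vector_derivative]
      show ?thesis by (simp add: o_def)
    qed
    from bounded_linear.has_vector_derivative[OF mat_mult.bounded_linear_left this]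
    show ?thesis by (simp add: matrix_mul_assoc)
  qed
  have cont_piece: "continuous_on {b k..b (Suc k)} \<Phi>" for k
  proof -
    have "continuous_on {b k..b (Suc k)} (\<lambda>t. mat_exp ((t - b k) *\<^sub>R A (\<sigma> (b k))) ** E k)"
      by (rule continuous_on_vector_derivative) (rule deriv)
    then show ?thesis by (rule continuous_on_eq) (auto intro: \<Phi>_eq[symmetric])
  qed
  have cont: "continuous_on {0..b K} \<Phi>" for K
  proof (induction K)
    case (Suc K)
    have "{0..b (Suc K)} = {0..b K} \<union> {b K..b (Suc K)}"
      using breakpoints_nonneg[OF b, of K] b_less[of K] by auto
    then show ?case using Suc cont_piece[of K] by (simp add: continuous_on_closed_Un)
  qed (simp add: breakpoints_0[OF b])
  have "fundamental_solution A \<sigma> \<Phi>"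
    unfolding fundamental_solution_def
  proof (intro conjI allI impI)
    show "continuous_on {0..} \<Phi>"
      unfolding continuous_on_eq_continuous_within
    proof
      fix t :: real assume t: "t \<in> {0..}"
      obtain K where K: "t < b K" using breakpoints_unbounded[OF b] .
      then have "continuous (at t within {0..b K}) \<Phi>"
        using cont[of K] t by (simp add: continuous_on_eq_continuous_within)
      moreover have "at t within {0..} = at t within {0..b K}"
        by (rule at_within_nhd[of t "{..<b K}"]) (use K in auto)
      ultimately show "continuous (at t within {0..}) \<Phi>" by simp
    qed
    show "\<Phi> 0 = mat 1" using \<Phi>_b[of 0] E breakpoints_0[OF b] by simp
    fix t :: real assume t: "0 < t" "\<forall>\<^sub>F s in at t. \<sigma> s = \<sigma> t"
    obtain k where k: "b k \<le> t" "t < b (Suc k)" using breakpoints_locate[OF b, of t] t by auto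
    show "(\<Phi> has_vector_derivative A (\<sigma> t) ** \<Phi> t) (at t)"
    proof (cases "b k < t")
      case True
      have "\<sigma> t = \<sigma> (b k)" by (rule breakpoints_const[OF b k])
      moreover have "(\<Phi> has_vector_derivative A (\<sigma> (b k)) ** \<Phi> t) (at t)"
        unfolding \<Phi>_half[OF k]
        by (rule has_vector_derivative_transform_within_open[OF deriv, where S = "{b k<..<b (Suc k)}"])
           (use True k in \<open>auto intro: \<Phi>_half[symmetric]\<close>)
      ultimately show ?thesis by simp
    next
      case False
      then have tk: "t = b k" using k by simp
      then obtain l where l: "k = Suc l" using t breakpoints_0[OF b] by (cases k) auto
      \<comment> \<open>a breakpoint at which the signal does not jump: the formula of the previous piece goes on\<close>
      have "\<forall>\<^sub>F s in at_left t. \<sigma> s = \<sigma> t"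
        using t(2) by (simp add: eventually_at_split)
      moreover have "\<forall>\<^sub>F s in at_left t. s \<in> {b l<..<t}"
        using b_less[of l] tk l by (intro eventually_at_leftI[of "b l"]) auto
      ultimately have "\<forall>\<^sub>F s in at_left t. \<sigma> s = \<sigma> t \<and> s \<in> {b l<..<t}"
        by (rule eventually_conj)
      then obtain s where "\<sigma> s = \<sigma> t" "b l < s" "s < t"
        using eventually_happens trivial_limit_at_left_real by fastforce
      then have \<sigma>: "\<sigma> (b l) = \<sigma> t" "\<sigma> (b k) = \<sigma> t"
        using breakpoints_const[OF b, of l s] l tk by simp_all
      have eq: "\<Phi> u = mat_exp ((u - b l) *\<^sub>R A (\<sigma> t)) ** E l" if "b l \<le> u" "u < b (Suc k)" for u
      proof (cases "u < b k")
        case True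
        then show ?thesis using that \<Phi>_half[of l u] l \<sigma> by simp
      next
        case False
        then have "\<Phi> u = mat_exp ((u - b k) *\<^sub>R A (\<sigma> t)) ** (mat_exp ((b k - b l) *\<^sub>R A (\<sigma> t)) ** E l)"
          using that \<Phi>_half[of k u] l \<sigma> E(2)[of l] by simp
        also have "\<dots> = mat_exp ((u - b k + (b k - b l)) *\<^sub>R A (\<sigma> t)) ** E l"
          using False by (subst mat_exp_add) (auto simp: matrix_mul_assoc)
        finally show ?thesis by simp
      qed
      have bl: "b l < t" using b_less[of l] l tk by simp
      then have "\<Phi> t = mat_exp ((t - b l) *\<^sub>R A (\<sigma> t)) ** E l" using eq[of t] k by simp
      then show ?thesis
        using has_vector_derivative_transform_within_open[OF deriv[of "b l" "\<sigma> t" "E l" t UNIV],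
            where S = "{b l<..<b (Suc k)}" and g = \<Phi>] bl k eq by auto
    qed
  qed
  then show ?thesis using that by blast
qed

lemma flow_eq:
  assumes "\<sigma> \<in> switching_signals" "fundamental_solution A \<sigma> \<Phi>" "0 \<le> t"
  shows "flow A \<sigma> t = \<Phi> t"
  unfolding flow_def
  by (rule the_equality) (use assms fundamental_solution_unique in blast)+

lemma flow_0: "\<sigma> \<in> switching_signals \<Longrightarrow> flow A \<sigma> 0 = mat 1"
  by (metis flow_eq fundamental_solution_def fundamental_solution_exists order_refl)

lemma flow_piece:
  assumes "\<sigma> \<in> switching_signals" "0 \<le> s" "s \<le> t" "\<And>u. s \<le> u \<Longrightarrow> u < t \<Longrightarrow> \<sigma> u = i"
  shows "flow A \<sigma> t = mat_exp ((t - s) *\<^sub>R A i) ** flow A \<sigma> s"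
proof -
  obtain \<Phi> where "fundamental_solution A \<sigma> \<Phi>" using fundamental_solution_exists assms(1) by blast
  then show ?thesis using fundamental_solution_piece[of A \<sigma> \<Phi> s t i] flow_eq[of \<sigma> A \<Phi>] assms by simp
qed

text \<open>Over any time interval the flow is a product of exponentials whose modes are taken by the signal
  there. Recording these modes keeps the products of an absorbed signal inside one class.\<close>

lemma flow_word:
  assumes \<sigma>: "\<sigma> \<in> switching_signals" and s: "0 \<le> s" and t: "s \<le> t"
  obtains ws where "ws \<in> words (\<sigma> ` {s..<t})" "duration ws = t - s"
    "flow A \<sigma> t = word_flow A ws ** flow A \<sigma> s"
proof -
  obtain b where b: "breakpoints \<sigma> b" using \<sigma> switching_signals_iff by blast
  have "s \<le> t \<longrightarrow> (\<exists>ws\<in>words (\<sigma> ` {s..<t}). duration ws = t - s \<and> flow A \<sigma> t = word_flow A ws ** flow A \<sigma> s)"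
    using b order_trans[OF s t]
  proof (induction rule: breakpoints_induct)
    case (step k t i)
    show ?case
    proof (intro impI)
      assume st: "s \<le> t"
      show "\<exists>ws\<in>words (\<sigma> ` {s..<t}). duration ws = t - s \<and> flow A \<sigma> t = word_flow A ws ** flow A \<sigma> s"
      proof (cases "b k \<le> s")
        case True
        show ?thesis
        proof (cases "s = t")
          case False
          then have "\<sigma> s = i" using True step st by auto
          then have "[(i, t - s)] \<in> words (\<sigma> ` {s..<t})"
            using st False by (auto intro!: image_eqI[of _ _ s])
          moreover have "flow A \<sigma> t = mat_exp ((t - s) *\<^sub>R A i) ** flow A \<sigma> s"
            by (rule flow_piece[OF \<sigma> s st]) (use step True in auto)
          ultimately show ?thesis by (intro bexI[of _ "[(i, t - s)]"]) auto
        qed (auto intro!: bexI[of _ "[]"])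
      next
        case False
        then obtain ws where ws: "ws \<in> words (\<sigma> ` {s..<b k})" "duration ws = b k - s"
          "flow A \<sigma> (b k) = word_flow A ws ** flow A \<sigma> s" using step by auto
        have bt: "b k \<le> t" using step by simp
        show ?thesis
        proof (cases "b k = t")
          case True
          then show ?thesis using ws by auto
        next
          case ne: False
          have "flow A \<sigma> t = mat_exp ((t - b k) *\<^sub>R A i) ** flow A \<sigma> (b k)"
            by (rule flow_piece[OF \<sigma> breakpoints_nonneg[OF b]]) (use step in auto)
          moreover have "ws \<in> words (\<sigma> ` {s..<t})" using words_mono[OF _ ws(1), of "\<sigma> ` {s..<t}"] bt by (auto simp: image_mono)
          moreover have "i \<in> \<sigma> ` {s..<t}"
            using step(3)[of "b k"] False ne bt by (intro image_eqI[of _ _ "b k"]) auto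
          ultimately show ?thesis
            using ws(2,3) bt ne
            by (intro bexI[of _ "ws @ [(i, t - b k)]"])
               (auto simp: word_flow_append matrix_mul_assoc)
        qed
      qed
    qed
  qed (use s in \<open>auto intro!: bexI[of _ "[]"]\<close>)
  then show ?thesis using t that by auto
qed

lemma flow_cong:
  assumes \<sigma>: "\<sigma> \<in> switching_signals" and \<sigma>': "\<sigma>' \<in> switching_signals"
    and eq: "\<And>u. 0 \<le> u \<Longrightarrow> u < t \<Longrightarrow> \<sigma> u = \<sigma>' u" and "0 \<le> t"
  shows "flow A \<sigma> t = flow A \<sigma>' t"
proof -
  obtain b where b: "breakpoints \<sigma> b" using \<sigma> switching_signals_iff by blast
  have "s \<le> t \<longrightarrow> flow A \<sigma> s = flow A \<sigma>' s" if "0 \<le> s" for s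
    using b that
  proof (induction rule: breakpoints_induct)
    case (step k s i)
    note nonneg = breakpoints_nonneg[OF b, of k]
    show ?case
    proof
      assume st: "s \<le> t"
      have "\<sigma>' u = i" if "b k \<le> u" "u < s" for u
        using eq[of u] step that st nonneg by auto
      then have "flow A \<sigma>' s = mat_exp ((s - b k) *\<^sub>R A i) ** flow A \<sigma>' (b k)"
        by (intro flow_piece[OF \<sigma>' nonneg]) (use step in auto)
      moreover have "flow A \<sigma> s = mat_exp ((s - b k) *\<^sub>R A i) ** flow A \<sigma> (b k)"
        by (intro flow_piece[OF \<sigma> nonneg]) (use step in auto)
      ultimately show "flow A \<sigma> s = flow A \<sigma>' s" using step st by auto
    qed
  qed (simp add: flow_0 \<sigma> \<sigma>')
  then show ?thesis using \<open>0 \<le> t\<close> by simp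
qed

text \<open>After \<open>T\<close> the signal becomes constant; from the last breakpoint before \<open>T\<close> on, the new
  breakpoints are \<open>T, T + 1, T + 2, \<dots>\<close>.\<close>

lemma switching_signals_extend:
  assumes \<sigma>: "\<sigma> \<in> switching_signals" and T: "0 \<le> T"
  shows "(\<lambda>u. if u < T then \<sigma> u else i) \<in> switching_signals"
proof (cases "T = 0")
  case True
  have "filterlim real at_top sequentially" by (rule filterlim_real_sequentially)
  then show ?thesis
    unfolding switching_signals_iff breakpoints_def
    by (intro exI[of _ real]) (auto simp: True strict_mono_def)
next
  case False
  obtain b where b: "breakpoints \<sigma> b" using \<sigma> switching_signals_iff by blast
  obtain k where k: "b k < T" "T \<le> b (Suc k)"
  proof -
    obtain K where K: "T \<le> b K" using breakpoints_unbounded[OF b] less_imp_le by metis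
    define k where "k = (LEAST k. T \<le> b k)"
    have k: "T \<le> b k" unfolding k_def by (rule LeastI, rule K)
    have "k \<noteq> 0" using k T False b by (auto simp: breakpoints_0[OF b] intro!: Nat.gr0I)
    then obtain l where l: "k = Suc l" by (cases k) auto
    then have "\<not> T \<le> b l" using not_less_Least[of l "\<lambda>k. T \<le> b k"] by (simp add: k_def)
    with k l that[of l] show ?thesis by auto
  qed
  define b' where "b' j = (if j \<le> k then b j else T + real (j - Suc k))" for j
  have mono: "strict_mono b'"
  proof (rule strict_mono_Suc_iff[THEN iffD2], rule allI)
    fix j
    have "b j < b (Suc j)" using breakpoints_strict_mono[OF b] by (simp add: strict_mono_Suc_iff)
    then show "b' j < b' (Suc j)" using k by (cases "j = k") (auto simp: b'_def)
  qed
  have "filterlim (\<lambda>j. T - real (Suc k) + real j) at_top sequentially"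
    by (intro filterlim_tendsto_add_at_top[OF tendsto_const] filterlim_real_sequentially)
  then have lim: "filterlim b' at_top sequentially"
  proof (rule filterlim_at_top_mono)
    show "\<forall>\<^sub>F j in sequentially. T - real (Suc k) + real j \<le> b' j"
      using eventually_gt_at_top[of k] by eventually_elim (auto simp: b'_def of_nat_diff)
  qed
  have le_T: "b j < T" if "j \<le> k" for j
    using breakpoints_strict_mono[OF b] that k by (metis strict_mono_less_eq order_le_less_trans)
  have const: "\<forall>s\<in>{b' j..<b' (Suc j)}. (if s < T then \<sigma> s else i) = (if b' j < T then \<sigma> (b' j) else i)" for j
  proof
    fix s assume s: "s \<in> {b' j..<b' (Suc j)}"
    consider "j < k" | "j = k" | "k < j" by linarith
    then show "(if s < T then \<sigma> s else i) = (if b' j < T then \<sigma> (b' j) else i)"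
    proof cases
      case 1
      then have "s < T" using s le_T[of "Suc j"] by (auto simp: b'_def)
      then show ?thesis using 1 s le_T[of j] breakpoints_const[OF b, of j s] by (auto simp: b'_def)
    next
      case 2
      then show ?thesis using s le_T[of j] k breakpoints_const[OF b, of j s] by (auto simp: b'_def)
    next
      case 3
      then show ?thesis using s by (auto simp: b'_def)
    qed
  qed
  have "b' 0 = 0" using breakpoints_0[OF b] by (simp add: b'_def)
  then show ?thesis
    unfolding switching_signals_iff breakpoints_def using mono lim const by (intro exI[of _ b']) auto
qed

lemma const_switching_signal: "(\<lambda>_. i) \<in> switching_signals"
  unfolding switching_signals_iff breakpoints_def
  by (intro exI[of _ real]) (auto simp: strict_mono_def filterlim_real_sequentially)

text \<open>Together with \<open>flow_word\<close> this identifies the supremum over signals with one over words.\<close>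

lemma word_signal:
  assumes "ws \<in> words UNIV"
  obtains \<sigma> where "\<sigma> \<in> switching_signals" "flow A \<sigma> (duration ws) = word_flow A ws"
proof -
  from assms have "\<exists>\<sigma>\<in>switching_signals. flow A \<sigma> (duration ws) = word_flow A ws"
  proof (induction ws rule: rev_induct)
    case Nil
    then show ?case using const_switching_signal flow_0 by fastforce
  next
    case (snoc p ws)
    obtain i s where p: "p = (i, s)" by fastforce
    then have s: "0 \<le> s" and ws: "ws \<in> words UNIV" using snoc by auto
    then obtain \<sigma> where \<sigma>: "\<sigma> \<in> switching_signals" "flow A \<sigma> (duration ws) = word_flow A ws"
      using snoc by blast
    define \<sigma>' where "\<sigma>' = (\<lambda>u. if u < duration ws then \<sigma> u else i)"
    have \<sigma>': "\<sigma>' \<in> switching_signals"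
      unfolding \<sigma>'_def by (rule switching_signals_extend[OF \<sigma>(1) duration_nonneg[OF ws]])
    have "flow A \<sigma>' (duration ws) = word_flow A ws"
      using flow_cong[OF \<sigma>' \<sigma>(1), of "duration ws" A] \<sigma>(2) duration_nonneg[OF ws] by (simp add: \<sigma>'_def)
    moreover have "flow A \<sigma>' (duration ws + s) =
        mat_exp ((duration ws + s - duration ws) *\<^sub>R A i) ** flow A \<sigma>' (duration ws)"
      by (rule flow_piece[OF \<sigma>' duration_nonneg[OF ws]]) (use s in \<open>auto simp: \<sigma>'_def\<close>)
    ultimately show ?case using \<sigma>' p by (intro bexI[of _ \<sigma>']) (auto simp: word_flow_append)
  qed
  then show ?thesis using that by blast
qed

section \<open>Norms and growth rates\<close>

lemma is_norm_equivalent: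
  fixes p :: "'a::euclidean_space \<Rightarrow> real"
  assumes p: "is_norm p"
  obtains c C where "0 < c" "0 < C" "\<And>x. c * norm x \<le> p x" "\<And>x. p x \<le> C * norm x"
proof -
  have pos: "0 \<le> p x" and zero: "p x = 0 \<longleftrightarrow> x = 0" and scale: "p (r *\<^sub>R x) = \<bar>r\<bar> * p x"
    and tri: "p (x + y) \<le> p x + p y" for x y r
    using p by (auto simp: is_norm_def)
  define C where "C = 1 + (\<Sum>b\<in>Basis. p b)"
  have sum_le: "p (\<Sum>b\<in>B. f b) \<le> (\<Sum>b\<in>B. p (f b))" if "finite B" for B and f :: "'a \<Rightarrow> 'a"
    using that
  proof (induction B rule: finite_induct)
    case (insert b B)
    then show ?case using tri[of "f b" "sum f B"] by simp
  qed (use zero[of 0] in simp)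
  have C: "0 < C" unfolding C_def by (intro add_pos_nonneg sum_nonneg pos) simp
  have upper: "p x \<le> C * norm x" for x
  proof -
    have "p x = p (\<Sum>b\<in>Basis. (x \<bullet> b) *\<^sub>R b)" by (simp add: euclidean_representation)
    also have "\<dots> \<le> (\<Sum>b\<in>Basis. \<bar>x \<bullet> b\<bar> * p b)" using sum_le[of Basis "\<lambda>b. (x \<bullet> b) *\<^sub>R b"] by (simp add: scale)
    also have "\<dots> \<le> (\<Sum>b\<in>Basis. norm x * p b)"
      by (intro sum_mono mult_right_mono Basis_le_norm pos)
    also have "\<dots> \<le> C * norm x" by (simp add: C_def sum_distrib_left[symmetric] algebra_simps)
    finally show ?thesis .
  qed
  have "\<bar>p x - p y\<bar> \<le> p (x - y)" for x y
    using tri[of "x - y" y] tri[of "y - x" x] scale[of "-1" "x - y"] by simp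
  then have lip: "\<bar>p x - p y\<bar> \<le> C * norm (x - y)" for x y
    by (rule order_trans[OF _ upper])
  have cont: "continuous_on UNIV p"
  proof (rule continuous_onI)
    fix e :: real and y :: 'a assume e: "0 < e"
    have "dist (p x') (p y) \<le> e" if "dist x' y < e / C" for x'
    proof -
      have "C * norm (x' - y) \<le> e" using that C by (simp add: dist_norm field_simps)
      then show ?thesis using lip[of x' y] by (simp add: dist_real_def)
    qed
    then show "\<exists>d>0. \<forall>x'\<in>UNIV. dist x' y < d \<longrightarrow> dist (p x') (p y) \<le> e"
      using C e by (intro exI[of _ "e / C"]) auto
  qed
  obtain e :: 'a where e: "norm e = 1" using vector_choose_size[of 1] by auto
  have "sphere (0::'a) 1 \<noteq> {}" using e by (auto simp: sphere_def)
  then obtain m where m: "m \<in> sphere 0 1" "\<And>y. y \<in> sphere 0 1 \<Longrightarrow> p m \<le> p y"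
    using continuous_attains_inf[OF compact_sphere _ continuous_on_subset[OF cont subset_UNIV], of 0 1] by auto
  have "0 < p m" using m(1) pos[of m] zero[of m] by (cases "m = 0") (auto simp: order_less_le)
  moreover have "p m * norm x \<le> p x" for x
  proof (cases "x = 0")
    case False
    then have "p m \<le> p ((1 / norm x) *\<^sub>R x)" by (intro m) simp
    then show ?thesis using False by (simp add: scale field_simps)
  qed (use zero[of 0] in simp)
  ultimately show ?thesis using that[of "p m" C] C upper by blast
qed

lemma is_norm_lipschitz:
  fixes p :: "'a::euclidean_space \<Rightarrow> real"
  assumes p: "is_norm p"
  obtains C where "\<And>x y. \<bar>p x - p y\<bar> \<le> C * norm (x - y)"
proof -
  obtain c C where C: "\<And>x. p x \<le> C * norm x" using is_norm_equivalent[OF p] by metis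
  have tri: "p (x + y) \<le> p x + p y" and scale: "p (r *\<^sub>R x) = \<bar>r\<bar> * p x" for x y r
    using p by (auto simp: is_norm_def)
  have "\<bar>p x - p y\<bar> \<le> p (x - y)" for x y
    using tri[of "x - y" y] tri[of "y - x" x] scale[of "-1" "x - y"] by simp
  then have "\<bar>p x - p y\<bar> \<le> C * norm (x - y)" for x y by (rule order_trans[OF _ C])
  then show ?thesis by (rule that)
qed

lemma
  fixes nrm :: "real ^ 'd \<Rightarrow> real"
  assumes n: "is_norm nrm"
  shows op_norm_upper: "nrm (M *v x) \<le> op_norm nrm M * nrm x"
    and op_norm_least: "(\<And>x. nrm (M *v x) \<le> B * nrm x) \<Longrightarrow> op_norm nrm M \<le> B"
    and op_norm_nonneg: "0 \<le> op_norm nrm M"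
proof -
  obtain c C where cC: "0 < c" "0 < C" "\<And>x. c * norm x \<le> nrm x" "\<And>x. nrm x \<le> C * norm x"
    using is_norm_equivalent[OF n] by metis
  have pos: "0 \<le> nrm x" and zero: "nrm x = 0 \<longleftrightarrow> x = 0" and scale: "nrm (r *\<^sub>R x) = \<bar>r\<bar> * nrm x" for x r
    using n by (auto simp: is_norm_def)
  have normalise: "nrm ((1 / nrm x) *\<^sub>R x) = 1" if "x \<noteq> 0" for x
    using that pos[of x] zero[of x] by (simp add: scale)
  have ne: "{x. nrm x = 1} \<noteq> {}" using normalise[of "axis undefined 1"] by (auto simp: axis_eq_0_iff)
  have bdd: "bdd_above ((\<lambda>x. nrm (M *v x)) ` {x. nrm x = 1})" for M
  proof (rule bdd_aboveI2)
    fix x assume "x \<in> {x. nrm x = 1}"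
    then have x: "norm x \<le> 1 / c" using cC(1) cC(3)[of x] by (simp add: field_simps)
    have "nrm (M *v x) \<le> C * (norm M * norm x)"
      using cC(4)[of "M *v x"] norm_matrix_vector_mult_le[of M x] cC(2)
      by (meson mult_left_mono order_less_imp_le order_trans)
    also have "\<dots> \<le> C * (norm M * (1 / c))" using x cC by (intro mult_left_mono) auto
    finally show "nrm (M *v x) \<le> C * (norm M * (1 / c))" .
  qed
  show up: "nrm (M *v x) \<le> op_norm nrm M * nrm x" for M x
  proof (cases "x = 0")
    case False
    have "nrm (M *v ((1 / nrm x) *\<^sub>R x)) \<le> op_norm nrm M"
      unfolding op_norm_def using normalise[OF False] by (intro cSUP_upper bdd) auto
    moreover have "M *v ((1 / nrm x) *\<^sub>R x) = (1 / nrm x) *\<^sub>R (M *v x)"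
      by (rule mat_vec.scaleR_right)
    ultimately show ?thesis using False pos[of x] zero[of x] by (simp add: scale field_simps)
  qed (use zero[of 0] in simp)
  show "op_norm nrm M \<le> B" if "\<And>x. nrm (M *v x) \<le> B * nrm x"
    unfolding op_norm_def using ne
  proof (rule cSUP_least)
    show "nrm (M *v x) \<le> B" if x: "x \<in> {x. nrm x = 1}" for x
      using x \<open>\<And>x. nrm (M *v x) \<le> B * nrm x\<close>[of x] by simp
  qed
  obtain x where "nrm x = 1" using ne by auto
  then show "0 \<le> op_norm nrm M" using up[of M x] pos[of "M *v x"] by simp
qed

lemma is_norm_op_norm:
  fixes nrm :: "real ^ 'd \<Rightarrow> real"
  assumes n: "is_norm nrm"
  shows "is_norm (op_norm nrm)"
proof -
  have pos: "0 \<le> nrm x" and zero: "nrm x = 0 \<longleftrightarrow> x = 0" and scale: "nrm (r *\<^sub>R x) = \<bar>r\<bar> * nrm x"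
    and tri: "nrm (x + y) \<le> nrm x + nrm y" for x y r
    using n by (auto simp: is_norm_def)
  have le: "op_norm nrm (r *\<^sub>R M) \<le> \<bar>r\<bar> * op_norm nrm M" for r and M :: "real ^ 'd ^ 'd"
    using op_norm_upper[OF n, of M]
    by (intro op_norm_least[OF n])
       (simp add: mat_vec.scaleR_left scale mult.assoc mult_left_mono)
  have eq: "op_norm nrm (r *\<^sub>R M) = \<bar>r\<bar> * op_norm nrm M" for r and M :: "real ^ 'd ^ 'd"
  proof (cases "r = 0")
    case True
    then show ?thesis using le[of 0 M] op_norm_nonneg[OF n, of "0 *\<^sub>R M"] by simp
  next
    case False
    then show ?thesis using le[of r M] le[of "1 / r" "r *\<^sub>R M"] by (simp add: field_simps abs_divide)
  qed
  have zero': "op_norm nrm M = 0 \<longleftrightarrow> M = 0" for M :: "real ^ 'd ^ 'd"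
  proof
    assume "op_norm nrm M = 0"
    then have "nrm (M *v x) = 0" for x using op_norm_upper[OF n, of M x] pos[of "M *v x"] by simp
    then have "M *v x = 0" for x using zero by blast
    then show "M = 0" by (metis matrix_eq matrix_vector_mult_0)
  next
    show "M = 0 \<Longrightarrow> op_norm nrm M = 0" using eq[of 0 M] by simp
  qed
  have "op_norm nrm (M + N) \<le> op_norm nrm M + op_norm nrm N" for M N :: "real ^ 'd ^ 'd"
  proof (rule op_norm_least[OF n])
    fix x
    have "nrm ((M + N) *v x) \<le> nrm (M *v x) + nrm (N *v x)"
      by (simp add: mat_vec.add_left tri)
    also have "\<dots> \<le> op_norm nrm M * nrm x + op_norm nrm N * nrm x"
      by (intro add_mono op_norm_upper n)
    finally show "nrm ((M + N) *v x) \<le> (op_norm nrm M + op_norm nrm N) * nrm x"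
      by (simp add: algebra_simps)
  qed
  with eq zero' op_norm_nonneg[OF n] show ?thesis by (simp add: is_norm_def)
qed

text \<open>Only these two consequences of the equivalence of norms are used to pass between \<open>op_norm\<close> and
  estimates on vectors; the constant disappears after taking logarithms and dividing by \<open>t\<close>.\<close>

lemma op_norm_equivalent:
  fixes nrm :: "real ^ 'd \<Rightarrow> real"
  assumes n: "is_norm nrm"
  obtains \<kappa> where "1 \<le> \<kappa>"
    "\<And>M B. (\<And>x. norm (M *v x) \<le> B * norm x) \<Longrightarrow> op_norm nrm M \<le> \<kappa> * B"
    "\<And>M x. norm (M *v x) \<le> \<kappa> * op_norm nrm M * norm x"
proof -
  obtain c C where cC: "0 < c" "0 < C" "\<And>x. c * norm x \<le> nrm x" "\<And>x. nrm x \<le> C * norm x"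
    using is_norm_equivalent[OF n] by metis
  have "c * norm (axis undefined 1 :: real ^ 'd) \<le> C * norm (axis undefined 1 :: real ^ 'd)"
    by (rule order_trans[OF cC(3) cC(4)])
  then have 1: "1 \<le> C / c" using cC by (simp add: norm_axis_1 field_simps)
  have 2: "op_norm nrm M \<le> C / c * B" if M: "\<And>x. norm (M *v x) \<le> B * norm x" for M B
  proof (rule op_norm_least[OF n])
    fix x
    have "0 \<le> B * norm (axis undefined 1 :: real ^ 'd)" by (rule order_trans[OF norm_ge_zero M])
    then have B: "0 \<le> B" by (simp add: norm_axis_1)
    have "nrm (M *v x) \<le> C * (B * norm x)"
      using cC(2) cC(4)[of "M *v x"] M[of x] by (meson mult_left_mono order_less_imp_le order_trans)
    also have "\<dots> \<le> C * (B * (nrm x / c))"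
      using cC(1) cC(2) cC(3)[of x] B by (intro mult_left_mono) (auto simp: field_simps)
    finally show "nrm (M *v x) \<le> C / c * B * nrm x" by (simp add: field_simps)
  qed
  have 3: "norm (M *v x) \<le> C / c * op_norm nrm M * norm x" for M x
  proof -
    have "c * norm (M *v x) \<le> op_norm nrm M * nrm x"
      using cC(3)[of "M *v x"] op_norm_upper[OF n, of M x] by linarith
    also have "\<dots> \<le> op_norm nrm M * (C * norm x)"
      using cC(4) op_norm_nonneg[OF n] by (intro mult_left_mono)
    finally show ?thesis using cC by (simp add: field_simps)
  qed
  show ?thesis using that[OF 1 2 3] by blast
qed

text \<open>The form in which the upper limit of the deterministic exponent is used: it speaks of words, so that
  signals are no longer needed.\<close>

definition growth_bound :: "('n \<Rightarrow> real ^ 'd ^ 'd) \<Rightarrow> real \<Rightarrow> bool" where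
  "growth_bound A \<theta> \<longleftrightarrow> (\<forall>\<delta>>0. \<exists>C. \<forall>ws\<in>words UNIV. \<forall>x.
     norm (word_flow A ws *v x) \<le> C * exp ((\<theta> + \<delta>) * duration ws) * norm x)"

text \<open>A crude exponential rate, valid for all products and their inverses.\<close>

definition total_norm :: "('n::finite \<Rightarrow> real ^ 'd ^ 'd) \<Rightarrow> real" where
  "total_norm A = (\<Sum>i\<in>UNIV. norm (A i))"

lemma total_norm_nonneg: "0 \<le> total_norm A"
  by (simp add: total_norm_def sum_nonneg)

lemma norm_exp_scaled_le:
  fixes A :: "'n::finite \<Rightarrow> real ^ 'd ^ 'd"
  shows "norm (mat_exp (s *\<^sub>R A i) *v x) \<le> exp (total_norm A * \<bar>s\<bar>) * norm x"
proof -
  have "norm (A i) \<le> total_norm A" unfolding total_norm_def by (rule member_le_sum) auto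
  then have "\<bar>s\<bar> * norm (A i) \<le> total_norm A * \<bar>s\<bar>" by (simp add: mult.commute mult_left_mono)
  moreover have "norm (mat_exp (s *\<^sub>R A i) *v x) \<le> exp (norm (s *\<^sub>R A i)) * norm x"
    by (rule norm_mat_exp_vec_le)
  ultimately have "norm (mat_exp (s *\<^sub>R A i) *v x) \<le> exp (\<bar>s\<bar> * norm (A i)) * norm x"
    "exp (\<bar>s\<bar> * norm (A i)) * norm x \<le> exp (total_norm A * \<bar>s\<bar>) * norm x"
    by (auto intro!: mult_right_mono)
  then show ?thesis by (rule order_trans)
qed

lemma
  fixes A :: "'n::finite \<Rightarrow> real ^ 'd ^ 'd"
  assumes "ws \<in> words UNIV"
  shows norm_word_flow_le: "norm (word_flow A ws *v x) \<le> exp (total_norm A * duration ws) * norm x"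
    and norm_word_flow_ge: "exp (- (total_norm A * duration ws)) * norm x \<le> norm (word_flow A ws *v x)"
proof -
  have "norm (word_flow A ws *v x) \<le> exp (total_norm A * duration ws) * norm x \<and>
      exp (- (total_norm A * duration ws)) * norm x \<le> norm (word_flow A ws *v x)"
    using assms
  proof (induction ws arbitrary: x)
    case (Cons p ws)
    obtain i s where p: "p = (i, s)" by fastforce
    let ?y = "mat_exp (s *\<^sub>R A i) *v x" and ?a = "total_norm A"
    have s: "0 \<le> s" and ws: "ws \<in> words UNIV" using Cons p by auto
    have y1: "norm ?y \<le> exp (?a * s) * norm x" using norm_exp_scaled_le[of s A i x] s by simp
    have "norm (mat_exp ((- s) *\<^sub>R A i) *v ?y) \<le> exp (?a * s) * norm ?y"
      using norm_exp_scaled_le[of "- s" A i ?y] s by simp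
    then have "norm x \<le> exp (?a * s) * norm ?y"
      using mat_exp_minus'[OF s, of "A i"] by (simp add: matrix_vector_mul_assoc)
    then have y2: "exp (- (?a * s)) * norm x \<le> norm ?y" by (simp add: exp_minus field_simps)
    have eq: "word_flow A (p # ws) *v x = word_flow A ws *v ?y" by (simp add: p matrix_vector_mul_assoc)
    have "norm (word_flow A ws *v ?y) \<le> exp (?a * duration ws) * (exp (?a * s) * norm x)"
      using Cons(1)[OF ws, of ?y] y1 by (meson exp_ge_zero mult_left_mono order_trans)
    moreover have "exp (- (?a * duration ws)) * (exp (- (?a * s)) * norm x) \<le> norm (word_flow A ws *v ?y)"
      using Cons(1)[OF ws, of ?y] y2 by (meson exp_ge_zero mult_left_mono order_trans)
    ultimately show ?case unfolding eq by (simp add: p distrib_left exp_add mult_ac exp_minus exp_diff divide_inverse)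
  qed simp
  then show "norm (word_flow A ws *v x) \<le> exp (total_norm A * duration ws) * norm x"
    "exp (- (total_norm A * duration ws)) * norm x \<le> norm (word_flow A ws *v x)" by auto
qed

lemma flow_eq_word:
  assumes "\<sigma> \<in> switching_signals" "0 \<le> t"
  obtains ws where "ws \<in> words UNIV" "duration ws = t" "flow A \<sigma> t = word_flow A ws"
proof -
  obtain ws where "ws \<in> words (\<sigma> ` {0..<t})" "duration ws = t - 0" "flow A \<sigma> t = word_flow A ws ** flow A \<sigma> 0"
    by (rule flow_word[OF assms(1) order_refl assms(2)])
  then show ?thesis using that[of ws] words_mono[OF subset_UNIV, of ws] flow_0[OF assms(1), of A] by simp
qed

lemma op_norm_word_bounds:
  fixes A :: "'n::finite \<Rightarrow> real ^ 'd ^ 'd"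
  assumes n: "is_norm nrm"
  obtains c where "0 \<le> c"
    "\<And>ws. ws \<in> words UNIV \<Longrightarrow> 0 < op_norm nrm (word_flow A ws)"
    "\<And>ws. ws \<in> words UNIV \<Longrightarrow> \<bar>ln (op_norm nrm (word_flow A ws))\<bar> \<le> total_norm A * duration ws + c"
proof -
  obtain \<kappa> where \<kappa>: "1 \<le> \<kappa>"
    "\<And>M B. (\<And>x. norm (M *v x) \<le> B * norm x) \<Longrightarrow> op_norm nrm M \<le> \<kappa> * B"
    "\<And>M x. norm (M *v x) \<le> \<kappa> * op_norm nrm M * norm x"
    using op_norm_equivalent[OF n] by blast
  have bounds: "exp (- (total_norm A * duration ws)) / \<kappa> \<le> op_norm nrm (word_flow A ws)"
    "op_norm nrm (word_flow A ws) \<le> \<kappa> * exp (total_norm A * duration ws)" if ws: "ws \<in> words UNIV" for ws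
  proof -
    let ?e = "axis undefined 1 :: real ^ 'd"
    have "exp (- (total_norm A * duration ws)) * norm ?e \<le> \<kappa> * op_norm nrm (word_flow A ws) * norm ?e"
      by (rule order_trans[OF norm_word_flow_ge[OF ws] \<kappa>(3)])
    then show "exp (- (total_norm A * duration ws)) / \<kappa> \<le> op_norm nrm (word_flow A ws)"
      using \<kappa>(1) by (simp add: norm_axis_1 field_simps)
    show "op_norm nrm (word_flow A ws) \<le> \<kappa> * exp (total_norm A * duration ws)"
      using norm_word_flow_le[OF ws] by (rule \<kappa>(2))
  qed
  have pos: "0 < op_norm nrm (word_flow A ws)" if ws: "ws \<in> words UNIV" for ws
    using \<kappa>(1) by (intro less_le_trans[OF _ bounds(1)[OF ws]] divide_pos_pos) auto
  have "\<bar>ln (op_norm nrm (word_flow A ws))\<bar> \<le> total_norm A * duration ws + ln \<kappa>" if ws: "ws \<in> words UNIV" for ws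
  proof -
    have "ln (exp (- (total_norm A * duration ws)) / \<kappa>) \<le> ln (op_norm nrm (word_flow A ws))"
      using bounds(1)[OF ws] \<kappa>(1) pos[OF ws] by (subst ln_le_cancel_iff) auto
    moreover have "ln (op_norm nrm (word_flow A ws)) \<le> ln (\<kappa> * exp (total_norm A * duration ws))"
      using bounds(2)[OF ws] \<kappa>(1) pos[OF ws] by (subst ln_le_cancel_iff) auto
    ultimately show ?thesis using \<kappa>(1) by (simp add: ln_div ln_mult)
  qed
  then show ?thesis using that[of "ln \<kappa>"] pos \<kappa>(1) by simp
qed

text \<open>The upper limit controls all products of large duration; short products are absorbed in the
  constant \<open>C\<close>.\<close>

lemma lyap_det_finite:
  fixes A :: "'n::finite \<Rightarrow> real ^ 'd ^ 'd"
  assumes n: "is_norm nrm"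
  obtains \<theta> where "lyap_det nrm A = ereal \<theta>" "growth_bound A \<theta>"
proof -
  obtain c where c: "0 \<le> c"
    "\<And>ws. ws \<in> words UNIV \<Longrightarrow> 0 < op_norm nrm (word_flow A ws)"
    "\<And>ws. ws \<in> words UNIV \<Longrightarrow> \<bar>ln (op_norm nrm (word_flow A ws))\<bar> \<le> total_norm A * duration ws + c"
    using op_norm_word_bounds[OF n] by blast
  define f where "f t = (SUP \<sigma>\<in>switching_signals. ereal (ln (op_norm nrm (flow A \<sigma> t))))" for t
  have ln_flow: "\<bar>ln (op_norm nrm (flow A \<sigma> t))\<bar> \<le> total_norm A * t + c"
    if h: "\<sigma> \<in> switching_signals" "0 \<le> t" for \<sigma> t
  proof -
    obtain ws where "ws \<in> words UNIV" "duration ws = t" "flow A \<sigma> t = word_flow A ws"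
      by (rule flow_eq_word[OF h])
    then show ?thesis using c(3)[of ws] by simp
  qed
  have f_le: "f t \<le> ereal (total_norm A * t + c)" if "0 \<le> t" for t
    unfolding f_def using ln_flow[OF _ that] by (intro SUP_least) (simp add: abs_le_iff)
  have f_ge: "ereal (- (total_norm A * t + c)) \<le> f t" if "0 \<le> t" for t
  proof -
    define \<sigma> :: "real \<Rightarrow> 'n" where "\<sigma> = (\<lambda>_. undefined)"
    have \<sigma>: "\<sigma> \<in> switching_signals" unfolding \<sigma>_def by (rule const_switching_signal)
    have "ereal (- (total_norm A * t + c)) \<le> ereal (ln (op_norm nrm (flow A \<sigma> t)))"
      using ln_flow[OF \<sigma> that] by (simp add: abs_le_iff)
    also have "\<dots> \<le> f t" unfolding f_def by (rule SUP_upper[OF \<sigma>])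
    finally show ?thesis .
  qed
  have scaled: "ereal (1 / t) * ereal x \<le> ereal (total_norm A + c)"
    "ereal (- (total_norm A + c)) \<le> ereal (1 / t) * ereal (- x)"
    if "1 \<le> t" "x = total_norm A * t + c" for t x :: real
  proof -
    have "x \<le> (total_norm A + c) * t"
      using that c(1) mult_left_mono[of 1 t c] by (simp add: algebra_simps)
    then show "ereal (1 / t) * ereal x \<le> ereal (total_norm A + c)"
      "ereal (- (total_norm A + c)) \<le> ereal (1 / t) * ereal (- x)" using that(1)
      by (simp_all add: field_simps)
  qed
  have "lyap_det nrm A \<le> ereal (total_norm A + c)"
    unfolding lyap_det_def f_def[symmetric]
  proof (rule Limsup_bounded)
    show "\<forall>\<^sub>F t in at_top. ereal (1 / t) * f t \<le> ereal (total_norm A + c)"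
      using eventually_ge_at_top[of 1]
    proof eventually_elim
      case (elim t)
      have "ereal (1 / t) * f t \<le> ereal (1 / t) * ereal (total_norm A * t + c)"
        using f_le[of t] elim by (intro ereal_mult_left_mono) auto
      also have "\<dots> \<le> ereal (total_norm A + c)" using scaled(1)[OF elim refl] .
      finally show ?case .
    qed
  qed
  moreover have "ereal (- (total_norm A + c)) \<le> lyap_det nrm A"
  proof -
    have "\<forall>\<^sub>F t in at_top. ereal (- (total_norm A + c)) \<le> ereal (1 / t) * f t"
      using eventually_ge_at_top[of 1]
    proof eventually_elim
      case (elim t)
      have "ereal (- (total_norm A + c)) \<le> ereal (1 / t) * ereal (- (total_norm A * t + c))"
        using scaled(2)[OF elim refl] .
      also have "\<dots> \<le> ereal (1 / t) * f t"
        using f_ge[of t] elim by (intro ereal_mult_left_mono) auto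
      finally show ?case .
    qed
    then have "ereal (- (total_norm A + c)) \<le> Liminf at_top (\<lambda>t. ereal (1 / t) * f t)"
      by (rule Liminf_bounded)
    also have "\<dots> \<le> lyap_det nrm A"
      unfolding lyap_det_def f_def[symmetric] by (rule Liminf_le_Limsup) simp
    finally show ?thesis .
  qed
  ultimately obtain \<theta> where \<theta>: "lyap_det nrm A = ereal \<theta>"
    by (cases "lyap_det nrm A") auto
  obtain \<kappa> where \<kappa>: "1 \<le> \<kappa>"
    "\<And>M x. norm (M *v x) \<le> \<kappa> * op_norm nrm M * norm x"
    by (rule op_norm_equivalent[OF n]) metis
  have "growth_bound A \<theta>"
    unfolding growth_bound_def
  proof (intro allI impI)
    fix \<delta> :: real assume \<delta>: "0 < \<delta>"
    have "Limsup at_top (\<lambda>t. ereal (1 / t) * f t) < ereal (\<theta> + \<delta>)"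
      using \<theta> \<delta> unfolding lyap_det_def f_def[symmetric] by simp
    then have "\<forall>\<^sub>F t in at_top. ereal (1 / t) * f t < ereal (\<theta> + \<delta>)"
      by (rule Limsup_lessD)
    then obtain t0 where t0: "\<And>t. t0 \<le> t \<Longrightarrow> ereal (1 / t) * f t < ereal (\<theta> + \<delta>)"
      by (auto simp: eventually_at_top_linorder)
    define t1 where "t1 = max 1 t0"
    define C where "C = max \<kappa> (exp (total_norm A * t1 + \<bar>\<theta> + \<delta>\<bar> * t1))"
    show "\<exists>C. \<forall>ws\<in>words UNIV. \<forall>x. norm (word_flow A ws *v x) \<le> C * exp ((\<theta> + \<delta>) * duration ws) * norm x"
    proof (intro exI[of _ C] ballI allI)
      fix ws :: "('n \<times> real) list" and x assume ws: "ws \<in> words UNIV"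
      let ?t = "duration ws"
      show "norm (word_flow A ws *v x) \<le> C * exp ((\<theta> + \<delta>) * ?t) * norm x"
      proof (cases "t1 \<le> ?t")
        case True
        then have t: "0 < ?t" "t0 \<le> ?t" by (auto simp: t1_def)
        obtain \<sigma> where \<sigma>: "\<sigma> \<in> switching_signals" "flow A \<sigma> ?t = word_flow A ws"
          using word_signal[OF ws] by blast
        have "ereal (ln (op_norm nrm (word_flow A ws))) \<le> f ?t"
          unfolding f_def using SUP_upper[OF \<sigma>(1), of "\<lambda>\<sigma>. ereal (ln (op_norm nrm (flow A \<sigma> ?t)))"] \<sigma>(2) by simp
        then have "ereal (1 / ?t) * ereal (ln (op_norm nrm (word_flow A ws))) \<le> ereal (1 / ?t) * f ?t"
          using t by (intro ereal_mult_left_mono) auto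
        also have "\<dots> < ereal (\<theta> + \<delta>)" by (rule t0[OF t(2)])
        finally have "ln (op_norm nrm (word_flow A ws)) < (\<theta> + \<delta>) * ?t"
          using t by (simp add: field_simps)
        then have op: "op_norm nrm (word_flow A ws) \<le> exp ((\<theta> + \<delta>) * ?t)"
          using c(2)[OF ws] by (metis exp_le_cancel_iff exp_ln less_imp_le)
        have "norm (word_flow A ws *v x) \<le> \<kappa> * op_norm nrm (word_flow A ws) * norm x" by (rule \<kappa>(2))
        also have "\<dots> \<le> C * exp ((\<theta> + \<delta>) * ?t) * norm x"
          using op \<kappa>(1) op_norm_nonneg[OF n] by (intro mult_right_mono mult_mono) (auto simp: C_def)
        finally show ?thesis .
      next
        case False
        have t: "0 \<le> ?t" by (rule duration_nonneg[OF ws])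
        have "norm (word_flow A ws *v x) \<le> exp (total_norm A * ?t) * norm x"
          by (rule norm_word_flow_le[OF ws])
        also have "exp (total_norm A * ?t) \<le> C * exp ((\<theta> + \<delta>) * ?t)"
        proof -
          have "total_norm A * ?t \<le> total_norm A * t1"
            using False total_norm_nonneg[of A] by (intro mult_left_mono) auto
          moreover have "- ((\<theta> + \<delta>) * ?t) \<le> \<bar>\<theta> + \<delta>\<bar> * t1"
          proof -
            have "- ((\<theta> + \<delta>) * ?t) \<le> \<bar>\<theta> + \<delta>\<bar> * ?t" using t
              by (metis abs_ge_minus_self minus_mult_left mult_right_mono)
            also have "\<dots> \<le> \<bar>\<theta> + \<delta>\<bar> * t1" using False by (intro mult_left_mono) auto
            finally show ?thesis .
          qed
          ultimately have "exp (total_norm A * ?t) \<le> exp (total_norm A * t1 + \<bar>\<theta> + \<delta>\<bar> * t1) * exp ((\<theta> + \<delta>) * ?t)"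
            by (simp add: exp_add[symmetric])
          also have "\<dots> \<le> C * exp ((\<theta> + \<delta>) * ?t)" by (intro mult_right_mono) (auto simp: C_def)
          finally show ?thesis .
        qed
        finally show ?thesis by (simp add: mult_right_mono)
      qed
    qed
  qed
  with \<theta> show ?thesis using that by blast
qed

section \<open>Norms adapted to the growth rate\<close>

text \<open>Coordinates with respect to a basis chosen inside a set depend continuously on the vector.\<close>

lemma bounded_coordinates:
  fixes S :: "'a::euclidean_space set"
  obtains B K where "finite B" "B \<subseteq> S" "0 < K"
    "\<And>v. v \<in> S \<Longrightarrow> \<exists>c. v = (\<Sum>b\<in>B. c b *\<^sub>R b) \<and> (\<Sum>b\<in>B. \<bar>c b\<bar>) \<le> K * norm v"
proof -
  obtain B where B: "B \<subseteq> S" "independent B" "S \<subseteq> span B"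
    using maximal_independent_subset by blast
  have fin: "finite B" using B(2) independent_imp_finite by blast
  have "\<exists>f. linear f \<and> (\<forall>b'\<in>B. f b' = (if b' = b then 1 else 0 :: real))" for b
    using linear_independent_extend[OF B(2), of "\<lambda>b'. if b' = b then 1 else 0 :: real"] by blast
  then obtain f :: "'a \<Rightarrow> 'a \<Rightarrow> real" where f: "\<And>b. linear (f b)"
    "\<And>b b'. b' \<in> B \<Longrightarrow> f b b' = (if b' = b then 1 else 0)" by metis
  have "\<exists>K>0. \<forall>v. norm (f b v) \<le> norm v * K" for b
    using bounded_linear.pos_bounded f(1) linear_conv_bounded_linear by blast
  then obtain k where k: "\<And>b. 0 < k b" "\<And>b v. norm (f b v) \<le> norm v * k b" by metis
  define K where "K = 1 + (\<Sum>b\<in>B. k b)"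
  have "\<exists>c. v = (\<Sum>b\<in>B. c b *\<^sub>R b) \<and> (\<Sum>b\<in>B. \<bar>c b\<bar>) \<le> K * norm v" if "v \<in> S" for v
  proof -
    have "v \<in> span B" using that B(3) by blast
    then obtain u where u: "v = (\<Sum>b\<in>B. u b *\<^sub>R b)" unfolding span_finite[OF fin] by auto
    have "f b v = u b" if "b \<in> B" for b
    proof -
      have "f b v = (\<Sum>b'\<in>B. u b' *\<^sub>R f b b')"
        unfolding u by (simp add: linear_sum[OF f(1)] linear_scale[OF f(1)])
      also have "\<dots> = (\<Sum>b'\<in>B. if b' = b then u b' else 0)"
        by (intro sum.cong) (auto simp: f(2))
      also have "\<dots> = u b" using that fin by simp
      finally show ?thesis .
    qed
    then have "(\<Sum>b\<in>B. \<bar>u b\<bar>) = (\<Sum>b\<in>B. norm (f b v))" by simp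
    also have "\<dots> \<le> (\<Sum>b\<in>B. norm v * k b)" by (intro sum_mono k)
    also have "\<dots> \<le> K * norm v" by (simp add: K_def sum_distrib_left[symmetric] algebra_simps)
    finally show ?thesis using u by blast
  qed
  moreover have "0 < K" using k(1) by (simp add: K_def add_pos_nonneg sum_nonneg less_imp_le)
  ultimately show ?thesis using that fin B(1) by blast
qed

definition adapted :: "('n \<Rightarrow> real ^ 'd ^ 'd) \<Rightarrow> real \<Rightarrow> (real ^ 'd \<Rightarrow> real) \<Rightarrow> bool" where
  "adapted A r p \<longleftrightarrow> (\<forall>x. 0 \<le> p x) \<and> (\<forall>c x. p (c *\<^sub>R x) = \<bar>c\<bar> * p x) \<and> (\<forall>x y. p (x + y) \<le> p x + p y) \<and>
     (\<forall>ws\<in>words UNIV. \<forall>x. p (word_flow A ws *v x) \<le> exp (r * duration ws) * p x)"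

text \<open>One bound \<open>K\<close> serves all adapted seminorms of rate at most \<open>R\<close>: a product is a combination of
  finitely many fixed products, with coefficients controlled by its norm, and the seminorm is adapted
  to each of these.\<close>

lemma adapted_uniform_bound:
  fixes A :: "'n \<Rightarrow> real ^ 'd ^ 'd"
  obtains K where "0 < K"
    "\<And>p r ws x. adapted A r p \<Longrightarrow> r \<le> R \<Longrightarrow> ws \<in> words UNIV \<Longrightarrow>
       p (word_flow A ws *v x) \<le> K * norm (word_flow A ws) * p x"
proof -
  obtain B K where B: "finite B" "B \<subseteq> word_flow A ` words UNIV" "0 < K"
    "\<And>v. v \<in> word_flow A ` words UNIV \<Longrightarrow> \<exists>c. v = (\<Sum>b\<in>B. c b *\<^sub>R b) \<and> (\<Sum>b\<in>B. \<bar>c b\<bar>) \<le> K * norm v"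
    using bounded_coordinates[of "word_flow A ` words UNIV"] by blast
  have "\<forall>b\<in>B. \<exists>ws\<in>words UNIV. b = word_flow A ws" using B(2) by blast
  then obtain w where w: "\<And>b. b \<in> B \<Longrightarrow> w b \<in> words UNIV" "\<And>b. b \<in> B \<Longrightarrow> b = word_flow A (w b)"
    by metis
  define T where "T = (\<Sum>b\<in>B. duration (w b))"
  have T: "duration (w b) \<le> T" if "b \<in> B" for b
    unfolding T_def using that B(1) w(1) by (intro member_le_sum) (auto intro: duration_nonneg)
  define E where "E = exp (\<bar>R\<bar> * T)"
  have bound: "p (word_flow A ws *v x) \<le> E * K * norm (word_flow A ws) * p x"
    if p: "adapted A r p" and r: "r \<le> R" and ws: "ws \<in> words UNIV" for p r ws x
  proof -
    have nn: "0 \<le> p y" and sc: "p (c *\<^sub>R y) = \<bar>c\<bar> * p y" and tri: "p (y + z) \<le> p y + p z" for y z c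
      using p by (auto simp: adapted_def)
    have p0: "p 0 = 0" using sc[of 0 0] by simp
    have sum_le: "p (\<Sum>b\<in>D. g b) \<le> (\<Sum>b\<in>D. p (g b))" if "finite D" for D and g :: "real ^ 'd ^ 'd \<Rightarrow> real ^ 'd"
      using that
    proof (induction D rule: finite_induct)
      case (insert b D)
      then show ?case using tri[of "g b" "sum g D"] by simp
    qed (simp add: p0)
    obtain c where c: "word_flow A ws = (\<Sum>b\<in>B. c b *\<^sub>R b)" "(\<Sum>b\<in>B. \<bar>c b\<bar>) \<le> K * norm (word_flow A ws)"
      using B(4)[of "word_flow A ws"] ws by blast
    have pb: "p (b *v x) \<le> E * p x" if b: "b \<in> B" for b
    proof -
      have "p (b *v x) \<le> exp (r * duration (w b)) * p x"
        using p w(1)[OF b] w(2)[OF b] unfolding adapted_def by metis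
      also have "r * duration (w b) \<le> \<bar>R\<bar> * T"
        using r T[OF b] duration_nonneg[OF w(1)[OF b]] by (intro mult_mono) auto
      then have "exp (r * duration (w b)) * p x \<le> E * p x"
        unfolding E_def by (intro mult_right_mono nn) simp
      finally show ?thesis .
    qed
    have "word_flow A ws *v x = (\<Sum>b\<in>B. c b *\<^sub>R (b *v x))"
      unfolding c(1) by (simp add: mat_vec.sum_left
          mat_vec.scaleR_left)
    then have "p (word_flow A ws *v x) \<le> (\<Sum>b\<in>B. \<bar>c b\<bar> * p (b *v x))"
      using sum_le[OF B(1), of "\<lambda>b. c b *\<^sub>R (b *v x)"] by (simp add: sc)
    also have "\<dots> \<le> (\<Sum>b\<in>B. \<bar>c b\<bar> * (E * p x))" by (intro sum_mono mult_left_mono pb) auto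
    also have "\<dots> = (\<Sum>b\<in>B. \<bar>c b\<bar>) * (E * p x)" by (simp add: sum_distrib_right)
    also have "\<dots> \<le> (K * norm (word_flow A ws)) * (E * p x)"
      using nn by (intro mult_right_mono c(2)) (simp add: E_def)
    finally show ?thesis by (simp add: mult_ac)
  qed
  show ?thesis using that[of "E * K"] bound B(3) by (simp add: E_def)
qed

text \<open>The supremum of \<open>exp (- (\<theta> + \<delta>) t) |\<Phi> x|\<close> over all products \<open>\<Phi>\<close> of all durations \<open>t\<close> is finite
  by the choice of \<open>\<theta>\<close>, and applying a further product only shrinks the family.\<close>

lemma adapted_norm_exists:
  fixes A :: "'n \<Rightarrow> real ^ 'd ^ 'd"
  assumes g: "growth_bound A \<theta>" and \<delta>: "0 < \<delta>"
  obtains p C where "adapted A (\<theta> + \<delta>) p" "\<And>x. norm x \<le> p x" "\<And>x. p x \<le> C * norm x"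
proof -
  obtain C where C: "\<And>ws x. ws \<in> words UNIV \<Longrightarrow>
      norm (word_flow A ws *v x) \<le> C * exp ((\<theta> + \<delta>) * duration ws) * norm x"
    using g \<delta> unfolding growth_bound_def by blast
  define h where "h ws x = exp (- ((\<theta> + \<delta>) * duration ws)) * norm (word_flow A ws *v x)" for ws x
  define p where "p x = (SUP ws\<in>words UNIV. h ws x)" for x
  have h_le: "h ws x \<le> C * norm x" if "ws \<in> words UNIV" for ws x
  proof -
    have "h ws x \<le> exp (- ((\<theta> + \<delta>) * duration ws)) * (C * exp ((\<theta> + \<delta>) * duration ws) * norm x)"
      unfolding h_def by (intro mult_left_mono C that) simp
    also have "\<dots> = exp (- ((\<theta> + \<delta>) * duration ws)) * exp ((\<theta> + \<delta>) * duration ws) * (C * norm x)"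
      by (simp only: mult_ac)
    also have "\<dots> = C * norm x" by (simp add: exp_add[symmetric])
    finally show ?thesis .
  qed
  have bdd: "bdd_above ((\<lambda>ws. h ws x) ` words UNIV)" for x using h_le by (intro bdd_aboveI2) auto
  have ne: "words (UNIV :: 'n set) \<noteq> {}" using words_simps(1) by blast
  have h_p: "h ws x \<le> p x" if "ws \<in> words UNIV" for ws x
    unfolding p_def by (rule cSUP_upper[OF that bdd])
  have p_le: "p x \<le> b" if "\<And>ws. ws \<in> words UNIV \<Longrightarrow> h ws x \<le> b" for x b
    unfolding p_def using ne that by (rule cSUP_least)
  have low: "norm x \<le> p x" for x using h_p[of "[]" x] by (simp add: h_def)
  then have nn: "0 \<le> p x" for x by (rule order_trans[OF norm_ge_zero])
  have h_sc: "h ws (c *\<^sub>R x) = \<bar>c\<bar> * h ws x" for ws c x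
    by (simp add: h_def mat_vec.scaleR_right)
  have sc_le: "p (c *\<^sub>R x) \<le> \<bar>c\<bar> * p x" for c x
    by (intro p_le) (simp add: h_sc mult_left_mono h_p)
  have sc: "p (c *\<^sub>R x) = \<bar>c\<bar> * p x" for c x
  proof (cases "c = 0")
    case True
    then show ?thesis using sc_le[of 0 x] nn[of 0] by simp
  next
    case False
    then show ?thesis using sc_le[of c x] sc_le[of "1 / c" "c *\<^sub>R x"] by (simp add: field_simps)
  qed
  have tri: "p (x + y) \<le> p x + p y" for x y
  proof (rule p_le)
    fix ws assume ws: "ws \<in> words (UNIV :: 'n set)"
    have "h ws (x + y) \<le> h ws x + h ws y"
      unfolding h_def distrib_left[symmetric]
      by (intro mult_left_mono) (auto simp: mat_vec.add_right norm_triangle_ineq)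
    then show "h ws (x + y) \<le> p x + p y" using h_p[OF ws, of x] h_p[OF ws, of y] by linarith
  qed
  have "p (word_flow A us *v x) \<le> exp ((\<theta> + \<delta>) * duration us) * p x" if us: "us \<in> words UNIV" for us x
  proof (rule p_le)
    fix ws assume ws: "ws \<in> words (UNIV :: 'n set)"
    have "h ws (word_flow A us *v x) = exp ((\<theta> + \<delta>) * duration us) * h (us @ ws) x"
    proof -
      have "- ((\<theta> + \<delta>) * duration ws)
          = (\<theta> + \<delta>) * duration us + - ((\<theta> + \<delta>) * duration (us @ ws))"
        by (simp add: algebra_simps)
      then have "exp (- ((\<theta> + \<delta>) * duration ws))
          = exp ((\<theta> + \<delta>) * duration us) * exp (- ((\<theta> + \<delta>) * duration (us @ ws)))"
        by (simp only: exp_add)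
      then show ?thesis
        unfolding h_def word_flow_append by (simp only: matrix_vector_mul_assoc mult.assoc)
    qed
    also have "\<dots> \<le> exp ((\<theta> + \<delta>) * duration us) * p x"
      using us ws by (intro mult_left_mono[OF h_p]) simp_all
    finally show "h ws (word_flow A us *v x) \<le> exp ((\<theta> + \<delta>) * duration us) * p x" .
  qed
  then have "adapted A (\<theta> + \<delta>) p" unfolding adapted_def using nn sc tri by blast
  moreover have "p x \<le> C * norm x" for x by (rule p_le) (rule h_le)
  ultimately show ?thesis using that low by blast
qed

section \<open>Periodic words\<close>

lemma word_flow_concat_replicate:
  "word_flow A (concat (replicate m ws)) = mat_pow (word_flow A ws) m"
  by (induction m) (simp_all add: word_flow_append mat_pow_commute mat_pow_Suc)

lemma duration_concat_replicate: "duration (concat (replicate m ws)) = real m * duration ws"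
  by (induction m) (simp_all add: algebra_simps)

lemma words_concat_replicate: "ws \<in> words J \<Longrightarrow> concat (replicate m ws) \<in> words J"
  by (induction m) simp_all

lemma le_of_power_le_const_power:
  fixes x y :: real
  assumes "0 \<le> x" "0 < y" and le: "\<And>m. x ^ m \<le> C * y ^ m"
  shows "x \<le> y"
proof (rule ccontr)
  assume "\<not> x \<le> y"
  then have "1 < x / y" using assms by simp
  then obtain m where "C < (x / y) ^ m" using real_arch_pow by blast
  then have "C * y ^ m < x ^ m" using assms(2) by (simp add: power_divide field_simps)
  with le[of m] show False by simp
qed

text \<open>A product may be repeated periodically, so its eigenvalues cannot exceed the growth rate.\<close>

lemma spectral_radius_le_growth:
  fixes A :: "'n \<Rightarrow> real ^ 'd ^ 'd"
  assumes g: "growth_bound A \<theta>" and ws: "ws \<in> words UNIV"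
  shows "spectral_radius (word_flow A ws) \<le> exp (\<theta> * duration ws)"
proof -
  obtain z where z: "z \<in> mat_spectrum (word_flow A ws)" "cmod z = spectral_radius (word_flow A ws)"
    by (rule spectral_radius_attained)
  have le: "spectral_radius (word_flow A ws) \<le> exp ((\<theta> + \<delta>) * duration ws)" if \<delta>: "0 < \<delta>" for \<delta>
  proof -
    obtain C where C: "\<And>ws x. ws \<in> words UNIV \<Longrightarrow>
        norm (word_flow A ws *v x) \<le> C * exp ((\<theta> + \<delta>) * duration ws) * norm x"
      using g \<delta> unfolding growth_bound_def by blast
    have "cmod z ^ m \<le> C * exp ((\<theta> + \<delta>) * duration ws) ^ m" for m
    proof -
      have "cmod (z ^ m) \<le> C * exp ((\<theta> + \<delta>) * duration (concat (replicate m ws)))"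
        using C[OF words_concat_replicate[OF ws, of m]] mat_spectrum_mat_pow[OF z(1), of m]
        unfolding word_flow_concat_replicate by (rule eigenvalue_le_bound)
      then show ?thesis
        by (simp add: norm_power duration_concat_replicate exp_of_nat_mult[symmetric] mult_ac)
    qed
    then have "cmod z \<le> exp ((\<theta> + \<delta>) * duration ws)" using le_of_power_le_const_power[of "cmod z" "exp ((\<theta> + \<delta>) * duration ws)" C] by simp
    then show ?thesis using z(2) by simp
  qed
  have "((\<lambda>\<delta>. exp ((\<theta> + \<delta>) * duration ws)) \<longlongrightarrow> exp ((\<theta> + 0) * duration ws)) (at_right 0)"
    by (intro tendsto_intros)
  moreover have "\<forall>\<^sub>F \<delta> in at_right 0. spectral_radius (word_flow A ws) \<le> exp ((\<theta> + \<delta>) * duration ws)"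
    using eventually_at_right_less[of 0] by eventually_elim (rule le)
  ultimately have "spectral_radius (word_flow A ws) \<le> exp ((\<theta> + 0) * duration ws)"
    by (rule tendsto_lowerbound) simp
  then show ?thesis by simp
qed

lemma norm_mat_pow_scaled_tendsto_0:
  fixes M :: "real ^ 'd ^ 'd"
  assumes "spectral_radius M < r"
  shows "(\<lambda>m. norm ((1 / r ^ m) *\<^sub>R mat_pow M m)) \<longlonglongrightarrow> 0"
proof (rule tendsto_norm_zero, rule vec_tendstoI, rule vec_tendstoI)
  fix i j
  have "(\<lambda>m. ((1 / r ^ m) *\<^sub>R (mat_pow M m *v axis j 1)) $ i) \<longlonglongrightarrow> 0 $ i"
    by (intro tendsto_vec_nth mat_pow_tendsto_0 assms)
  then show "(\<lambda>m. ((1 / r ^ m) *\<^sub>R mat_pow M m) $ i $ j) \<longlonglongrightarrow> 0 $ i $ j"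
    by (simp add: matrix_vector_mult_basis column_def)
qed

text \<open>The factor \<open>K\<close> will be the uniform constant of \<open>adapted_uniform_bound\<close>, so that the repeated word
  halves every adapted norm.\<close>

lemma contracting_repetition:
  fixes A :: "'n \<Rightarrow> real ^ 'd ^ 'd"
  assumes ws: "ws \<in> words J" "ws \<noteq> []"
    and \<rho>: "spectral_radius (word_flow A ws) < exp (\<theta> * duration ws)" and K: "0 < K"
  obtains us where "us \<in> words J" "us \<noteq> []" "K * norm (word_flow A us) < exp (\<theta> * duration us) / 2"
proof -
  let ?r = "exp (\<theta> * duration ws)" and ?M = "word_flow A ws"
  have "\<forall>\<^sub>F m in sequentially. norm ((1 / ?r ^ m) *\<^sub>R mat_pow ?M m) < 1 / (2 * K)"
    using order_tendstoD(2)[OF norm_mat_pow_scaled_tendsto_0[OF \<rho>]] K by simp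
  then obtain m where m: "1 \<le> m" "norm ((1 / ?r ^ m) *\<^sub>R mat_pow ?M m) < 1 / (2 * K)"
    using eventually_conj[OF eventually_ge_at_top[of 1]] eventually_happens'[OF sequentially_bot] by blast
  have "norm (mat_pow ?M m) / ?r ^ m < 1 / (2 * K)" using m(2) by simp
  then have "K * norm (mat_pow ?M m) < ?r ^ m / 2" using K by (simp add: field_simps)
  also have "?r ^ m = exp (\<theta> * duration (concat (replicate m ws)))"
    by (simp add: duration_concat_replicate exp_of_nat_mult[symmetric] mult_ac)
  finally have "K * norm (word_flow A (concat (replicate m ws))) < exp (\<theta> * duration (concat (replicate m ws))) / 2"
    by (simp add: word_flow_concat_replicate)
  moreover have "concat (replicate m ws) \<noteq> []" using m(1) ws(2) by (cases m) auto
  ultimately show ?thesis using that words_concat_replicate[OF ws(1)] by blast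
qed

section \<open>Closed communicating classes\<close>

definition edges :: "real ^ 'n ^ 'n \<Rightarrow> ('n \<times> 'n) set" where
  "edges P = {(a, b). P $ a $ b \<noteq> 0}"

definition edges_in :: "real ^ 'n ^ 'n \<Rightarrow> 'n set \<Rightarrow> ('n \<times> 'n) set" where
  "edges_in P I = {(a, b). a \<in> I \<and> b \<in> I \<and> P $ a $ b \<noteq> 0}"

definition closed_class :: "real ^ 'n ^ 'n \<Rightarrow> 'n set \<Rightarrow> bool" where
  "closed_class P I \<longleftrightarrow> I \<noteq> {} \<and> (\<forall>i\<in>I. \<forall>j. P $ i $ j \<noteq> 0 \<longrightarrow> j \<in> I) \<and>
     (\<forall>i\<in>I. \<forall>j\<in>I. (i, j) \<in> (edges P)\<^sup>*)"

lemma closed_paths_stay: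
  assumes closed: "\<forall>i\<in>I. \<forall>j. P $ i $ j \<noteq> 0 \<longrightarrow> j \<in> I" and "(i, j) \<in> (edges P)\<^sup>*" and "i \<in> I"
  shows "j \<in> I \<and> (i, j) \<in> (edges_in P I)\<^sup>*"
  using assms(2)
proof (induction rule: rtrancl_induct)
  case (step y z)
  then have "(y, z) \<in> edges_in P I" "z \<in> I" using closed by (auto simp: edges_def edges_in_def)
  then show ?case using step by (meson rtrancl.rtrancl_into_rtrancl)
qed (use \<open>i \<in> I\<close> in simp)

text \<open>Paths of positive length are needed, since a word may repeat a state at which \<open>P\<close> has no loop.\<close>

lemma closed_class_trancl:
  assumes P: "stochastic_matrix P" and I: "closed_class P I" and "a \<in> I" "b \<in> I"
  shows "(a, b) \<in> (edges_in P I)\<^sup>+"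
proof -
  have closed: "\<forall>i\<in>I. \<forall>j. P $ i $ j \<noteq> 0 \<longrightarrow> j \<in> I" using I by (simp add: closed_class_def)
  have "(\<Sum>j\<in>UNIV. P $ a $ j) \<noteq> 0" using P by (simp add: stochastic_matrix_def)
  then obtain c where c: "P $ a $ c \<noteq> 0" by (meson sum.not_neutral_contains_not_neutral)
  then have "c \<in> I" "(a, c) \<in> edges_in P I" using closed \<open>a \<in> I\<close> by (auto simp: edges_in_def)
  moreover have "(c, b) \<in> (edges_in P I)\<^sup>*"
    using closed_paths_stay[OF closed, of c b] I \<open>b \<in> I\<close> \<open>c \<in> I\<close> by (simp add: closed_class_def)
  ultimately show ?thesis by (meson rtrancl_into_trancl2)
qed

lemma closed_class_disjoint:
  assumes I: "closed_class P I" and J: "closed_class P J" and "x \<in> I" "x \<in> J"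
  shows "I = J"
proof -
  have "I \<subseteq> J" if I: "closed_class P I" "x \<in> I" and J: "closed_class P J" "x \<in> J" for I J
  proof
    fix y assume "y \<in> I"
    then have "(x, y) \<in> (edges P)\<^sup>*" using I by (auto simp: closed_class_def)
    then show "y \<in> J" using closed_paths_stay[of J P x y] J by (auto simp: closed_class_def)
  qed
  then show ?thesis using assms by blast
qed

text \<open>A minimal nonempty closed set is strongly connected, because everything reachable from one of
  its points is again closed.\<close>

lemma closed_set_contains_closed_class:
  fixes P :: "real ^ 'n ^ 'n"
  assumes "S \<noteq> {}" and closed: "\<forall>i\<in>S. \<forall>j. P $ i $ j \<noteq> 0 \<longrightarrow> j \<in> S"
  obtains I where "closed_class P I" "I \<subseteq> S"
proof -
  have "\<exists>I\<subseteq>S. closed_class P I"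
    using assms
  proof (induction "card S" arbitrary: S rule: less_induct)
    case less
    show ?case
    proof (cases "closed_class P S")
      case False
      then obtain i j where ij: "i \<in> S" "j \<in> S" "(i, j) \<notin> (edges P)\<^sup>*"
        using less.prems by (auto simp: closed_class_def)
      define R where "R = {k. (i, k) \<in> (edges P)\<^sup>*}"
      have "R \<subseteq> S" using closed_paths_stay[OF less.prems(2)] ij by (auto simp: R_def)
      then have "R \<subset> S" using ij by (auto simp: R_def)
      then have "card R < card S" by (intro psubset_card_mono) auto
      moreover have "R \<noteq> {}" by (auto simp: R_def)
      moreover have "\<forall>i\<in>R. \<forall>j. P $ i $ j \<noteq> 0 \<longrightarrow> j \<in> R"
        by (auto simp: R_def edges_def intro: rtrancl.rtrancl_into_rtrancl)
      ultimately obtain I where "I \<subseteq> R" "closed_class P I" using less.hyps by blast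
      then show ?thesis using \<open>R \<subset> S\<close> by blast
    qed blast
  qed
  then show ?thesis using that by blast
qed

definition closed_classes :: "real ^ 'n ^ 'n \<Rightarrow> 'n set set" where
  "closed_classes P = {I. closed_class P I}"

lemma padded_block_powers_tendsto_0:
  fixes P :: "real ^ 'n ^ 'n"
  assumes "spectral_radius (padded_block P T) < 1"
  shows "(\<lambda>n. mat_pow (padded_block P T) n *v x) \<longlonglongrightarrow> 0"
  using mat_pow_tendsto_0[OF assms, of x] by simp

text \<open>A stochastic block inside \<open>T\<close> would keep mass forever.\<close>

lemma transient_contains_no_closed_class:
  fixes P :: "real ^ 'n ^ 'n"
  assumes P: "stochastic_matrix P" and \<rho>: "spectral_radius (padded_block P T) < 1" and I: "closed_class P I"
  shows "\<not> I \<subseteq> T"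
proof
  assume IT: "I \<subseteq> T"
  define x :: "real ^ 'n" where "x = (\<chi> i. if i \<in> I then 1 else 0)"
  have one: "(mat_pow (padded_block P T) n *v x) $ i = 1" if "i \<in> I" for n i
    using that
  proof (induction n arbitrary: i)
    case (Suc n)
    define y where "y = mat_pow (padded_block P T) n *v x"
    have y: "y $ j = 1" if "j \<in> I" for j using Suc.IH that by (simp add: y_def)
    have "(padded_block P T *v y) $ i = (\<Sum>j\<in>UNIV. P $ i $ j)"
      unfolding matrix_vector_mult_def vec_lambda_beta padded_block_def
    proof (rule sum.cong)
      fix j
      show "(if i \<in> T \<and> j \<in> T then P $ i $ j else 0) * y $ j = P $ i $ j"
      proof (cases "j \<in> I")
        case True
        then show ?thesis using Suc.prems IT y by auto
      next
        case False
        then have "P $ i $ j = 0" using I Suc.prems by (auto simp: closed_class_def)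
        then show ?thesis by simp
      qed
    qed simp
    then show ?case using P by (simp add: mat_pow_Suc_vec stochastic_matrix_def y_def)
  qed (simp add: x_def)
  obtain i where i: "i \<in> I" using I by (auto simp: closed_class_def)
  have "(\<lambda>n. (mat_pow (padded_block P T) n *v x) $ i) \<longlonglongrightarrow> 0 $ i"
    by (intro tendsto_vec_nth padded_block_powers_tendsto_0 \<rho>)
  then show False using i by (simp add: one LIMSEQ_const_iff)
qed

text \<open>For an eigenvalue of modulus at least one, the entries of maximal modulus of an eigenvector form a
  closed set inside the transient states, which would contain a closed class.\<close>

lemma spectral_radius_transient_block:
  fixes P :: "real ^ 'n ^ 'n"
  assumes P: "stochastic_matrix P"
  shows "spectral_radius (padded_block P (UNIV - \<Union>(closed_classes P))) < 1"
proof -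
  define T where "T = UNIV - \<Union>(closed_classes P)"
  obtain z where z: "z \<in> mat_spectrum (padded_block P T)" "cmod z = spectral_radius (padded_block P T)"
    by (rule spectral_radius_attained)
  have "cmod z < 1"
  proof (rule ccontr)
    assume "\<not> cmod z < 1"
    then have z1: "1 \<le> cmod z" by simp
    obtain v where v: "v \<noteq> 0" "map_matrix complex_of_real (padded_block P T) *v v = z *s v"
      using z(1) by (auto simp: mat_spectrum_def)
    have comp: "z * v $ i = (\<Sum>j\<in>UNIV. complex_of_real (padded_block P T $ i $ j) * v $ j)" for i
    proof -
      have "(map_matrix complex_of_real (padded_block P T) *v v) $ i = z * v $ i" using v(2) by simp
      then show ?thesis by (simp add: matrix_vector_mult_def map_matrix_def)
    qed
    define m where "m = Max (range (\<lambda>i. cmod (v $ i)))"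
    have le_m: "cmod (v $ i) \<le> m" for i unfolding m_def by (intro Max_ge) auto
    obtain k where "v $ k \<noteq> 0" using v(1) by (auto simp: vec_eq_iff)
    then have m0: "0 < m" using le_m[of k] by (smt (verit) zero_less_norm_iff)
    define S where "S = {i. cmod (v $ i) = m}"
    have "m \<in> range (\<lambda>i. cmod (v $ i))" unfolding m_def by (intro Max_in) auto
    then have S_ne: "S \<noteq> {}" by (auto simp: S_def)
    have Pnn: "0 \<le> P $ i $ j" and Psum: "(\<Sum>j\<in>UNIV. P $ i $ j) = 1" for i j
      using P by (auto simp: stochastic_matrix_def)
    have S: "i \<in> T \<and> j \<in> T \<and> j \<in> S" if i: "i \<in> S" and ij: "P $ i $ j \<noteq> 0" for i j
    proof -
      have "m \<le> cmod (z * v $ i)" using i z1 m0 by (simp add: S_def norm_mult)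
      also have "\<dots> \<le> (\<Sum>j\<in>UNIV. padded_block P T $ i $ j * cmod (v $ j))"
        unfolding comp by (rule order_trans[OF norm_sum])
          (simp add: norm_mult padded_block_def Pnn sum_mono)
      finally have "0 \<le> (\<Sum>j\<in>UNIV. padded_block P T $ i $ j * cmod (v $ j) - P $ i $ j * m)"
        by (simp add: sum_subtractf sum_distrib_right[symmetric] Psum)
      moreover have le: "padded_block P T $ i $ j * cmod (v $ j) - P $ i $ j * m \<le> 0" for j
        using le_m[of j] Pnn[of i j] m0 by (auto simp: padded_block_def mult_left_mono)
      ultimately have "(\<Sum>j\<in>UNIV. - (padded_block P T $ i $ j * cmod (v $ j) - P $ i $ j * m)) = 0"
        using sum_nonpos[of UNIV "\<lambda>j. padded_block P T $ i $ j * cmod (v $ j) - P $ i $ j * m", OF le]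
        unfolding sum_negf by linarith
      then have "\<forall>j\<in>UNIV. - (padded_block P T $ i $ j * cmod (v $ j) - P $ i $ j * m) = 0"
        by (subst (asm) sum_nonneg_eq_0_iff) (use le in auto)
      then have "padded_block P T $ i $ j * cmod (v $ j) = P $ i $ j * m" by simp
      then show ?thesis using ij m0 by (auto simp: padded_block_def S_def split: if_splits)
    qed
    have "S \<subseteq> T"
    proof
      fix i assume i: "i \<in> S"
      obtain j where "P $ i $ j \<noteq> 0" using Psum[of i] by (metis sum.neutral zero_neq_one)
      then show "i \<in> T" using S i by blast
    qed
    obtain I where "closed_class P I" "I \<subseteq> S"
      using closed_set_contains_closed_class[OF S_ne, of P] S by blast
    then show False using \<open>S \<subseteq> T\<close> by (auto simp: T_def closed_classes_def closed_class_def)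
  qed
  then show ?thesis using z(2) by (simp add: T_def)
qed

text \<open>Existence and uniqueness of the block form: the recurrence classes and the transient states refer to
  one and the same decomposition.\<close>

lemma block_form_iff:
  fixes P :: "real ^ 'n ^ 'n"
  assumes P: "stochastic_matrix P"
  shows "block_form P C T \<longleftrightarrow> C = closed_classes P \<and> T = UNIV - \<Union>(closed_classes P)"
proof
  assume b: "block_form P C T"
  have sub: "C \<subseteq> closed_classes P"
  proof
    fix I assume I: "I \<in> C"
    have ne: "I \<noteq> {}" using b I by (auto simp: block_form_def)
    have closed: "\<forall>i\<in>I. \<forall>j. P $ i $ j \<noteq> 0 \<longrightarrow> j \<in> I" using b I by (auto simp: block_form_def)
    have "(i, j) \<in> (edges P)\<^sup>*" if "i \<in> I" "j \<in> I" for i j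
    proof (rule subsetD[OF rtrancl_mono])
      show "{(a, b). a \<in> I \<and> b \<in> I \<and> P $ a $ b \<noteq> 0} \<subseteq> edges P" by (auto simp: edges_def)
      show "(i, j) \<in> {(a, b). a \<in> I \<and> b \<in> I \<and> P $ a $ b \<noteq> 0}\<^sup>*"
        using b I that by (simp add: block_form_def strongly_connected_block_def)
    qed
    then show "I \<in> closed_classes P" using ne closed by (simp add: closed_classes_def closed_class_def)
  qed
  have \<rho>: "spectral_radius (padded_block P T) < 1" and T: "T = UNIV - \<Union>C"
    using b by (auto simp: block_form_def)
  have "closed_classes P \<subseteq> C"
  proof
    fix I assume "I \<in> closed_classes P"
    then have I: "closed_class P I" by (simp add: closed_classes_def)
    then obtain x where x: "x \<in> I" "x \<notin> T" using transient_contains_no_closed_class[OF P \<rho> I] by blast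
    then obtain J where J: "J \<in> C" "x \<in> J" using T by auto
    then have "closed_class P J" using sub by (auto simp: closed_classes_def)
    then show "I \<in> C" using closed_class_disjoint[OF I _ x(1) J(2)] J(1) by simp
  qed
  then show "C = closed_classes P \<and> T = UNIV - \<Union>(closed_classes P)" using sub T by auto
next
  assume CT: "C = closed_classes P \<and> T = UNIV - \<Union>(closed_classes P)"
  have "{} \<notin> C" using CT by (auto simp: closed_classes_def closed_class_def)
  moreover have "disjoint C"
    unfolding pairwise_def disjnt_def
  proof (intro ballI impI)
    fix I J assume "I \<in> C" "J \<in> C" and ne: "I \<noteq> J"
    then have "closed_class P I" "closed_class P J" using CT by (simp_all add: closed_classes_def)
    then show "I \<inter> J = {}" using closed_class_disjoint[of P I J] ne by blast
  qed
  moreover have "(\<forall>i\<in>I. \<forall>j\<in>-I. P $ i $ j = 0) \<and> stochastic_block P I \<and> strongly_connected_block P I"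
    if "I \<in> C" for I
  proof -
    have I: "closed_class P I" using that CT by (simp add: closed_classes_def)
    then have closed: "\<forall>i\<in>I. \<forall>j. P $ i $ j \<noteq> 0 \<longrightarrow> j \<in> I" by (simp add: closed_class_def)
    have "(\<Sum>j\<in>I. P $ i $ j) = (\<Sum>j\<in>UNIV. P $ i $ j)" if "i \<in> I" for i
      using closed that by (intro sum.mono_neutral_left) auto
    then have "stochastic_block P I" using P by (simp add: stochastic_block_def stochastic_matrix_def)
    moreover have "strongly_connected_block P I"
      using closed_paths_stay[OF closed] I
      unfolding strongly_connected_block_def closed_class_def edges_in_def by blast
    ultimately show ?thesis using closed by auto
  qed
  ultimately show "block_form P C T"
    using CT spectral_radius_transient_block[OF P] by (auto simp: block_form_def)
qed

lemma recurrence_classes_eq: "stochastic_matrix P \<Longrightarrow> recurrence_classes P = closed_classes P"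
  by (auto simp: recurrence_classes_def block_form_iff)

lemma transient_states_eq: "stochastic_matrix P \<Longrightarrow> transient_states P = UNIV - \<Union>(closed_classes P)"
  by (auto simp: transient_states_def block_form_iff)

section \<open>Contracting patterns\<close>

lemma trancl_path:
  assumes "(a, b) \<in> (edges_in P I)\<^sup>+"
  shows "\<exists>zs. set zs \<subseteq> I \<and> successively (\<lambda>x y. P $ x $ y \<noteq> 0) (a # zs @ [b])"
  using assms
proof (induction rule: trancl_induct)
  case (base y)
  then show ?case by (intro exI[of _ "[]"]) (auto simp: edges_in_def)
next
  case (step y z)
  then obtain zs where "set zs \<subseteq> I" "successively (\<lambda>x y. P $ x $ y \<noteq> 0) (a # zs @ [y])" by blast
  moreover have "successively (\<lambda>x y. P $ x $ y \<noteq> 0) ((a # zs @ [y]) @ [z])"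
    using calculation(2) step(2) unfolding successively_append_iff by (simp add: edges_in_def)
  ultimately show ?case using step(2) by (intro exI[of _ "zs @ [y]"]) (simp add: edges_in_def)
qed

lemma word_flow_zero_times: "word_flow A (map (\<lambda>z. (z, 0)) zs) = mat 1"
  by (induction zs) auto

lemma duration_zero_times: "duration (map (\<lambda>z. (z, 0)) zs) = 0"
  by (induction zs) auto

lemma words_zero_times: "set zs \<subseteq> I \<Longrightarrow> map (\<lambda>z. (z, 0)) zs \<in> words I"
  by (induction zs) auto

text \<open>Visiting further states for time zero turns a word into a path of the graph of \<open>P\<close> and
  changes neither the product nor the duration.\<close>

lemma word_along_path:
  assumes conn: "\<And>a b. a \<in> I \<Longrightarrow> b \<in> I \<Longrightarrow> (a, b) \<in> (edges_in P I)\<^sup>+"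
    and "ws \<in> words I" "ws \<noteq> []"
  shows "\<exists>us\<in>words I. us \<noteq> [] \<and> fst (hd us) = fst (hd ws) \<and> word_flow A us = word_flow A ws \<and>
    duration us = duration ws \<and> successively (\<lambda>x y. P $ x $ y \<noteq> 0) (map fst us)"
  using assms(2,3)
proof (induction ws)
  case (Cons p ws)
  show ?case
  proof (cases "ws = []")
    case True
    then show ?thesis using Cons by (intro bexI[of _ "[p]"]) auto
  next
    case False
    then obtain us where us: "us \<in> words I" "us \<noteq> []" "word_flow A us = word_flow A ws"
      "duration us = duration ws" "successively (\<lambda>x y. P $ x $ y \<noteq> 0) (map fst us)"
      using Cons by auto
    have "fst (hd us) \<in> I" using us(1,2) by (cases us) auto
    then obtain zs where zs: "set zs \<subseteq> I" "successively (\<lambda>x y. P $ x $ y \<noteq> 0) (fst p # zs @ [fst (hd us)])"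
      using trancl_path[OF conn[of "fst p" "fst (hd us)"]] Cons by auto
    define vs where "vs = p # map (\<lambda>z. (z, 0)) zs @ us"
    obtain i s where p: "p = (i, s)" by fastforce
    have "vs \<in> words I" using Cons us words_zero_times[OF zs(1)] by (simp add: vs_def)
    moreover have "word_flow A vs = word_flow A (p # ws)"
      using us by (simp add: vs_def p word_flow_append word_flow_zero_times)
    moreover have "duration vs = duration (p # ws)"
      using us by (simp add: vs_def duration_zero_times)
    moreover have "successively (\<lambda>x y. P $ x $ y \<noteq> 0) (map fst vs)"
    proof -
      have "map fst vs = (fst p # zs) @ map fst us" by (simp add: vs_def comp_def)
      moreover have "hd (map fst us) = fst (hd us)" using us(2) by (simp add: hd_map)
      ultimately show ?thesis using zs(2) us(2,5)
        by (simp only: append_Cons[symmetric] successively_append_iff) auto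
    qed
    ultimately show ?thesis by (intro bexI[of _ vs]) (auto simp: vs_def)
  qed
qed simp

lemma tendsto_word_flow:
  assumes "\<And>l. l < q \<Longrightarrow> (\<lambda>n. s n l) \<longlonglongrightarrow> a l"
  shows "(\<lambda>n. word_flow A (map (\<lambda>l. (w l, s n l)) [0..<q])) \<longlonglongrightarrow> word_flow A (map (\<lambda>l. (w l, a l)) [0..<q])"
  using assms
proof (induction q)
  case (Suc q)
  then have "(\<lambda>n. word_flow A (map (\<lambda>l. (w l, s n l)) [0..<q])) \<longlonglongrightarrow> word_flow A (map (\<lambda>l. (w l, a l)) [0..<q])"
    by simp
  moreover have "(\<lambda>n. mat_exp (s n q *\<^sub>R A (w q))) \<longlonglongrightarrow> mat_exp (a q *\<^sub>R A (w q))"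
    by (intro tendsto_mat_exp Suc) simp
  ultimately show ?case by (simp add: word_flow_append mat_mult.tendsto)
qed simp

text \<open>With the uniform constant for \<open>K\<close>, every passage through the pattern halves every adapted norm. The
  holding times range over an open box, so that passages have positive probability.\<close>

definition contracting_pattern ::
  "('n \<Rightarrow> real ^ 'd ^ 'd) \<Rightarrow> real ^ 'n ^ 'n \<Rightarrow> 'n set \<Rightarrow> real \<Rightarrow> real \<Rightarrow> nat \<Rightarrow> (nat \<Rightarrow> 'n) \<Rightarrow>
    (nat \<Rightarrow> real) \<Rightarrow> real \<Rightarrow> bool" where
  "contracting_pattern A P I \<theta> K q w a \<epsilon> \<longleftrightarrow> 0 < q \<and> 0 < \<epsilon> \<and> (\<forall>l<q. w l \<in> I \<and> 0 \<le> a l) \<and>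
     (\<forall>l. Suc l < q \<longrightarrow> P $ w l $ w (Suc l) \<noteq> 0) \<and>
     (\<forall>s. (\<forall>l<q. a l < s l \<and> s l < a l + \<epsilon>) \<longrightarrow>
       K * norm (word_flow A (map (\<lambda>l. (w l, s l)) [0..<q])) \<le> exp (\<theta> * (\<Sum>l<q. s l)) / 2)"

lemma duration_map_upt: "duration (map (\<lambda>l. (w l, s l)) [0..<q]) = (\<Sum>l<q. s l)"
  by (induction q) simp_all

text \<open>Repetition gives the gain, insertion of states visited for time zero gives the path, and
  continuity in the durations gives the box.\<close>

lemma contracting_pattern_exists:
  fixes A :: "'n::finite \<Rightarrow> real ^ 'd ^ 'd"
  assumes P: "stochastic_matrix P" and I: "closed_class P I" and K: "0 < K"
    and ws: "ws \<in> words I" "ws \<noteq> []"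
    and \<rho>: "spectral_radius (word_flow A ws) < exp (\<theta> * duration ws)"
  obtains q w a \<epsilon> where "contracting_pattern A P I \<theta> K q w a \<epsilon>"
proof -
  obtain us where us: "us \<in> words I" "us \<noteq> []" "K * norm (word_flow A us) < exp (\<theta> * duration us) / 2"
    using contracting_repetition[OF ws \<rho> K] .
  obtain vs where vs: "vs \<in> words I" "vs \<noteq> []" "word_flow A vs = word_flow A us" "duration vs = duration us"
    "successively (\<lambda>x y. P $ x $ y \<noteq> 0) (map fst vs)"
    using word_along_path[OF closed_class_trancl[OF P I] us(1,2)] by blast
  define q w a where "q = length vs" and "w = (\<lambda>l. fst (vs ! l))" and "a = (\<lambda>l. snd (vs ! l))"
  have vs_eq: "map (\<lambda>l. (w l, a l)) [0..<q] = vs"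
    by (simp add: q_def w_def a_def map_nth)
  have "0 < q" using vs(2) by (simp add: q_def)
  have wa: "w l \<in> I \<and> 0 \<le> a l" if "l < q" for l
  proof -
    have "vs ! l \<in> I \<times> {0..}" using vs(1) that nth_mem[of l vs] by (auto simp: words_def q_def lists_eq_set)
    then show ?thesis by (auto simp: w_def a_def)
  qed
  have path: "P $ w l $ w (Suc l) \<noteq> 0" if "Suc l < q" for l
    using vs(5) that by (simp add: successively_conv_nth q_def w_def)
  define F where "F s = K * norm (word_flow A (map (\<lambda>l. (w l, s l)) [0..<q])) - exp (\<theta> * (\<Sum>l<q. s l)) / 2" for s
  have Fa: "F a < 0"
    using us(3) vs(3,4) duration_map_upt[of w a q] unfolding F_def vs_eq by simp
  have "\<exists>\<epsilon>>0. \<forall>s. (\<forall>l<q. a l < s l \<and> s l < a l + \<epsilon>) \<longrightarrow> F s \<le> 0"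
  proof (rule ccontr)
    assume "\<not> ?thesis"
    then have "\<forall>n. \<exists>s. (\<forall>l<q. a l < s l \<and> s l < a l + 1 / real (Suc n)) \<and> 0 < F s"
      by (metis not_le of_nat_0_less_iff zero_less_Suc zero_less_divide_1_iff)
    then obtain s where s: "\<And>n l. l < q \<Longrightarrow> a l < s n l \<and> s n l < a l + 1 / real (Suc n)" "\<And>n. 0 < F (s n)"
      by metis
    have lim: "(\<lambda>n. s n l) \<longlonglongrightarrow> a l" if "l < q" for l
    proof (rule tendsto_sandwich[of "\<lambda>_. a l" _ _ "\<lambda>n. a l + 1 / real (Suc n)"])
      have "(\<lambda>n. a l + 1 / real (Suc n)) \<longlonglongrightarrow> a l + 0"
        by (intro tendsto_intros lim_const_over_n[THEN LIMSEQ_Suc])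
      then show "(\<lambda>n. a l + 1 / real (Suc n)) \<longlonglongrightarrow> a l" by simp
    qed (use s(1)[OF that] in \<open>auto intro!: always_eventually less_imp_le\<close>)
    have "(\<lambda>n. F (s n)) \<longlonglongrightarrow> F a"
      unfolding F_def using lim by (intro tendsto_intros tendsto_word_flow) auto
    then have "0 \<le> F a" by (rule LIMSEQ_le_const) (use s(2) less_imp_le in blast)
    with Fa show False by simp
  qed
  then obtain \<epsilon> where \<epsilon>: "0 < \<epsilon>" "\<And>s. (\<forall>l<q. a l < s l \<and> s l < a l + \<epsilon>) \<Longrightarrow> F s \<le> 0" by blast
  have "contracting_pattern A P I \<theta> K q w a \<epsilon>"
    unfolding contracting_pattern_def using \<open>0 < q\<close> \<epsilon> wa path by (auto simp: F_def)
  then show ?thesis by (rule that)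
qed

section \<open>The jump chain and the jump times\<close>

primrec chain_law :: "real ^ 'n ^ 'n \<Rightarrow> real ^ 'n \<Rightarrow> nat \<Rightarrow> 'n \<Rightarrow> real" where
  "chain_law P \<nu> 0 i = \<nu> $ i"
| "chain_law P \<nu> (Suc n) i = (\<Sum>j\<in>UNIV. chain_law P \<nu> n j * P $ j $ i)"

text \<open>A Markov process together with a jump chain \<open>X\<close> and holding times \<open>S\<close> that represent it.\<close>

locale markov_realisation = prob_space M
  for M :: "'w measure" +
  fixes \<nu> :: "real ^ 'n" and \<mu> :: real and P :: "real ^ 'n ^ 'n" and \<sigma> :: "'w \<Rightarrow> real \<Rightarrow> 'n"
    and X :: "nat \<Rightarrow> 'w \<Rightarrow> 'n" and S :: "nat \<Rightarrow> 'w \<Rightarrow> real"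
  assumes stochastic: "stochastic_matrix P" and initial: "probability_vector \<nu>" and rate: "0 < \<mu>"
    and paths: "\<omega> \<in> space M \<Longrightarrow> \<sigma> \<omega> \<in> switching_signals"
    and \<sigma>_measurable: "0 \<le> t \<Longrightarrow> (\<lambda>\<omega>. \<sigma> \<omega> t) \<in> measurable M (count_space UNIV)"
    and chain: "jump_chain M \<nu> P X" and holding: "holding_times M \<mu> S"
    and independent: "indep_set
          {(\<lambda>\<omega> k. X k \<omega>) -` B \<inter> space M | B. B \<in> sets (PiM (UNIV :: nat set) (\<lambda>_. count_space UNIV))}
          {(\<lambda>\<omega> k. S k \<omega>) -` B \<inter> space M | B. B \<in> sets (PiM (UNIV :: nat set) (\<lambda>_. borel))}"
    and realisation: "AE \<omega> in M. \<forall>k t. (\<Sum>j<k. S j \<omega>) \<le> t \<and> t < (\<Sum>j\<le>k. S j \<omega>) \<longrightarrow> \<sigma> \<omega> t = X k \<omega>"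
begin

lemma X_measurable [measurable]: "X k \<in> measurable M (count_space UNIV)"
  using chain by (simp add: jump_chain_def)

lemma S_distributed: "distributed M lborel (S k) (exponential_density \<mu>)"
  using holding by (simp add: holding_times_def)

lemma S_measurable [measurable]: "S k \<in> borel_measurable M"
  using S_distributed[of k] rate by (simp add: exponential_distributed_iff)

lemma P_nonneg: "0 \<le> P $ i $ j" and P_sum: "(\<Sum>j\<in>UNIV. P $ i $ j) = 1"
  using stochastic by (auto simp: stochastic_matrix_def)

lemma chain_law_nonneg: "0 \<le> chain_law P \<nu> n i"
  using initial P_nonneg by (induction n arbitrary: i) (auto simp: probability_vector_def sum_nonneg)

text \<open>Later cylinder probabilities follow by summing over the state before the cylinder.\<close>

lemma prob_cylinder:
  "prob {\<omega> \<in> space M. \<forall>k\<le>m. X (n + k) \<omega> = w k}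
    = chain_law P \<nu> n (w 0) * (\<Prod>k<m. P $ w k $ w (Suc k))"
proof (induction n arbitrary: m w)
  case 0
  then show ?case using chain by (simp add: jump_chain_def)
next
  case (Suc n)
  let ?w = "\<lambda>i. case_nat i w"
  let ?E = "\<lambda>i. {\<omega> \<in> space M. \<forall>k\<le>Suc m. X (n + k) \<omega> = ?w i k}"
  have "{\<omega> \<in> space M. \<forall>k\<le>m. X (Suc n + k) \<omega> = w k} = (\<Union>i\<in>UNIV. ?E i)"
  proof (intro set_eqI iffI)
    fix \<omega> assume \<omega>: "\<omega> \<in> {\<omega> \<in> space M. \<forall>k\<le>m. X (Suc n + k) \<omega> = w k}"
    have "X (n + k) \<omega> = ?w (X n \<omega>) k" if "k \<le> Suc m" for k
      using \<omega> that by (cases k) auto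
    then show "\<omega> \<in> (\<Union>i\<in>UNIV. ?E i)" using \<omega> by blast
  next
    fix \<omega> assume "\<omega> \<in> (\<Union>i\<in>UNIV. ?E i)"
    then obtain i where \<omega>: "\<omega> \<in> space M" and i: "\<And>k. k \<le> Suc m \<Longrightarrow> X (n + k) \<omega> = ?w i k" by auto
    have "X (Suc n + k) \<omega> = w k" if "k \<le> m" for k using i[of "Suc k"] that by simp
    then show "\<omega> \<in> {\<omega> \<in> space M. \<forall>k\<le>m. X (Suc n + k) \<omega> = w k}" using \<omega> by simp
  qed
  moreover have "prob (\<Union>i\<in>UNIV. ?E i) = (\<Sum>i\<in>UNIV. prob (?E i))"
  proof (rule finite_measure_finite_Union)
    show "?E ` UNIV \<subseteq> events" by auto
    show "disjoint_family_on ?E UNIV"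
      unfolding disjoint_family_on_def
    proof (intro ballI impI)
      fix i j :: 'n assume ne: "i \<noteq> j"
      have "X n \<omega> = i" if "\<omega> \<in> ?E i" for \<omega> i using that by (auto dest: spec[where x = 0])
      then show "?E i \<inter> ?E j = {}" using ne by blast
    qed
  qed simp
  moreover have "prob (?E i) = (chain_law P \<nu> n i * P $ i $ w 0) * (\<Prod>k<m. P $ w k $ w (Suc k))" for i
    unfolding Suc.IH by (simp add: prod.lessThan_Suc_shift del: prod.lessThan_Suc)
  ultimately show ?case by (simp add: sum_distrib_right)
qed

lemma prob_X: "prob {\<omega> \<in> space M. X n \<omega> = i} = chain_law P \<nu> n i"
  using prob_cylinder[of 0 n "\<lambda>_. i"] by simp

lemma AE_chain_law_0:
  assumes "chain_law P \<nu> n i = 0"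
  shows "AE \<omega> in M. X n \<omega> \<noteq> i"
proof (rule AE_I')
  show "{\<omega> \<in> space M. X n \<omega> = i} \<in> null_sets M"
    using prob_X[of n i] assms by (auto simp: null_sets_def emeasure_eq_measure)
qed auto

lemma AE_edges: "AE \<omega> in M. \<forall>k. P $ X k \<omega> $ X (Suc k) \<omega> \<noteq> 0"
proof -
  have "AE \<omega> in M. X k \<omega> = i \<longrightarrow> X (Suc k) \<omega> = j \<longrightarrow> P $ i $ j \<noteq> 0" for k i j
  proof (cases "P $ i $ j = 0")
    case True
    have "prob {\<omega> \<in> space M. X k \<omega> = i \<and> X (Suc k) \<omega> = j} = 0"
    proof -
      have "{\<omega> \<in> space M. X k \<omega> = i \<and> X (Suc k) \<omega> = j}
          = {\<omega> \<in> space M. \<forall>l\<le>1. X (k + l) \<omega> = case_nat i (\<lambda>_. j) l}"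
        by (auto simp: le_Suc_eq)
      then show ?thesis using prob_cylinder[of 1 k "case_nat i (\<lambda>_. j)"] True by simp
    qed
    then show ?thesis
      by (intro AE_I'[of "{\<omega> \<in> space M. X k \<omega> = i \<and> X (Suc k) \<omega> = j}"])
         (auto simp: null_sets_def emeasure_eq_measure)
  qed simp
  then have "AE \<omega> in M. \<forall>k i j. X k \<omega> = i \<longrightarrow> X (Suc k) \<omega> = j \<longrightarrow> P $ i $ j \<noteq> 0"
    unfolding AE_all_countable by blast
  then show ?thesis by eventually_elim blast
qed

lemma AE_S_pos: "AE \<omega> in M. \<forall>k. 0 < S k \<omega>"
proof -
  have "AE \<omega> in M. 0 < S k \<omega>" for k
  proof (rule AE_I'[of "{\<omega> \<in> space M. S k \<omega> \<le> 0}"])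
    show "{\<omega> \<in> space M. S k \<omega> \<le> 0} \<in> null_sets M"
      using exponential_distributedD_le[OF S_distributed[of k], of 0] rate
      by (auto simp: null_sets_def emeasure_eq_measure)
  qed auto
  then show ?thesis by (simp add: AE_all_countable)
qed

lemma prob_S_box:
  assumes B: "\<And>l. l < q \<Longrightarrow> B l \<in> sets borel"
  shows "prob {\<omega> \<in> space M. \<forall>l<q. S (n + l) \<omega> \<in> B l} = (\<Prod>l<q. prob {\<omega> \<in> space M. S (n + l) \<omega> \<in> B l})"
proof (cases "q = 0")
  case True
  then show ?thesis by (simp add: prob_space)
next
  case False
  have "prob (\<Inter>k\<in>(\<lambda>l. n + l) ` {..<q}. S k -` B (k - n) \<inter> space M)
      = (\<Prod>k\<in>(\<lambda>l. n + l) ` {..<q}. prob (S k -` B (k - n) \<inter> space M))"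
    using holding False B unfolding holding_times_def
    by (intro indep_varsD[of "\<lambda>_. borel" S UNIV]) auto
  also have "\<dots> = (\<Prod>l<q. prob (S (n + l) -` B l \<inter> space M))"
    by (subst prod.reindex) (auto simp: inj_on_def)
  also have "(\<Inter>k\<in>(\<lambda>l. n + l) ` {..<q}. S k -` B (k - n) \<inter> space M) = {\<omega> \<in> space M. \<forall>l<q. S (n + l) \<omega> \<in> B l}"
    using False by auto
  finally show ?thesis by (simp add: vimage_def Int_def conj_commute)
qed

lemma prob_S_interval:
  assumes "0 \<le> a" "a \<le> b"
  shows "prob {\<omega> \<in> space M. S k \<omega> \<in> {a<..b}} = exp (- a * \<mu>) - exp (- b * \<mu>)"
proof -
  have "{\<omega> \<in> space M. S k \<omega> \<in> {a<..b}} = {\<omega> \<in> space M. S k \<omega> \<le> b} - {\<omega> \<in> space M. S k \<omega> \<le> a}"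
    by auto
  then have "prob {\<omega> \<in> space M. S k \<omega> \<in> {a<..b}}
      = prob {\<omega> \<in> space M. S k \<omega> \<le> b} - prob {\<omega> \<in> space M. S k \<omega> \<le> a}"
    using assms by (simp add: finite_measure_Diff Collect_mono_iff)
  then show ?thesis using exponential_distributedD_le[OF S_distributed] assms rate by simp
qed

definition T :: "nat \<Rightarrow> 'w \<Rightarrow> real" where
  "T n \<omega> = (\<Sum>j<n. S j \<omega>)"

lemma T_measurable [measurable]: "T n \<in> borel_measurable M"
  unfolding T_def by measurable

lemma T_simps [simp]: "T 0 \<omega> = 0" "T (Suc n) \<omega> = T n \<omega> + S n \<omega>"
  by (simp_all add: T_def)

text \<open>Almost surely infinitely many holding times exceed \<open>1\<close>, so there is no explosion.\<close>

lemma AE_T_unbounded: "AE \<omega> in M. \<forall>t. \<exists>n. t < T n \<omega>"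
proof -
  have large: "AE \<omega> in M. \<exists>j\<ge>n. 1 < S j \<omega>" for n
  proof -
    let ?E = "\<lambda>k. {\<omega> \<in> space M. \<forall>l<k. S (n + l) \<omega> \<in> {..1}}"
    have E: "prob (?E k) = (1 - exp (- \<mu>)) ^ k" for k
    proof -
      have "prob {\<omega> \<in> space M. S (n + l) \<omega> \<in> {..1}} = 1 - exp (- \<mu>)" for l
        using exponential_distributedD_le[OF S_distributed, of 1] rate by simp
      then show ?thesis by (subst prob_S_box) auto
    qed
    let ?N = "{\<omega> \<in> space M. \<forall>l. S (n + l) \<omega> \<le> 1}"
    have "prob ?N \<le> (1 - exp (- \<mu>)) ^ k" for k
      unfolding E[symmetric] by (intro finite_measure_mono) auto
    moreover have "(\<lambda>k. (1 - exp (- \<mu>)) ^ k) \<longlonglongrightarrow> 0"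
      using rate by (intro LIMSEQ_realpow_zero) auto
    ultimately have "prob ?N \<le> 0" by (meson LIMSEQ_le_const)
    then have "?N \<in> null_sets M" by (auto simp: null_sets_def emeasure_eq_measure measure_le_0_iff)
    then show ?thesis
    proof (rule AE_I')
      show "{\<omega> \<in> space M. \<not> (\<exists>j\<ge>n. 1 < S j \<omega>)} \<subseteq> ?N" by (auto simp: not_less)
    qed
  qed
  then have "AE \<omega> in M. \<forall>n. \<exists>j\<ge>n. 1 < S j \<omega>" by (simp add: AE_all_countable)
  then show ?thesis using AE_S_pos
  proof eventually_elim
    case (elim \<omega>)
    have mono: "T m \<omega> \<le> T (m + n) \<omega>" for m n
    proof (induction n)
      case (Suc n)
      then show ?case using elim(2)[rule_format, of "m + n"] by simp
    qed simp
    have "\<exists>n. real k \<le> T n \<omega>" for k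
    proof (induction k)
      case (Suc k)
      then obtain n where n: "real k \<le> T n \<omega>" by blast
      obtain j where j: "n \<le> j" "1 < S j \<omega>" using elim(1) by blast
      have "T n \<omega> \<le> T j \<omega>" using mono[of n "j - n"] j by simp
      then have "real (Suc k) \<le> T (Suc j) \<omega>" using n j by simp
      then show ?case by blast
    qed (auto intro: exI[of _ 0])
    then show ?case by (meson less_le_trans reals_Archimedean2)
  qed
qed

text \<open>The almost sure properties of a path after which the remaining arguments are deterministic.\<close>

definition regular :: "'w \<Rightarrow> bool" where
  "regular \<omega> \<longleftrightarrow> (\<forall>k. 0 < S k \<omega>) \<and> (\<forall>t. \<exists>n. t < T n \<omega>) \<and> (\<forall>k. P $ X k \<omega> $ X (Suc k) \<omega> \<noteq> 0) \<and>
     (\<forall>k t. T k \<omega> \<le> t \<longrightarrow> t < T (Suc k) \<omega> \<longrightarrow> \<sigma> \<omega> t = X k \<omega>)"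

lemma AE_regular: "AE \<omega> in M. regular \<omega>"
  using AE_S_pos AE_T_unbounded AE_edges realisation
proof eventually_elim
  case (elim \<omega>)
  have "\<sigma> \<omega> t = X k \<omega>" if "T k \<omega> \<le> t" "t < T (Suc k) \<omega>" for k t
    using elim(4) that unfolding T_def lessThan_Suc_atMost by blast
  then show ?case using elim(1-3) unfolding regular_def by blast
qed

lemma
  assumes "regular \<omega>"
  shows regular_S_pos: "0 < S k \<omega>"
    and regular_unbounded: "\<exists>n. t < T n \<omega>"
    and regular_edge: "P $ X k \<omega> $ X (Suc k) \<omega> \<noteq> 0"
    and regular_\<sigma>: "T k \<omega> \<le> t \<Longrightarrow> t < T (Suc k) \<omega> \<Longrightarrow> \<sigma> \<omega> t = X k \<omega>"
  using assms unfolding regular_def by blast+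

lemma regular_T_mono: "regular \<omega> \<Longrightarrow> m \<le> n \<Longrightarrow> T m \<omega> \<le> T n \<omega>"
  unfolding T_def by (intro sum_mono2) (auto intro: less_imp_le regular_S_pos)

lemma regular_T_nonneg: "regular \<omega> \<Longrightarrow> 0 \<le> T n \<omega>"
  using regular_T_mono[of \<omega> 0 n] by simp

lemma regular_locate:
  assumes "regular \<omega>" "0 \<le> t"
  obtains k where "T k \<omega> \<le> t" "t < T (Suc k) \<omega>" "\<sigma> \<omega> t = X k \<omega>"
proof -
  obtain n where "t < T n \<omega>" using regular_unbounded[OF assms(1)] by blast
  define k where "k = (LEAST k. t < T k \<omega>)"
  have k: "t < T k \<omega>" unfolding k_def by (rule LeastI, fact)
  have "k \<noteq> 0" using k assms(2) by (auto intro!: Nat.gr0I)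
  then obtain l where l: "k = Suc l" by (cases k) auto
  then have "\<not> t < T l \<omega>" using not_less_Least[of l "\<lambda>k. t < T k \<omega>"] by (simp add: k_def)
  then show ?thesis using k l that[of l] regular_\<sigma>[OF assms(1), of l t] by simp
qed

lemma integrable_S: "integrable M (S k)"
proof (rule ccontr)
  assume "\<not> integrable M (S k)"
  then have "expectation (S k) = 0" by (rule not_integrable_integral_eq)
  then show False using exponential_distributed_expectation[OF rate S_distributed[of k]] rate by simp
qed

lemma prob_T_gt_le:
  assumes "0 < t"
  shows "prob {\<omega> \<in> space M. t < T n \<omega>} \<le> real n / (\<mu> * t)"
proof -
  have int: "integrable M (T n)" unfolding T_def by (intro Bochner_Integration.integrable_sum integrable_S)
  have "expectation (T n) = real n / \<mu>"
    unfolding T_def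
    by (simp add: Bochner_Integration.integral_sum integrable_S
        exponential_distributed_expectation[OF rate S_distributed])
  moreover have "prob {\<omega> \<in> space M. t \<le> T n \<omega>} \<le> expectation (T n) / t"
  proof (rule integral_Markov_inequality_measure[OF int])
    show "AE \<omega> in M. 0 \<le> T n \<omega>" using AE_regular by eventually_elim (rule regular_T_nonneg)
  qed (use assms in auto)
  moreover have "prob {\<omega> \<in> space M. t < T n \<omega>} \<le> prob {\<omega> \<in> space M. t \<le> T n \<omega>}"
    by (intro finite_measure_mono) auto
  ultimately show ?thesis by (simp add: field_simps)
qed

definition pattern_at :: "nat \<Rightarrow> (nat \<Rightarrow> 'n) \<Rightarrow> (nat \<Rightarrow> real) \<Rightarrow> real \<Rightarrow> nat \<Rightarrow> 'w \<Rightarrow> bool" where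
  "pattern_at q w a \<epsilon> n \<omega> \<longleftrightarrow> (\<forall>l<q. X (n + l) \<omega> = w l \<and> a l < S (n + l) \<omega> \<and> S (n + l) \<omega> < a l + \<epsilon>)"

lemma pattern_at_measurable [measurable]: "Measurable.pred M (pattern_at q w a \<epsilon> n)"
  unfolding pattern_at_def by measurable

text \<open>The constant \<open>p\<close> does not depend on the position \<open>n\<close>: it is the product of the transition
  probabilities and of the probabilities that each holding time falls into the first half of its interval.\<close>

lemma prob_pattern_ge:
  assumes q: "0 < q" and \<epsilon>: "0 < \<epsilon>" and a: "\<forall>l<q. 0 \<le> a l"
    and path: "\<forall>l. Suc l < q \<longrightarrow> P $ w l $ w (Suc l) \<noteq> 0"
  obtains p where "0 < p" "\<And>n. p * chain_law P \<nu> n (w 0) \<le> prob {\<omega> \<in> space M. pattern_at q w a \<epsilon> n \<omega>}"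
proof -
  define B where "B l = {a l<..a l + \<epsilon> / 2}" for l
  define pS where "pS = (\<Prod>l<q. exp (- a l * \<mu>) - exp (- (a l + \<epsilon> / 2) * \<mu>))"
  define pX where "pX = (\<Prod>l<q - 1. P $ w l $ w (Suc l))"
  have "- (a l + \<epsilon> / 2) * \<mu> < - a l * \<mu>" for l
    using \<epsilon> rate by (intro mult_strict_right_mono) auto
  then have "0 < pS" unfolding pS_def by (intro prod_pos) simp
  moreover have "0 < pX" unfolding pX_def using path P_nonneg
    by (intro prod_pos ballI) (metis Suc_diff_1 Suc_less_eq lessThan_iff order_less_le q)
  moreover have "pX * pS * chain_law P \<nu> n (w 0) \<le> prob {\<omega> \<in> space M. pattern_at q w a \<epsilon> n \<omega>}" for n
  proof -
    let ?X = "{\<omega> \<in> space M. \<forall>l\<le>q - 1. X (n + l) \<omega> = w l}"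
    let ?S = "{\<omega> \<in> space M. \<forall>l<q. S (n + l) \<omega> \<in> B l}"
    have S: "prob ?S = pS"
    proof -
      have "prob ?S = (\<Prod>l<q. prob {\<omega> \<in> space M. S (n + l) \<omega> \<in> B l})"
        by (rule prob_S_box) (simp add: B_def)
      also have "\<dots> = pS"
        unfolding pS_def B_def using a \<epsilon> by (intro prod.cong refl prob_S_interval) auto
      finally show ?thesis .
    qed
    have X: "prob ?X = chain_law P \<nu> n (w 0) * pX"
      unfolding pX_def by (rule prob_cylinder)
    have "prob (?X \<inter> ?S) = prob ?X * prob ?S"
    proof (rule indep_setD[OF independent])
      have "{x \<in> space (PiM UNIV (\<lambda>_. count_space UNIV)). \<forall>l\<le>q - 1. x (n + l) = w l}
          \<in> sets (PiM (UNIV :: nat set) (\<lambda>_. count_space UNIV))"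
        by measurable
      then have "{x :: nat \<Rightarrow> 'n. \<forall>l\<le>q - 1. x (n + l) = w l} \<in> sets (PiM UNIV (\<lambda>_. count_space UNIV))"
        by (simp add: space_PiM)
      moreover have "?X = (\<lambda>\<omega> k. X k \<omega>) -` {x. \<forall>l\<le>q - 1. x (n + l) = w l} \<inter> space M" by auto
      ultimately show "?X \<in> {(\<lambda>\<omega> k. X k \<omega>) -` B \<inter> space M | B. B \<in> sets (PiM UNIV (\<lambda>_. count_space UNIV))}"
        by blast
      have [measurable]: "B l \<in> sets borel" for l by (simp add: B_def)
      have "{x \<in> space (PiM UNIV (\<lambda>_. borel)). \<forall>l<q. x (n + l) \<in> B l}
          \<in> sets (PiM (UNIV :: nat set) (\<lambda>_. borel))"
        by measurable
      then have "{x :: nat \<Rightarrow> real. \<forall>l<q. x (n + l) \<in> B l} \<in> sets (PiM UNIV (\<lambda>_. borel))"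
        by (simp add: space_PiM)
      moreover have "?S = (\<lambda>\<omega> k. S k \<omega>) -` {x. \<forall>l<q. x (n + l) \<in> B l} \<inter> space M" by auto
      ultimately show "?S \<in> {(\<lambda>\<omega> k. S k \<omega>) -` B \<inter> space M | B. B \<in> sets (PiM UNIV (\<lambda>_. borel))}"
        by blast
    qed
    moreover have "?X \<inter> ?S \<subseteq> {\<omega> \<in> space M. pattern_at q w a \<epsilon> n \<omega>}"
      using \<epsilon> by (fastforce simp: pattern_at_def B_def)
    then have "prob (?X \<inter> ?S) \<le> prob {\<omega> \<in> space M. pattern_at q w a \<epsilon> n \<omega>}"
      by (intro finite_measure_mono) auto
    ultimately have "prob ?X * prob ?S \<le> prob {\<omega> \<in> space M. pattern_at q w a \<epsilon> n \<omega>}" by simp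
    then show ?thesis unfolding X S by (simp only: mult_ac)
  qed
  ultimately show ?thesis using that[of "pX * pS"] by simp
qed

section \<open>Recurrence and transience of the jump chain\<close>

lemma chain_law_step_ge: "chain_law P \<nu> n i * P $ i $ j \<le> chain_law P \<nu> (Suc n) j"
  unfolding chain_law.simps
  by (rule member_le_sum[of i UNIV "\<lambda>i. chain_law P \<nu> n i * P $ i $ j"])
     (auto intro: mult_nonneg_nonneg P_nonneg chain_law_nonneg)

lemma chain_law_path_ge:
  assumes "(i, j) \<in> (edges P)\<^sup>*"
  shows "\<exists>l c. 0 < c \<and> (\<forall>n. c * chain_law P \<nu> n i \<le> chain_law P \<nu> (n + l) j)"
  using assms
proof (induction rule: rtrancl_induct)
  case base
  then show ?case by (intro exI[of _ 0] exI[of _ 1]) simp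
next
  case (step y z)
  then obtain l c where c: "0 < c" "\<And>n. c * chain_law P \<nu> n i \<le> chain_law P \<nu> (n + l) y" by blast
  have pos: "0 < P $ y $ z" using step(2) P_nonneg[of y z] by (simp add: edges_def order_less_le)
  have "(c * P $ y $ z) * chain_law P \<nu> n i \<le> chain_law P \<nu> (n + Suc l) z" for n
  proof -
    have "(c * P $ y $ z) * chain_law P \<nu> n i \<le> chain_law P \<nu> (n + l) y * P $ y $ z"
      using c(2)[of n] pos mult_right_mono[of _ _ "P $ y $ z"] by (simp add: mult_ac)
    also have "\<dots> \<le> chain_law P \<nu> (Suc (n + l)) z" by (rule chain_law_step_ge)
    finally show ?thesis by simp
  qed
  then show ?case using c(1) pos by (intro exI[of _ "Suc l"] exI[of _ "c * P $ y $ z"]) auto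
qed

lemma chain_law_closed_mono:
  assumes closed: "\<forall>i\<in>I. \<forall>j. P $ i $ j \<noteq> 0 \<longrightarrow> j \<in> I"
  shows "(\<Sum>i\<in>I. chain_law P \<nu> n i) \<le> (\<Sum>i\<in>I. chain_law P \<nu> (Suc n) i)"
proof -
  have "(\<Sum>i\<in>I. chain_law P \<nu> n i) = (\<Sum>i\<in>I. chain_law P \<nu> n i * (\<Sum>j\<in>I. P $ i $ j))"
  proof (intro sum.cong refl)
    fix i assume "i \<in> I"
    then have "(\<Sum>j\<in>I. P $ i $ j) = (\<Sum>j\<in>UNIV. P $ i $ j)"
      using closed by (intro sum.mono_neutral_left) auto
    then show "chain_law P \<nu> n i = chain_law P \<nu> n i * (\<Sum>j\<in>I. P $ i $ j)" by (simp add: P_sum)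
  qed
  also have "\<dots> = (\<Sum>j\<in>I. \<Sum>i\<in>I. chain_law P \<nu> n i * P $ i $ j)"
    unfolding sum_distrib_left by (rule sum.swap)
  also have "\<dots> \<le> (\<Sum>j\<in>I. chain_law P \<nu> (Suc n) j)"
    using P_nonneg chain_law_nonneg by (auto intro!: sum_mono sum_mono2)
  finally show ?thesis .
qed

text \<open>A reachable closed class keeps the mass it has once received, and each state passes a fixed
  fraction of it on to \<open>j\<close> within a bounded time; so \<open>j\<close> has a positive lower density.\<close>

lemma chain_law_density:
  assumes I: "closed_class P I" and j: "j \<in> I" and i0: "i0 \<in> I" "0 < chain_law P \<nu> n0 i0"
  obtains c b where "0 < c" "\<And>m. c * real m - b \<le> (\<Sum>n<m. chain_law P \<nu> n j)"
proof -
  let ?\<pi> = "chain_law P \<nu>"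
  have "\<forall>i\<in>I. \<exists>l c. 0 < c \<and> (\<forall>n. c * ?\<pi> n i \<le> ?\<pi> (n + l) j)"
    using I j by (auto simp: closed_class_def intro: chain_law_path_ge)
  then obtain l c where lc: "\<And>i. i \<in> I \<Longrightarrow> 0 < c i" "\<And>i n. i \<in> I \<Longrightarrow> c i * ?\<pi> n i \<le> ?\<pi> (n + l i) j"
    by metis
  define L where "L = (\<Sum>i\<in>I. l i)"
  define D where "D = (\<Sum>i\<in>I. 1 / c i)"
  have L: "l i \<le> L" if "i \<in> I" for i unfolding L_def using that by (intro member_le_sum) auto
  have D: "0 < D" unfolding D_def using lc(1) i0(1) by (intro sum_pos) auto
  have mass: "?\<pi> n0 i0 \<le> (\<Sum>i\<in>I. ?\<pi> (n0 + k) i)" for k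
  proof (induction k)
    case 0
    show ?case using i0(1) chain_law_nonneg by (simp add: member_le_sum[of i0 I "?\<pi> n0"])
  next
    case (Suc k)
    then show ?case
      using chain_law_closed_mono[of I "n0 + k"] I by (simp add: closed_class_def del: chain_law.simps)
  qed
  have visits: "?\<pi> n0 i0 * real m \<le> D * (\<Sum>n<m + (n0 + L). ?\<pi> n j)" for m
  proof -
    have "?\<pi> n0 i0 * real m \<le> (\<Sum>k<m. \<Sum>i\<in>I. ?\<pi> (n0 + k) i)"
      using sum_mono[of "{..<m}" "\<lambda>_. ?\<pi> n0 i0", OF mass] by (simp add: mult.commute)
    also have "\<dots> = (\<Sum>i\<in>I. \<Sum>k<m. ?\<pi> (n0 + k) i)" by (rule sum.swap)
    also have "\<dots> \<le> (\<Sum>i\<in>I. 1 / c i * (\<Sum>n<m + (n0 + L). ?\<pi> n j))"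
    proof (rule sum_mono)
      fix i assume i: "i \<in> I"
      have "c i * (\<Sum>k<m. ?\<pi> (n0 + k) i) \<le> (\<Sum>k<m. ?\<pi> (n0 + k + l i) j)"
        unfolding sum_distrib_left by (intro sum_mono lc i)
      also have "\<dots> = (\<Sum>n\<in>(\<lambda>k. n0 + k + l i) ` {..<m}. ?\<pi> n j)"
        by (subst sum.reindex) (auto simp: inj_on_def)
      also have "\<dots> \<le> (\<Sum>n<m + (n0 + L). ?\<pi> n j)"
        using L[OF i] chain_law_nonneg by (intro sum_mono2) auto
      finally show "(\<Sum>k<m. ?\<pi> (n0 + k) i) \<le> 1 / c i * (\<Sum>n<m + (n0 + L). ?\<pi> n j)"
        using lc(1)[OF i] by (simp add: field_simps)
    qed
    also have "\<dots> = D * (\<Sum>n<m + (n0 + L). ?\<pi> n j)" by (simp add: D_def sum_distrib_right)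
    finally show ?thesis .
  qed
  show ?thesis
  proof (rule that)
    show "0 < ?\<pi> n0 i0 / D" using i0(2) D by simp
    fix m
    show "?\<pi> n0 i0 / D * real m - ?\<pi> n0 i0 / D * real (n0 + L) \<le> (\<Sum>n<m. ?\<pi> n j)"
    proof (cases "n0 + L \<le> m")
      case True
      then have "?\<pi> n0 i0 * real (m - (n0 + L)) \<le> D * (\<Sum>n<m. ?\<pi> n j)"
        using visits[of "m - (n0 + L)"] by simp
      then show ?thesis using D True by (simp add: of_nat_diff field_simps)
    next
      case False
      then have "?\<pi> n0 i0 / D * real m \<le> ?\<pi> n0 i0 / D * real (n0 + L)"
        using i0(2) D by (intro mult_left_mono) auto
      moreover have "0 \<le> (\<Sum>n<m. ?\<pi> n j)" by (intro sum_nonneg chain_law_nonneg)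
      ultimately show ?thesis by linarith
    qed
  qed
qed

text \<open>No mass enters the transient states from outside, so the law restricted to them evolves by the
  transient block alone.\<close>

lemma chain_law_transient_power:
  assumes Tr: "Tr = UNIV - \<Union>(closed_classes P)"
  shows "(\<Sum>j\<in>Tr. chain_law P \<nu> n j * u $ j) = (\<Sum>j\<in>Tr. \<nu> $ j * (mat_pow (padded_block P Tr) n *v u) $ j)"
proof (induction n arbitrary: u)
  case (Suc n)
  have zero: "P $ i $ j = 0" if "i \<notin> Tr" "j \<in> Tr" for i j
  proof -
    obtain I where "closed_class P I" "i \<in> I" "j \<notin> I"
      using \<open>i \<notin> Tr\<close> \<open>j \<in> Tr\<close> unfolding Tr closed_classes_def by blast
    then show ?thesis unfolding closed_class_def by blast
  qed
  have "(\<Sum>j\<in>Tr. chain_law P \<nu> (Suc n) j * u $ j) = (\<Sum>j\<in>Tr. \<Sum>i\<in>UNIV. chain_law P \<nu> n i * P $ i $ j * u $ j)"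
    by (simp add: sum_distrib_right)
  also have "\<dots> = (\<Sum>j\<in>Tr. \<Sum>i\<in>Tr. chain_law P \<nu> n i * P $ i $ j * u $ j)"
    by (intro sum.cong refl sum.mono_neutral_right) (auto simp: zero)
  also have "\<dots> = (\<Sum>i\<in>Tr. chain_law P \<nu> n i * (\<Sum>j\<in>Tr. P $ i $ j * u $ j))"
    unfolding sum_distrib_left by (subst sum.swap) (simp add: mult.assoc)
  also have "\<dots> = (\<Sum>i\<in>Tr. chain_law P \<nu> n i * (padded_block P Tr *v u) $ i)"
  proof (intro sum.cong refl arg_cong2[where f = "(*)"])
    fix i assume "i \<in> Tr"
    have "(\<Sum>j\<in>Tr. P $ i $ j * u $ j) = (\<Sum>j\<in>UNIV. (if j \<in> Tr then P $ i $ j else 0) * u $ j)"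
      by (intro sum.mono_neutral_cong_left) auto
    then show "(\<Sum>j\<in>Tr. P $ i $ j * u $ j) = (padded_block P Tr *v u) $ i"
      using \<open>i \<in> Tr\<close> by (simp add: padded_block_def matrix_vector_mult_def)
  qed
  also have "\<dots> = (\<Sum>j\<in>Tr. \<nu> $ j * (mat_pow (padded_block P Tr) n *v (padded_block P Tr *v u)) $ j)"
    by (rule Suc)
  also have "\<dots> = (\<Sum>j\<in>Tr. \<nu> $ j * (mat_pow (padded_block P Tr) (Suc n) *v u) $ j)"
    by (simp add: matrix_vector_mul_assoc mat_pow_commute mat_pow_Suc)
  finally show ?case .
qed simp

lemma AE_leaves_transient: "AE \<omega> in M. \<exists>k. X k \<omega> \<in> \<Union>(closed_classes P)"
proof -
  define Tr where "Tr = UNIV - \<Union>(closed_classes P)"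
  have "(\<lambda>n. \<Sum>j\<in>Tr. \<nu> $ j * (mat_pow (padded_block P Tr) n *v 1) $ j) \<longlonglongrightarrow> (\<Sum>j\<in>Tr. \<nu> $ j * 0 $ j)"
    by (intro tendsto_intros tendsto_vec_nth padded_block_powers_tendsto_0)
       (use spectral_radius_transient_block[OF stochastic] in \<open>simp add: Tr_def\<close>)
  then have lim: "(\<lambda>n. \<Sum>j\<in>Tr. chain_law P \<nu> n j) \<longlonglongrightarrow> 0"
    using chain_law_transient_power[OF Tr_def, of _ 1] by simp
  let ?N = "{\<omega> \<in> space M. \<forall>k. X k \<omega> \<in> Tr}"
  have "prob ?N \<le> (\<Sum>j\<in>Tr. chain_law P \<nu> n j)" for n
  proof -
    have "prob ?N \<le> prob (\<Union>j\<in>Tr. {\<omega> \<in> space M. X n \<omega> = j})"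
      by (intro finite_measure_mono) auto
    also have "\<dots> \<le> (\<Sum>j\<in>Tr. prob {\<omega> \<in> space M. X n \<omega> = j})"
      by (intro finite_measure_subadditive_finite) auto
    finally show ?thesis by (simp add: prob_X)
  qed
  then have "prob ?N \<le> 0" by (intro LIMSEQ_le_const[OF lim] exI[of _ 0]) simp
  then have "?N \<in> null_sets M" by (auto simp: null_sets_def emeasure_eq_measure measure_le_0_iff)
  then show ?thesis by (rule AE_I') (auto simp: Tr_def)
qed

end

section \<open>Measurability of the flow\<close>

lemma mat_exp_near_identity:
  fixes A :: "real ^ 'd ^ 'd"
  shows "norm (mat_exp A *v x - x) \<le> (exp (norm A) - 1) * norm x"
proof -
  let ?f = "\<lambda>m. ((1 / fact m) *\<^sub>R mat_pow A m) *v x" and ?g = "\<lambda>m. norm A ^ m / fact m * norm x"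
  have bl: "bounded_linear (\<lambda>M :: real ^ 'd ^ 'd. M *v x)"
    by (rule mat_vec.bounded_linear_left)
  have f: "mat_exp A *v x = (\<Sum>m. ?f m)" "summable ?f"
    unfolding mat_exp_def
    by (rule bounded_linear.suminf[OF bl summable_mat_exp]) (rule bounded_linear.summable[OF bl summable_mat_exp])
  have g: "summable ?g" by (intro summable_mult2 summable_power_over_fact)
  have le: "norm (?f m) \<le> ?g m" for m
    using norm_mat_pow_vec_le[of A m x]
    by (simp add: mat_vec.scaleR_left divide_simps)
  have "mat_exp A *v x - x = (\<Sum>m. ?f (Suc m))"
    using suminf_split_head[OF f(2)] f(1) by simp
  also have "norm \<dots> \<le> (\<Sum>m. ?g (Suc m))"
    by (rule norm_suminf_le[OF le]) (rule summable_Suc_iff[of ?g, THEN iffD2, OF g])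
  also have "\<dots> = (\<Sum>m. ?g m) - norm x" using suminf_split_head[OF g] by simp
  also have "(\<Sum>m. ?g m) = exp (norm A) * norm x"
    unfolding exp_def by (subst suminf_mult2[symmetric]) (auto simp: summable_power_over_fact field_simps)
  finally show ?thesis by (simp add: algebra_simps)
qed

text \<open>Used for a single grid cell: whatever the signal does there, the flow moves by little.\<close>

lemma word_flow_near_identity:
  fixes A :: "'n::finite \<Rightarrow> real ^ 'd ^ 'd"
  assumes "ws \<in> words UNIV"
  shows "norm (word_flow A ws *v x - x) \<le> (exp (total_norm A * duration ws) - 1) * norm x"
  using assms
proof (induction ws arbitrary: x)
  case (Cons p ws)
  obtain i s where p: "p = (i, s)" by fastforce
  have s: "0 \<le> s" and ws: "ws \<in> words UNIV" using Cons p by auto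
  let ?a = "total_norm A" and ?E = "mat_exp (s *\<^sub>R A i)"
  have "norm (A i) \<le> ?a" unfolding total_norm_def by (rule member_le_sum) auto
  then have "norm (s *\<^sub>R A i) \<le> ?a * s" using s by (simp add: mult.commute mult_left_mono)
  then have "(exp (norm (s *\<^sub>R A i)) - 1) * norm x \<le> (exp (?a * s) - 1) * norm x"
    by (intro mult_right_mono) auto
  then have E: "norm (?E *v x - x) \<le> (exp (?a * s) - 1) * norm x"
    by (rule order_trans[OF mat_exp_near_identity])
  have "word_flow A (p # ws) *v x - x = word_flow A ws *v (?E *v x - x) + (word_flow A ws *v x - x)"
    by (simp add: p matrix_vector_mult_diff_distrib matrix_vector_mul_assoc)
  also have "norm \<dots> \<le> norm (word_flow A ws *v (?E *v x - x)) + norm (word_flow A ws *v x - x)"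
    by (rule norm_triangle_ineq)
  also have "\<dots> \<le> exp (?a * duration ws) * ((exp (?a * s) - 1) * norm x) + (exp (?a * duration ws) - 1) * norm x"
    by (intro add_mono order_trans[OF norm_word_flow_le[OF ws]] mult_left_mono E Cons.IH[OF ws]) simp
  also have "\<dots> = (exp (?a * duration (p # ws)) - 1) * norm x"
    by (simp add: p distrib_left exp_add algebra_simps)
  finally show ?case .
qed simp

definition sampled_word :: "(real \<Rightarrow> 'n) \<Rightarrow> real \<Rightarrow> nat \<Rightarrow> ('n \<times> real) list" where
  "sampled_word \<sigma> h n = map (\<lambda>k. (\<sigma> (real k * h), h)) [0..<n]"

lemma sampled_word_Suc: "sampled_word \<sigma> h (Suc n) = sampled_word \<sigma> h n @ [(\<sigma> (real n * h), h)]"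
  by (simp add: sampled_word_def)

text \<open>Sampling the signal on a grid of width \<open>h\<close> is exact on every grid cell without a breakpoint
  inside, and the number of the other cells is bounded.\<close>

lemma sampled_word_tendsto_flow:
  fixes A :: "'n::finite \<Rightarrow> real ^ 'd ^ 'd"
  assumes \<sigma>: "\<sigma> \<in> switching_signals" and t: "0 < t"
  shows "(\<lambda>n. word_flow A (sampled_word \<sigma> (t / real n) n) *v x) \<longlonglongrightarrow> flow A \<sigma> t *v x"
proof -
  obtain b where b: "breakpoints \<sigma> b" using \<sigma> switching_signals_iff by blast
  obtain J where J: "t < b J" using breakpoints_unbounded[OF b] .
  let ?a = "total_norm A"
  have a0: "0 \<le> ?a" by (rule total_norm_nonneg)
  define f where "f s = flow A \<sigma> s *v x" for s
  define D where "D h = 2 * (exp (?a * h) - 1) * (exp (?a * t) * norm x)" for h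
  have main: "norm (word_flow A (sampled_word \<sigma> h n) *v x - f t) \<le> exp (?a * t) * (real J * D h)"
    if n: "0 < n" and h: "h = t / real n" for n h
  proof -
    have h0: "0 < h" using n t h by simp
    have kh: "real k * h \<le> t" if "k \<le> n" for k
    proof -
      have "real k * h \<le> real n * h" using that h0 by (intro mult_right_mono) auto
      then show ?thesis using n h by simp
    qed
    have D0: "0 \<le> D h" unfolding D_def using a0 h0 by (intro mult_nonneg_nonneg) auto
    define u where "u k = word_flow A (sampled_word \<sigma> h k) *v x" for k
    define E where "E k = mat_exp (h *\<^sub>R A (\<sigma> (real k * h)))" for k
    define bad where "bad = {k. k < n \<and> (\<exists>j. real k * h < b j \<and> b j < real (Suc k) * h)}"
    have u_Suc: "u (Suc k) = E k *v u k" for k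
      by (simp add: u_def E_def sampled_word_Suc word_flow_append matrix_vector_mul_assoc)
    have step: "norm (E k *v f (real k * h) - f (real (Suc k) * h)) \<le> (if k \<in> bad then D h else 0)"
      if k: "k < n" for k
    proof (cases "k \<in> bad")
      case True
      obtain ws where ws: "ws \<in> words (\<sigma> ` {real k * h..<real (Suc k) * h})" "duration ws = real (Suc k) * h - real k * h"
        "flow A \<sigma> (real (Suc k) * h) = word_flow A ws ** flow A \<sigma> (real k * h)"
        by (rule flow_word[OF \<sigma>, of "real k * h" "real (Suc k) * h" A]) (use h0 in \<open>auto simp: distrib_right\<close>)
      have ws': "ws \<in> words UNIV" "duration ws = h"
        using words_mono[OF subset_UNIV ws(1)] ws(2) by (auto simp: distrib_right)
      let ?y = "f (real k * h)"
      have y: "norm ?y \<le> exp (?a * t) * norm x"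
      proof -
        obtain vs where vs: "vs \<in> words UNIV" "duration vs = real k * h" "flow A \<sigma> (real k * h) = word_flow A vs"
          by (rule flow_eq_word[OF \<sigma>, of "real k * h" A]) (use h0 in auto)
        have "norm ?y \<le> exp (?a * (real k * h)) * norm x"
          using norm_word_flow_le[OF vs(1), of A x] vs(2,3) by (simp add: f_def)
        also have "\<dots> \<le> exp (?a * t) * norm x"
          using kh[of k] k a0 by (intro mult_right_mono) (auto intro: mult_left_mono)
        finally show ?thesis .
      qed
      have "E k = word_flow A [(\<sigma> (real k * h), h)]" by (simp add: E_def)
      then have "norm (E k *v ?y - ?y) \<le> (exp (?a * h) - 1) * norm ?y"
        using word_flow_near_identity[of "[(\<sigma> (real k * h), h)]" A ?y] h0 by simp
      moreover have "norm (f (real (Suc k) * h) - ?y) \<le> (exp (?a * h) - 1) * norm ?y"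
        using word_flow_near_identity[OF ws'(1), of A ?y] ws'(2) ws(3)
        by (simp add: f_def matrix_vector_mul_assoc)
      moreover have "norm (E k *v ?y - f (real (Suc k) * h))
          \<le> norm (E k *v ?y - ?y) + norm (f (real (Suc k) * h) - ?y)"
        using norm_triangle_ineq4[of "E k *v ?y - ?y" "f (real (Suc k) * h) - ?y"] by simp
      ultimately have "norm (E k *v ?y - f (real (Suc k) * h)) \<le> 2 * (exp (?a * h) - 1) * norm ?y"
        unfolding mult.assoc by linarith
      also have "\<dots> \<le> D h" unfolding D_def using y a0 h0 by (intro mult_left_mono) auto
      finally show ?thesis using True by simp
    next
      case False
      obtain l where l: "b l \<le> real k * h" "real k * h < b (Suc l)"
        using breakpoints_locate[OF b, of "real k * h"] h0 by auto
      have "real (Suc k) * h \<le> b (Suc l)" 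
      proof (rule ccontr)
        assume "\<not> real (Suc k) * h \<le> b (Suc l)"
        then have "b (Suc l) < real (Suc k) * h" by simp
        with l(2) k have "k \<in> bad" unfolding bad_def by blast
        with False show False by simp
      qed
      then have const: "\<sigma> v = \<sigma> (real k * h)" if "real k * h \<le> v" "v < real (Suc k) * h" for v
        using breakpoints_const[OF b, of l v] breakpoints_const[OF b, of l "real k * h"] l that by simp
      have "0 \<le> real k * h" "real k * h \<le> real (Suc k) * h" using h0 by (auto simp: distrib_right)
      from flow_piece[OF \<sigma> this const] have "flow A \<sigma> (real (Suc k) * h)
          = mat_exp ((real (Suc k) * h - real k * h) *\<^sub>R A (\<sigma> (real k * h))) ** flow A \<sigma> (real k * h)" .
      moreover have "real (Suc k) * h - real k * h = h" by (simp add: distrib_right)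
      ultimately have "f (real (Suc k) * h) = E k *v f (real k * h)"
        by (simp add: f_def E_def matrix_vector_mul_assoc)
      then show ?thesis using False by simp
    qed
    have err: "norm (u k - f (real k * h)) \<le> exp (?a * (real k * h)) * (\<Sum>i<k. if i \<in> bad then D h else 0)"
      if "k \<le> n" for k
      using that
    proof (induction k)
      case 0
      then show ?case by (simp add: u_def f_def sampled_word_def flow_0[OF \<sigma>])
    next
      case (Suc k)
      let ?s = "\<Sum>i<k. if i \<in> bad then D h else 0" and ?d = "if k \<in> bad then D h else 0"
      have s0: "0 \<le> ?s" using D0 by (intro sum_nonneg) auto
      have "norm (E k *v (u k - f (real k * h))) \<le> exp (?a * h) * norm (u k - f (real k * h))"
        using norm_exp_scaled_le[of h A "\<sigma> (real k * h)"] h0 by (simp add: E_def)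
      also have "\<dots> \<le> exp (?a * h) * (exp (?a * (real k * h)) * ?s)"
        using Suc by (intro mult_left_mono) auto
      also have "\<dots> = exp (?a * (real (Suc k) * h)) * ?s"
        by (simp add: algebra_simps exp_add)
      finally have 1: "norm (E k *v (u k - f (real k * h))) \<le> exp (?a * (real (Suc k) * h)) * ?s" .
      have "norm (E k *v f (real k * h) - f (real (Suc k) * h)) \<le> 1 * ?d" using step[of k] Suc by simp
      also have "\<dots> \<le> exp (?a * (real (Suc k) * h)) * ?d"
        using D0 a0 h0 by (intro mult_right_mono) (auto simp del: of_nat_Suc)
      finally have 2: "norm (E k *v f (real k * h) - f (real (Suc k) * h)) \<le> exp (?a * (real (Suc k) * h)) * ?d" .
      have "u (Suc k) - f (real (Suc k) * h)
          = E k *v (u k - f (real k * h)) + (E k *v f (real k * h) - f (real (Suc k) * h))"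
        by (simp only: u_Suc matrix_vector_mult_diff_distrib) simp
      then have "norm (u (Suc k) - f (real (Suc k) * h))
          \<le> norm (E k *v (u k - f (real k * h))) + norm (E k *v f (real k * h) - f (real (Suc k) * h))"
        by (metis norm_triangle_ineq)
      also have "\<dots> \<le> exp (?a * (real (Suc k) * h)) * (?s + ?d)"
        using 1 2 by (simp only: distrib_left)
      finally show ?case by simp
    qed
    \<comment> \<open>different bad cells contain different breakpoints, all of them before \<open>t\<close>\<close>
    have "card bad \<le> J"
    proof -
      have "\<forall>k\<in>bad. \<exists>j. real k * h < b j \<and> b j < real (Suc k) * h" by (simp add: bad_def)
      then obtain j where j: "\<And>k. k \<in> bad \<Longrightarrow> real k * h < b (j k) \<and> b (j k) < real (Suc k) * h" by metis
      have "inj_on j bad"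
      proof (rule inj_onI)
        fix k k' assume k: "k \<in> bad" "k' \<in> bad" "j k = j k'"
        have "real k * h < real (Suc k') * h" "real k' * h < real (Suc k) * h"
          using j[OF k(1)] j[OF k(2)] k(3) by auto
        then have "real k < real (Suc k')" "real k' < real (Suc k)"
          using h0 by (simp_all only: mult_less_cancel_right_pos)
        then show "k = k'" by linarith
      qed
      moreover have "j ` bad \<subseteq> {..<J}"
      proof
        fix m assume "m \<in> j ` bad"
        then obtain k where k: "k \<in> bad" "m = j k" by blast
        then have "k < n" by (simp add: bad_def)
        then have "b m < t" using j[OF k(1)] kh[of "Suc k"] k(2) by simp
        then have "b m < b J" using J by simp
        then show "m \<in> {..<J}" using breakpoints_strict_mono[OF b] by (simp add: strict_mono_less)
      qed
      ultimately have "card bad \<le> card {..<J}" by (intro card_inj_on_le) auto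
      then show ?thesis by simp
    qed
    have "real n * h = t" using n h by simp
    then have "norm (u n - f t) \<le> exp (?a * t) * (\<Sum>i<n. if i \<in> bad then D h else 0)"
      using err[of n] by simp
    also have "(\<Sum>i<n. if i \<in> bad then D h else 0) = (\<Sum>i\<in>bad. D h)"
      by (rule sum.mono_neutral_cong_right) (auto simp: bad_def)
    also have "exp (?a * t) * (\<Sum>i\<in>bad. D h) \<le> exp (?a * t) * (real J * D h)"
      using \<open>card bad \<le> J\<close> D0 by (intro mult_left_mono) (auto intro: mult_right_mono)
    finally show ?thesis by (simp add: u_def)
  qed
  have "(\<lambda>n. exp (?a * t) * (real J * D (t / real n))) \<longlonglongrightarrow> exp (?a * t) * (real J * (2 * (exp (?a * 0) - 1) * (exp (?a * t) * norm x)))"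
    unfolding D_def by (intro tendsto_intros lim_const_over_n)
  then have lim: "(\<lambda>n. exp (?a * t) * (real J * D (t / real n))) \<longlonglongrightarrow> 0" by simp
  have "\<forall>\<^sub>F n in sequentially. norm (word_flow A (sampled_word \<sigma> (t / real n) n) *v x - f t)
      \<le> exp (?a * t) * (real J * D (t / real n))"
    using eventually_gt_at_top[of 0] by eventually_elim (rule main, simp_all)
  then have "(\<lambda>n. word_flow A (sampled_word \<sigma> (t / real n) n) *v x - f t) \<longlonglongrightarrow> 0"
    by (rule Lim_null_comparison[OF _ lim])
  then show ?thesis unfolding f_def by (rule LIM_zero_cancel)
qed

context markov_realisation
begin

lemma word_flow_sampled_measurable:
  assumes "0 \<le> h"
  shows "(\<lambda>\<omega>. word_flow A (sampled_word (\<sigma> \<omega>) h n) :: real ^ 'd ^ 'd) \<in> borel_measurable M"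
proof (induction n)
  case (Suc n)
  have "(\<lambda>\<omega>. mat_exp (h *\<^sub>R A (\<sigma> \<omega> (real n * h))) :: real ^ 'd ^ 'd) \<in> borel_measurable M"
    using assms by (intro measurable_compose[OF \<sigma>_measurable]) auto
  then have "(\<lambda>\<omega>. mat_exp (h *\<^sub>R A (\<sigma> \<omega> (real n * h))) ** word_flow A (sampled_word (\<sigma> \<omega>) h n))
      \<in> borel_measurable M"
    using Suc
    by (rule borel_measurable_continuous_Pair)
       (intro mat_mult.continuous_on continuous_intros)
  then show ?case by (simp add: sampled_word_Suc word_flow_append)
qed (simp add: sampled_word_def)

text \<open>The flow depends on the whole path, but it is a limit of functions of finitely many values.\<close>

lemma flow_measurable:
  fixes A :: "'n \<Rightarrow> real ^ 'd ^ 'd"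
  assumes t: "0 < t"
  shows "(\<lambda>\<omega>. flow A (\<sigma> \<omega>) t) \<in> borel_measurable M"
proof (rule borel_measurable_LIMSEQ_metric)
  show "(\<lambda>\<omega>. word_flow A (sampled_word (\<sigma> \<omega>) (t / real n) n)) \<in> borel_measurable M" for n
    using t by (intro word_flow_sampled_measurable) simp
  fix \<omega> assume "\<omega> \<in> space M"
  then have \<sigma>: "\<sigma> \<omega> \<in> switching_signals" by (rule paths)
  show "(\<lambda>n. word_flow A (sampled_word (\<sigma> \<omega>) (t / real n) n)) \<longlonglongrightarrow> flow A (\<sigma> \<omega>) t"
  proof (rule vec_tendstoI, rule vec_tendstoI)
    fix i j
    have "(\<lambda>n. (word_flow A (sampled_word (\<sigma> \<omega>) (t / real n) n) *v axis j 1) $ i)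
        \<longlonglongrightarrow> (flow A (\<sigma> \<omega>) t *v axis j 1) $ i"
      by (intro tendsto_vec_nth sampled_word_tendsto_flow \<sigma> t)
    then show "(\<lambda>n. word_flow A (sampled_word (\<sigma> \<omega>) (t / real n) n) $ i $ j) \<longlonglongrightarrow> flow A (\<sigma> \<omega>) t $ i $ j"
      by (simp add: matrix_vector_mult_basis column_def)
  qed
qed

lemma integrable_ln_op_norm_flow:
  fixes A :: "'n \<Rightarrow> real ^ 'd ^ 'd"
  assumes n: "is_norm nrm" and t: "0 < t"
  shows "integrable M (\<lambda>\<omega>. ln (op_norm nrm (flow A (\<sigma> \<omega>) t)))"
proof -
  obtain C where C: "\<And>M N :: real ^ 'd ^ 'd. \<bar>op_norm nrm M - op_norm nrm N\<bar> \<le> C * norm (M - N)"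
    using is_norm_lipschitz[OF is_norm_op_norm[OF n]] by blast
  have "continuous_on UNIV (op_norm nrm :: real ^ 'd ^ 'd \<Rightarrow> real)"
  proof (rule continuous_at_imp_continuous_on, rule ballI)
    fix N :: "real ^ 'd ^ 'd"
    have "((\<lambda>M. C * norm (M - N)) \<longlongrightarrow> C * norm (N - N)) (at N)" by (intro tendsto_intros)
    then have lim: "((\<lambda>M. C * norm (M - N)) \<longlongrightarrow> 0) (at N)" by simp
    have "((\<lambda>M. op_norm nrm M - op_norm nrm N) \<longlongrightarrow> 0) (at N)"
      by (rule Lim_null_comparison[OF _ lim]) (simp add: C)
    then show "isCont (op_norm nrm) N" unfolding isCont_def by (rule LIM_zero_cancel)
  qed
  then have meas: "(\<lambda>\<omega>. op_norm nrm (flow A (\<sigma> \<omega>) t)) \<in> borel_measurable M"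
    by (rule borel_measurable_continuous_on[OF _ flow_measurable[OF t]])
  obtain c where c: "\<And>ws. ws \<in> words UNIV \<Longrightarrow> \<bar>ln (op_norm nrm (word_flow A ws))\<bar> \<le> total_norm A * duration ws + c"
    by (rule op_norm_word_bounds[OF n, of A]) blast
  show ?thesis
  proof (rule integrable_const_bound)
    show "AE \<omega> in M. norm (ln (op_norm nrm (flow A (\<sigma> \<omega>) t))) \<le> total_norm A * t + c"
    proof (rule AE_I2)
      fix \<omega> assume "\<omega> \<in> space M"
      then have \<sigma>: "\<sigma> \<omega> \<in> switching_signals" by (rule paths)
      obtain ws where "ws \<in> words UNIV" "duration ws = t" "flow A (\<sigma> \<omega>) t = word_flow A ws"
        by (rule flow_eq_word[OF \<sigma> less_imp_le[OF t]])
      then show "norm (ln (op_norm nrm (flow A (\<sigma> \<omega>) t))) \<le> total_norm A * t + c" using c[of ws] by simp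
    qed
  qed (use meas in measurable)
qed

end

section \<open>Absorption in the accessible classes\<close>

lemma switching_signal_right_constant:
  assumes "\<sigma> \<in> switching_signals" "0 \<le> t"
  shows "\<exists>\<epsilon>>0. \<forall>u\<in>{t..<t + \<epsilon>}. \<sigma> u = \<sigma> t"
proof -
  obtain b where b: "breakpoints \<sigma> b" using assms switching_signals_iff by blast
  obtain k where k: "b k \<le> t" "t < b (Suc k)" by (rule breakpoints_locate[OF b assms(2)])
  show ?thesis
  proof (intro exI[of _ "b (Suc k) - t"] conjI ballI)
    show "0 < b (Suc k) - t" using k(2) by simp
    fix u assume u: "u \<in> {t..<t + (b (Suc k) - t)}"
    have "\<sigma> u = \<sigma> (b k)" by (rule breakpoints_const[OF b]) (use u k in auto)
    also have "\<dots> = \<sigma> t" by (rule breakpoints_const[OF b k, symmetric])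
    finally show "\<sigma> u = \<sigma> t" .
  qed
qed

lemma exit_time_attained:
  assumes \<sigma>: "\<sigma> \<in> switching_signals" and ex: "\<exists>t\<ge>0. \<sigma> t \<notin> Tr"
  shows "0 \<le> exit_time Tr \<sigma>" "\<sigma> (exit_time Tr \<sigma>) \<notin> Tr" "\<And>t. 0 \<le> t \<Longrightarrow> \<sigma> t \<notin> Tr \<Longrightarrow> exit_time Tr \<sigma> \<le> t"
proof -
  define E where "E = {t. 0 \<le> t \<and> \<sigma> t \<notin> Tr}"
  have ne: "E \<noteq> {}" using ex by (auto simp: E_def)
  have bdd: "bdd_below E" by (intro bdd_belowI[of _ 0]) (auto simp: E_def)
  have \<tau>: "exit_time Tr \<sigma> = Inf E" by (simp add: exit_time_def E_def)
  show least: "exit_time Tr \<sigma> \<le> t" if "0 \<le> t" "\<sigma> t \<notin> Tr" for t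
    unfolding \<tau> using that bdd by (intro cInf_lower) (auto simp: E_def)
  show nn: "0 \<le> exit_time Tr \<sigma>" unfolding \<tau> using ne by (intro cInf_greatest) (auto simp: E_def)
  show "\<sigma> (exit_time Tr \<sigma>) \<notin> Tr"
  proof
    assume Tr: "\<sigma> (exit_time Tr \<sigma>) \<in> Tr"
    obtain \<epsilon> where \<epsilon>: "0 < \<epsilon>" "\<And>u. exit_time Tr \<sigma> \<le> u \<Longrightarrow> u < exit_time Tr \<sigma> + \<epsilon> \<Longrightarrow> \<sigma> u = \<sigma> (exit_time Tr \<sigma>)"
      using switching_signal_right_constant[OF \<sigma> nn] by (metis atLeastLessThan_iff)
    have "exit_time Tr \<sigma> + \<epsilon> \<le> t" if "t \<in> E" for t
    proof (rule ccontr)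
      assume "\<not> exit_time Tr \<sigma> + \<epsilon> \<le> t"
      moreover have t: "0 \<le> t" "\<sigma> t \<notin> Tr" using that by (auto simp: E_def)
      ultimately have "\<sigma> t = \<sigma> (exit_time Tr \<sigma>)" using least[OF t] by (intro \<epsilon>(2)) auto
      then show False using t Tr by simp
    qed
    then have "exit_time Tr \<sigma> + \<epsilon> \<le> Inf E" using ne by (intro cInf_greatest)
    then show False using \<epsilon>(1) \<tau> by simp
  qed
qed

text \<open>The right-hand side involves countably many times, which makes the exit event measurable: a path
  that leaves \<open>Tr\<close> into \<open>I\<close> stays in \<open>I\<close> up to some rational time.\<close>

lemma exit_event_rational:
  assumes \<sigma>: "\<sigma> \<in> switching_signals" and disj: "I \<inter> Tr = {}"
  shows "(\<exists>t\<ge>0. \<sigma> t \<notin> Tr) \<and> \<sigma> (exit_time Tr \<sigma>) \<in> I \<longleftrightarrow>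
    (\<exists>q :: rat. 0 \<le> q \<and> \<sigma> (of_rat q) \<in> I \<and> (\<forall>s :: rat. 0 \<le> s \<and> s < q \<longrightarrow> \<sigma> (of_rat s) \<in> Tr \<union> I))"
    (is "?L \<longleftrightarrow> ?R")
proof
  assume L: ?L
  define \<tau> where "\<tau> = exit_time Tr \<sigma>"
  have ex: "\<exists>t\<ge>0. \<sigma> t \<notin> Tr" and \<tau>I: "\<sigma> \<tau> \<in> I" using L by (auto simp: \<tau>_def)
  note att = exit_time_attained[OF \<sigma> ex, folded \<tau>_def]
  obtain \<epsilon> where \<epsilon>: "0 < \<epsilon>" "\<And>u. \<tau> \<le> u \<Longrightarrow> u < \<tau> + \<epsilon> \<Longrightarrow> \<sigma> u = \<sigma> \<tau>"
    using switching_signal_right_constant[OF \<sigma> att(1)] by (metis atLeastLessThan_iff)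
  obtain q where q: "\<tau> < of_rat q" "of_rat q < \<tau> + \<epsilon>" using of_rat_dense[of \<tau> "\<tau> + \<epsilon>"] \<epsilon>(1) by auto
  have "0 \<le> q" using q(1) att(1) by (metis less_le_trans order_le_less zero_le_of_rat_iff order_trans)
  moreover have "\<sigma> (of_rat q) \<in> I" using \<epsilon>(2)[of "of_rat q"] q \<tau>I by simp
  moreover have "\<sigma> (of_rat s) \<in> Tr \<union> I" if s: "0 \<le> s" "s < q" for s :: rat
  proof (cases "\<tau> \<le> of_rat s")
    case True
    have "(of_rat s :: real) < of_rat q" using s(2) by (simp add: of_rat_less)
    then show ?thesis using \<epsilon>(2)[OF True] q(2) \<tau>I by simp
  next
    case False
    then show ?thesis using att(3)[of "of_rat s"] s(1) by (auto simp: zero_le_of_rat_iff)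
  qed
  ultimately show ?R by blast
next
  assume ?R
  then obtain q :: rat where q: "0 \<le> q" "\<sigma> (of_rat q) \<in> I"
    "\<And>s :: rat. 0 \<le> s \<Longrightarrow> s < q \<Longrightarrow> \<sigma> (of_rat s) \<in> Tr \<union> I" by blast
  have q0: "(0::real) \<le> of_rat q" using q(1) by (simp add: zero_le_of_rat_iff)
  have qTr: "\<sigma> (of_rat q) \<notin> Tr" using q(2) disj by blast
  have ex: "\<exists>t\<ge>0. \<sigma> t \<notin> Tr" using q0 qTr by blast
  define \<tau> where "\<tau> = exit_time Tr \<sigma>"
  note att = exit_time_attained[OF \<sigma> ex, folded \<tau>_def]
  have before: "\<sigma> s \<in> Tr \<union> I" if s: "0 \<le> s" "s < of_rat q" for s :: real
  proof -
    obtain \<epsilon> where \<epsilon>: "0 < \<epsilon>" "\<And>u. s \<le> u \<Longrightarrow> u < s + \<epsilon> \<Longrightarrow> \<sigma> u = \<sigma> s"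
      using switching_signal_right_constant[OF \<sigma> s(1)] by (metis atLeastLessThan_iff)
    obtain r where r: "s < of_rat r" "of_rat r < min (s + \<epsilon>) (of_rat q)"
      using of_rat_dense[of s "min (s + \<epsilon>) (of_rat q)"] \<epsilon>(1) s(2) by auto
    have "(0::real) < of_rat r" using r(1) s(1) by linarith
    then have "0 \<le> r" by (simp add: zero_less_of_rat_iff)
    moreover have "r < q" using r(2) by (simp add: of_rat_less)
    ultimately have "\<sigma> (of_rat r) \<in> Tr \<union> I" by (rule q(3))
    then show ?thesis using \<epsilon>(2)[of "of_rat r"] r by simp
  qed
  have "\<tau> \<le> of_rat q" using att(3)[OF q0 qTr] .
  then have "\<sigma> \<tau> \<in> I" using before[of \<tau>] att(1,2) q(2) by (cases "\<tau> = of_rat q") auto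
  then show ?L using ex by (simp add: \<tau>_def)
qed

context markov_realisation
begin

abbreviation transient :: "'n set" where
  "transient \<equiv> UNIV - \<Union>(closed_classes P)"

definition exit_event :: "'n set \<Rightarrow> 'w set" where
  "exit_event I = {\<omega> \<in> space M. (\<exists>t\<ge>0. \<sigma> \<omega> t \<notin> transient) \<and> \<sigma> \<omega> (exit_time transient (\<sigma> \<omega>)) \<in> I}"

lemma accessible_iff: "accessible M \<sigma> transient I \<longleftrightarrow> 0 < prob (exit_event I)"
  by (simp add: accessible_def exit_event_def)

lemma exit_event_measurable:
  assumes "I \<in> closed_classes P"
  shows "exit_event I \<in> events"
proof -
  have "exit_event I = {\<omega> \<in> space M. \<exists>q :: rat. 0 \<le> q \<and> \<sigma> \<omega> (of_rat q) \<in> I \<and>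
      (\<forall>s :: rat. 0 \<le> s \<and> s < q \<longrightarrow> \<sigma> \<omega> (of_rat s) \<in> transient \<union> I)}"
    unfolding exit_event_def
  proof (intro Collect_cong conj_cong refl)
    fix \<omega> assume "\<omega> \<in> space M"
    then show "((\<exists>t\<ge>0. \<sigma> \<omega> t \<notin> transient) \<and> \<sigma> \<omega> (exit_time transient (\<sigma> \<omega>)) \<in> I) =
        (\<exists>q :: rat. 0 \<le> q \<and> \<sigma> \<omega> (of_rat q) \<in> I \<and>
          (\<forall>s :: rat. 0 \<le> s \<and> s < q \<longrightarrow> \<sigma> \<omega> (of_rat s) \<in> transient \<union> I))"
      by (intro exit_event_rational paths) (use assms in blast)+
  qed
  also have "\<dots> \<in> events"
  proof -
    define Q where "Q q J \<omega> \<longleftrightarrow> (0 \<le> q \<longrightarrow> \<sigma> \<omega> (of_rat q) \<in> J)" for q :: rat and J \<omega>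
    have m [measurable]: "Measurable.pred M (Q q J)" for q :: rat and J
    proof (cases "0 \<le> q")
      case True
      then have [measurable]: "(\<lambda>\<omega>. \<sigma> \<omega> (of_rat q)) \<in> measurable M (count_space UNIV)"
        by (intro \<sigma>_measurable) (simp add: zero_le_of_rat_iff)
      have "Measurable.pred M (\<lambda>\<omega>. \<sigma> \<omega> (of_rat q) \<in> J)" by measurable
      then show ?thesis using True by (simp add: Q_def[abs_def])
    qed (simp add: Q_def[abs_def])
    have "{\<omega> \<in> space M. \<exists>q :: rat. 0 \<le> q \<and> Q q I \<omega> \<and> (\<forall>s :: rat. s < q \<longrightarrow> Q s (transient \<union> I) \<omega>)} \<in> events"
      by measurable
    also have "{\<omega> \<in> space M. \<exists>q :: rat. 0 \<le> q \<and> Q q I \<omega> \<and> (\<forall>s :: rat. s < q \<longrightarrow> Q s (transient \<union> I) \<omega>)}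
      = {\<omega> \<in> space M. \<exists>q :: rat. 0 \<le> q \<and> \<sigma> \<omega> (of_rat q) \<in> I \<and>
      (\<forall>s :: rat. 0 \<le> s \<and> s < q \<longrightarrow> \<sigma> \<omega> (of_rat s) \<in> transient \<union> I)}"
      unfolding Q_def by (intro Collect_cong) blast
    finally show ?thesis .
  qed
  finally show ?thesis .
qed

lemma AE_not_exit_event:
  assumes I: "I \<in> closed_classes P" and "\<not> accessible M \<sigma> transient I"
  shows "AE \<omega> in M. \<omega> \<notin> exit_event I"
proof -
  have "prob (exit_event I) = 0" using assms(2) measure_nonneg[of M "exit_event I"]
    by (simp add: accessible_iff)
  then have "exit_event I \<in> null_sets M"
    using exit_event_measurable[OF I] by (simp add: null_sets_def emeasure_eq_measure)
  then show ?thesis by (rule AE_not_in)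
qed

lemma closed_class_absorbing:
  assumes \<omega>: "regular \<omega>" and I: "closed_class P I" and X: "X k \<omega> \<in> I" and "k \<le> n"
  shows "X n \<omega> \<in> I"
  using \<open>k \<le> n\<close>
proof (induction rule: dec_induct)
  case (step n)
  then show ?case using regular_edge[OF \<omega>, of n] I unfolding closed_class_def by blast
qed (rule X)

lemma signal_absorbed:
  assumes \<omega>: "regular \<omega>" and I: "closed_class P I" and X: "X k \<omega> \<in> I" and t: "T k \<omega> \<le> t"
  shows "\<sigma> \<omega> t \<in> I"
proof -
  obtain n where n: "T n \<omega> \<le> t" "t < T (Suc n) \<omega>" "\<sigma> \<omega> t = X n \<omega>"
    by (rule regular_locate[OF \<omega> order_trans[OF regular_T_nonneg[OF \<omega>] t]])
  have "k \<le> n" using regular_T_mono[OF \<omega>, of "Suc n" k] t n(2) by (meson not_less_eq_eq not_le order_trans)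
  then show ?thesis using closed_class_absorbing[OF \<omega> I X] n(3) by simp
qed

lemma signal_stays:
  assumes \<omega>: "regular \<omega>" and I: "closed_class P I" and s: "0 \<le> s" "\<sigma> \<omega> s \<in> I" and t: "s \<le> t"
  shows "\<sigma> \<omega> t \<in> I"
proof -
  obtain n where n: "T n \<omega> \<le> s" "\<sigma> \<omega> s = X n \<omega>" by (rule regular_locate[OF \<omega> s(1)])
  show ?thesis by (rule signal_absorbed[OF \<omega> I, of n]) (use n s t in auto)
qed

text \<open>Holding times are positive, so the exit time is the jump time of the first recurrent state.\<close>

lemma first_exit:
  assumes \<omega>: "regular \<omega>" "\<omega> \<in> space M" and I: "I \<in> closed_classes P" and X: "X k \<omega> \<in> I"
    and before: "\<And>j. j < k \<Longrightarrow> X j \<omega> \<in> transient"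
  shows "\<omega> \<in> exit_event I"
proof -
  have Tk: "0 \<le> T k \<omega>" by (rule regular_T_nonneg[OF \<omega>(1)])
  have \<sigma>Tk: "\<sigma> \<omega> (T k \<omega>) = X k \<omega>"
    using regular_\<sigma>[OF \<omega>(1), of k "T k \<omega>"] regular_S_pos[OF \<omega>(1), of k] by simp
  then have out: "\<sigma> \<omega> (T k \<omega>) \<notin> transient" using X I by auto
  then have ex: "\<exists>t\<ge>0. \<sigma> \<omega> t \<notin> transient" using Tk by blast
  note att = exit_time_attained[OF paths[OF \<omega>(2)] ex]
  have "\<sigma> \<omega> t \<in> transient" if t: "0 \<le> t" "t < T k \<omega>" for t
  proof -
    obtain n where n: "T n \<omega> \<le> t" "\<sigma> \<omega> t = X n \<omega>" by (rule regular_locate[OF \<omega>(1) t(1)])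
    then have "n < k" using regular_T_mono[OF \<omega>(1), of k n] t by (meson not_le order_trans)
    then show ?thesis using before n by simp
  qed
  then have "\<not> exit_time transient (\<sigma> \<omega>) < T k \<omega>" using att(1,2) by blast
  moreover have "exit_time transient (\<sigma> \<omega>) \<le> T k \<omega>" by (rule att(3)[OF Tk out])
  ultimately have "exit_time transient (\<sigma> \<omega>) = T k \<omega>" by simp
  then show ?thesis using \<omega>(2) ex X \<sigma>Tk by (simp add: exit_event_def)
qed

definition accessible_states :: "'n set" where
  "accessible_states = \<Union>{I \<in> closed_classes P. accessible M \<sigma> transient I}"

text \<open>There are finitely many classes, hence the inaccessible ones may be discarded simultaneously.\<close>

lemma AE_absorbed: "AE \<omega> in M. \<exists>t0\<ge>0. \<forall>t\<ge>t0. \<sigma> \<omega> t \<in> accessible_states"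
proof -
  have "AE \<omega> in M. \<forall>I\<in>{I \<in> closed_classes P. \<not> accessible M \<sigma> transient I}. \<omega> \<notin> exit_event I"
    by (intro AE_finite_allI) (auto intro: AE_not_exit_event)
  then show ?thesis using AE_regular AE_leaves_transient AE_space
  proof eventually_elim
    case (elim \<omega>)
    define k where "k = (LEAST k. X k \<omega> \<in> \<Union>(closed_classes P))"
    have "X k \<omega> \<in> \<Union>(closed_classes P)" unfolding k_def using elim(3) by (rule LeastI_ex)
    then obtain I where I: "I \<in> closed_classes P" "X k \<omega> \<in> I" by blast
    have "X j \<omega> \<in> transient" if "j < k" for j using not_less_Least[of j] that by (auto simp: k_def)
    then have "\<omega> \<in> exit_event I" by (rule first_exit[OF elim(2,4) I])
    then have "accessible M \<sigma> transient I" using elim(1) I(1) by blast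
    then have "I \<subseteq> accessible_states" using I(1) by (auto simp: accessible_states_def)
    moreover have "\<sigma> \<omega> t \<in> I" if "T k \<omega> \<le> t" for t
      using signal_absorbed[OF elim(2) _ I(2) that] I(1) by (simp add: closed_classes_def)
    ultimately show ?case using regular_T_nonneg[OF elim(2), of k] by blast
  qed
qed

lemma prob_accessible_states_tendsto:
  "(\<lambda>n. prob {\<omega> \<in> space M. \<sigma> \<omega> (real n) \<in> accessible_states}) \<longlonglongrightarrow> 1"
proof -
  let ?F = "\<lambda>n. {\<omega> \<in> space M. \<sigma> \<omega> (real n) \<in> accessible_states}"
  have meas [measurable]: "?F n \<in> events" for n
  proof -
    have [measurable]: "(\<lambda>\<omega>. \<sigma> \<omega> (real n)) \<in> measurable M (count_space UNIV)" by (rule \<sigma>_measurable) simp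
    show ?thesis by measurable
  qed
  have "(\<lambda>n. \<integral>\<omega>. indicator (?F n) \<omega> \<partial>M) \<longlonglongrightarrow> (\<integral>\<omega>. (1::real) \<partial>M)"
  proof (rule integral_dominated_convergence[where w = "\<lambda>_. 1"])
    show "AE \<omega> in M. (\<lambda>n. indicator (?F n) \<omega>) \<longlonglongrightarrow> (1::real)"
      using AE_absorbed AE_space
    proof eventually_elim
      case (elim \<omega>)
      then obtain t0 where t0: "\<And>t. t0 \<le> t \<Longrightarrow> \<sigma> \<omega> t \<in> accessible_states" by blast
      obtain N where N: "t0 \<le> real N" using real_arch_simple by blast
      have "\<forall>\<^sub>F n in sequentially. indicator (?F n) \<omega> = (1::real)"
        using eventually_ge_at_top[of N]
      proof eventually_elim
        case (elim n)
        then have "t0 \<le> real n" using N by linarith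
        then have "\<sigma> \<omega> (real n) \<in> accessible_states" by (rule t0)
        then show ?case using \<open>\<omega> \<in> space M\<close> by simp
      qed
      then show ?case by (rule tendsto_eventually)
    qed
  qed (auto simp: indicator_def)
  then show ?thesis by (simp add: prob_space)
qed

section \<open>Comparison of the two exponents\<close>

lemma lyap_prob_le_lyap_det:
  fixes A :: "'n \<Rightarrow> real ^ 'd ^ 'd"
  assumes n: "is_norm nrm"
  shows "lyap_prob nrm M \<sigma> A \<le> lyap_det nrm A"
  unfolding lyap_prob_def lyap_det_def
proof (rule Limsup_mono)
  obtain c where c: "\<And>ws. ws \<in> words UNIV \<Longrightarrow> \<bar>ln (op_norm nrm (word_flow A ws))\<bar> \<le> total_norm A * duration ws + c"
    by (rule op_norm_word_bounds[OF n, of A]) blast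
  show "\<forall>\<^sub>F t in at_top. ereal (1 / t * (\<integral>\<omega>. ln (op_norm nrm (flow A (\<sigma> \<omega>) t)) \<partial>M))
      \<le> ereal (1 / t) * (SUP \<sigma>\<in>switching_signals. ereal (ln (op_norm nrm (flow A \<sigma> t))))"
    using eventually_gt_at_top[of 0]
  proof eventually_elim
    case (elim t)
    let ?L = "\<lambda>\<sigma>. ln (op_norm nrm (flow A \<sigma> t))"
    define s where "s = (SUP \<sigma>\<in>switching_signals. ereal (?L \<sigma>))"
    have up: "ereal (?L \<sigma>) \<le> s" if "\<sigma> \<in> switching_signals" for \<sigma>
      unfolding s_def by (rule SUP_upper[OF that])
    have "s \<le> ereal (total_norm A * t + c)"
      unfolding s_def
    proof (rule SUP_least)
      fix \<sigma> :: "real \<Rightarrow> 'n" assume \<sigma>: "\<sigma> \<in> switching_signals"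
      obtain ws where "ws \<in> words UNIV" "duration ws = t" "flow A \<sigma> t = word_flow A ws"
        by (rule flow_eq_word[OF \<sigma> less_imp_le[OF elim]])
      then show "ereal (?L \<sigma>) \<le> ereal (total_norm A * t + c)" using c[of ws] by simp
    qed
    moreover have "s \<noteq> - \<infinity>"
      using up[OF const_switching_signal[of undefined]] by auto
    ultimately obtain v where v: "s = ereal v" by (cases s) auto
    have "(\<integral>\<omega>. ?L (\<sigma> \<omega>) \<partial>M) \<le> v"
    proof (rule integral_le_const[OF integrable_ln_op_norm_flow[OF n elim]])
      show "AE \<omega> in M. ?L (\<sigma> \<omega>) \<le> v"
      proof (rule AE_I2)
        fix \<omega> assume "\<omega> \<in> space M"
        then show "?L (\<sigma> \<omega>) \<le> v" using up[OF paths] v by simp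
      qed
    qed
    then show ?case unfolding s_def[symmetric] v using elim by (simp add: divide_right_mono)
  qed
qed

text \<open>Once the signal has entered a class on which every product has the maximal spectral radius,
  the norm of the flow cannot fall behind by more than was lost before.\<close>

lemma flow_lower_bound:
  fixes A :: "'n \<Rightarrow> real ^ 'd ^ 'd"
  assumes \<kappa>: "\<And>M x. norm (M *v x) \<le> \<kappa> * op_norm nrm M * norm x"
    and \<sigma>: "\<sigma>' \<in> switching_signals" and s: "0 \<le> s" and t: "s < t" and I: "\<And>u. s \<le> u \<Longrightarrow> \<sigma>' u \<in> I"
    and radius: "\<And>ws. ws \<in> words I \<Longrightarrow> ws \<noteq> [] \<Longrightarrow> spectral_radius (word_flow A ws) = exp (\<theta> * duration ws)"
  shows "exp (\<theta> * (t - s)) \<le> \<kappa> * op_norm nrm (flow A \<sigma>' t) * exp (total_norm A * s)"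
proof -
  obtain ws where ws: "ws \<in> words (\<sigma>' ` {s..<t})" "duration ws = t - s" "flow A \<sigma>' t = word_flow A ws ** flow A \<sigma>' s"
    by (rule flow_word[OF \<sigma> s less_imp_le[OF t]])
  obtain vs where vs: "vs \<in> words UNIV" "duration vs = s" "flow A \<sigma>' s = word_flow A vs"
    by (rule flow_eq_word[OF \<sigma> s])
  have wsI: "ws \<in> words I" by (rule words_mono[OF _ ws(1)]) (use I in auto)
  have "ws \<noteq> []" using ws(2) t by auto
  then have \<rho>: "spectral_radius (word_flow A ws) = exp (\<theta> * (t - s))" using radius[OF wsI] ws(2) by simp
  let ?op = "op_norm nrm (flow A \<sigma>' t)"
  have "norm (word_flow A ws *v x) \<le> (\<kappa> * ?op * exp (total_norm A * s)) * norm x" for x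
  proof -
    have "inj ((*v) (word_flow A vs))"
    proof (subst linear_injective_0[OF matrix_vector_mul_linear], intro allI impI)
      fix x assume "word_flow A vs *v x = 0"
      then have "exp (- (total_norm A * duration vs)) * norm x \<le> 0"
        using norm_word_flow_ge[OF vs(1), of A x] by simp
      then show "x = 0" by (simp add: mult_le_0_iff)
    qed
    then have "surj ((*v) (word_flow A vs))" by (intro linear_injective_imp_surjective[OF matrix_vector_mul_linear _ refl])
    then obtain y where y: "x = word_flow A vs *v y" by (metis surjD)
    have "exp (- (total_norm A * s)) * norm y \<le> norm x"
      using norm_word_flow_ge[OF vs(1), of A y] vs(2) y by simp
    then have ny: "norm y \<le> exp (total_norm A * s) * norm x" by (simp add: exp_minus field_simps)
    have nonneg: "0 \<le> \<kappa> * ?op"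
    proof -
      have "0 \<le> \<kappa> * ?op * norm (axis undefined 1 :: real ^ 'd)" by (rule order_trans[OF norm_ge_zero \<kappa>])
      then show ?thesis by (simp add: norm_axis_1)
    qed
    have "norm (word_flow A ws *v x) = norm (flow A \<sigma>' t *v y)"
      using ws(3) vs(3) y by (simp add: matrix_vector_mul_assoc)
    also have "\<dots> \<le> \<kappa> * ?op * norm y" by (rule \<kappa>)
    also have "\<dots> \<le> \<kappa> * ?op * (exp (total_norm A * s) * norm x)" by (rule mult_left_mono[OF ny nonneg])
    finally show ?thesis by (simp add: mult_ac)
  qed
  moreover obtain z where "z \<in> mat_spectrum (word_flow A ws)" "cmod z = spectral_radius (word_flow A ws)"
    by (rule spectral_radius_attained)
  ultimately show ?thesis using eigenvalue_le_bound \<rho> by metis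
qed

text \<open>The path is split at a fixed time \<open>m\<close> rather than at the absorption time. Paths not yet absorbed at
  time \<open>m\<close> cost at most a multiple of \<open>t\<close> times their probability, which is small for large \<open>m\<close>.\<close>

lemma lyap_prob_ge:
  fixes A :: "'n \<Rightarrow> real ^ 'd ^ 'd"
  assumes n: "is_norm nrm"
    and radius: "\<And>I ws. I \<in> closed_classes P \<Longrightarrow> accessible M \<sigma> transient I \<Longrightarrow> ws \<in> words I \<Longrightarrow> ws \<noteq> [] \<Longrightarrow>
      spectral_radius (word_flow A ws) = exp (\<theta> * duration ws)"
  shows "ereal \<theta> \<le> lyap_prob nrm M \<sigma> A"
proof -
  obtain \<kappa> where \<kappa>: "1 \<le> \<kappa>" "\<And>M x. norm (M *v x) \<le> \<kappa> * op_norm nrm M * norm x"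
    by (rule op_norm_equivalent[OF n]) metis
  obtain c where c: "0 \<le> c" "\<And>ws. ws \<in> words UNIV \<Longrightarrow> 0 < op_norm nrm (word_flow A ws)"
    "\<And>ws. ws \<in> words UNIV \<Longrightarrow> \<bar>ln (op_norm nrm (word_flow A ws))\<bar> \<le> total_norm A * duration ws + c"
    by (rule op_norm_word_bounds[OF n, of A]) blast
  define a where "a = \<bar>\<theta>\<bar> + total_norm A"
  define c' where "c' = ln \<kappa> + c"
  have a0: "0 \<le> a" using total_norm_nonneg[of A] by (simp add: a_def)
  let ?L = "\<lambda>t \<omega>. ln (op_norm nrm (flow A (\<sigma> \<omega>) t))"
  let ?F = "\<lambda>m. {\<omega> \<in> space M. \<sigma> \<omega> (real m) \<in> accessible_states}"
  have lower: "\<theta> * t - a * real m - c' - a * t * (1 - prob (?F m)) \<le> expectation (?L t)" if t: "real m < t" for m t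
  proof -
    have t0: "0 < t" using t by (meson of_nat_0_le_iff order_le_less_trans)
    have meas [measurable]: "?F m \<in> events"
    proof -
      have [measurable]: "(\<lambda>\<omega>. \<sigma> \<omega> (real m)) \<in> measurable M (count_space UNIV)" by (rule \<sigma>_measurable) simp
      show ?thesis by measurable
    qed
    let ?g = "\<lambda>\<omega>. \<theta> * t - a * real m - c' - a * t * (1 - indicator (?F m) \<omega>)"
    have intg: "integrable M ?g" by (simp add: integrable_real_indicator emeasure_eq_measure)
    have "expectation ?g \<le> expectation (?L t)"
    proof (rule integral_mono_AE[OF intg integrable_ln_op_norm_flow[OF n t0]])
      show "AE \<omega> in M. ?g \<omega> \<le> ?L t \<omega>"
        using AE_regular AE_space
      proof eventually_elim
        case (elim \<omega>)
        have \<sigma>: "\<sigma> \<omega> \<in> switching_signals" by (rule paths[OF elim(2)])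
        obtain ws where ws: "ws \<in> words UNIV" "duration ws = t" "flow A (\<sigma> \<omega>) t = word_flow A ws"
          by (rule flow_eq_word[OF \<sigma> less_imp_le[OF t0]])
        have pos: "0 < op_norm nrm (flow A (\<sigma> \<omega>) t)" using c(2) ws by simp
        show ?case
        proof (cases "\<omega> \<in> ?F m")
          case True
          then obtain I where I: "I \<in> closed_classes P" "accessible M \<sigma> transient I" "\<sigma> \<omega> (real m) \<in> I"
            by (auto simp: accessible_states_def)
          have stays: "\<sigma> \<omega> u \<in> I" if "real m \<le> u" for u
            by (rule signal_stays[OF elim(1) _ _ I(3) that]) (use I(1) in \<open>auto simp: closed_classes_def\<close>)
          have "exp (\<theta> * (t - real m)) \<le> \<kappa> * op_norm nrm (flow A (\<sigma> \<omega>) t) * exp (total_norm A * real m)"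
            by (rule flow_lower_bound[OF \<kappa>(2) \<sigma> _ t stays radius[OF I(1,2)]]) simp
          then have "ln (exp (\<theta> * (t - real m))) \<le> ln (\<kappa> * op_norm nrm (flow A (\<sigma> \<omega>) t) * exp (total_norm A * real m))"
            using \<kappa>(1) pos by (subst ln_le_cancel_iff) auto
          then have "\<theta> * (t - real m) \<le> ln \<kappa> + ?L t \<omega> + total_norm A * real m"
            using \<kappa>(1) pos by (simp add: ln_mult)
          moreover have "\<theta> * real m \<le> \<bar>\<theta>\<bar> * real m" by (intro mult_right_mono) auto
          ultimately show ?thesis using True c(1) by (simp add: a_def c'_def algebra_simps)
        next
          case False
          have "\<bar>?L t \<omega>\<bar> \<le> total_norm A * t + c" using c(3)[OF ws(1)] ws by simp
          moreover have "\<theta> * t \<le> \<bar>\<theta>\<bar> * t" using t0 by (intro mult_right_mono) auto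
          moreover have "0 \<le> a * real m" using a0 by simp
          moreover have "0 \<le> ln \<kappa>" using \<kappa>(1) by simp
          ultimately show ?thesis using False by (simp add: a_def c'_def algebra_simps abs_le_iff)
        qed
      qed
    qed
    moreover have "expectation ?g = \<theta> * t - a * real m - c' - a * t * (1 - prob (?F m))"
      by (simp add: integrable_real_indicator emeasure_eq_measure prob_space)
    ultimately show ?thesis by simp
  qed
  have "ereal (\<theta> - \<eta>) \<le> lyap_prob nrm M \<sigma> A" if \<eta>: "0 < \<eta>" for \<eta>
  proof -
    have "(\<lambda>m. a * (1 - prob (?F m))) \<longlonglongrightarrow> a * (1 - 1)"
      by (intro tendsto_intros prob_accessible_states_tendsto)
    then have "\<forall>\<^sub>F m in sequentially. a * (1 - prob (?F m)) < \<eta> / 2"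
      by (rule order_tendstoD) (use \<eta> in simp)
    then obtain m where m: "a * (1 - prob (?F m)) < \<eta> / 2"
      using eventually_happens'[OF sequentially_bot] by blast
    have "\<forall>\<^sub>F t in at_top. ereal (\<theta> - \<eta>) \<le> ereal (1 / t * expectation (?L t))"
      using eventually_gt_at_top[of "real m"] eventually_ge_at_top[of "2 * (a * real m + c') / \<eta>"]
    proof eventually_elim
      case (elim t)
      have t0: "0 < t" using elim(1) by (meson of_nat_0_le_iff order_le_less_trans)
      have "a * real m + c' \<le> \<eta> / 2 * t" using elim(2) \<eta> by (simp add: field_simps)
      moreover have "a * t * (1 - prob (?F m)) \<le> \<eta> / 2 * t"
        using mult_right_mono[OF less_imp_le[OF m], of t] t0 by (simp add: mult_ac)
      ultimately have "(\<theta> - \<eta>) * t \<le> expectation (?L t)"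
        using lower[OF elim(1)] by (simp add: algebra_simps)
      then show ?case using t0 by (simp add: field_simps)
    qed
    then have "ereal (\<theta> - \<eta>) \<le> Liminf at_top (\<lambda>t. ereal (1 / t * expectation (?L t)))"
      by (rule Liminf_bounded)
    also have "\<dots> \<le> lyap_prob nrm M \<sigma> A"
      unfolding lyap_prob_def by (rule Liminf_le_Limsup) simp
    finally show ?thesis .
  qed
  note ge = this
  show ?thesis
  proof (cases "lyap_prob nrm M \<sigma> A")
    case (real r)
    have "\<theta> \<le> r + \<eta>" if "0 < \<eta>" for \<eta> using ge[OF that] real by simp
    then show ?thesis using real field_le_epsilon[of \<theta> r] by simp
  next
    case MInf
    then show ?thesis using ge[of 1] by simp
  qed simp
qed

end

section \<open>A contracting pattern lowers the probabilistic exponent\<close>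

context markov_realisation
begin

text \<open>A class that the jump chain never charges is almost surely not visited at any time.\<close>

lemma accessible_class_reached:
  assumes I: "I \<in> closed_classes P" and acc: "accessible M \<sigma> transient I"
  obtains n i where "i \<in> I" "0 < chain_law P \<nu> n i"
proof -
  have "\<exists>n. \<exists>i\<in>I. 0 < chain_law P \<nu> n i"
  proof (rule ccontr)
    assume no: "\<not> (\<exists>n. \<exists>i\<in>I. 0 < chain_law P \<nu> n i)"
    have "AE \<omega> in M. \<forall>n. \<forall>i\<in>I. X n \<omega> \<noteq> i"
    proof (subst AE_all_countable, intro allI AE_finite_allI)
      fix n i assume "i \<in> I"
      then have "chain_law P \<nu> n i = 0" using no chain_law_nonneg[of n i] by (auto simp: order_less_le)
      then show "AE \<omega> in M. X n \<omega> \<noteq> i" by (rule AE_chain_law_0)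
    qed simp
    then have "AE \<omega> in M. \<omega> \<notin> exit_event I"
      using AE_regular AE_space
    proof eventually_elim
      case (elim \<omega>)
      show ?case
      proof
        assume "\<omega> \<in> exit_event I"
        then have ex: "\<exists>t\<ge>0. \<sigma> \<omega> t \<notin> transient" and inI: "\<sigma> \<omega> (exit_time transient (\<sigma> \<omega>)) \<in> I"
          by (auto simp: exit_event_def)
        have "0 \<le> exit_time transient (\<sigma> \<omega>)" by (rule exit_time_attained(1)[OF paths[OF elim(3)] ex])
        then obtain n where "\<sigma> \<omega> (exit_time transient (\<sigma> \<omega>)) = X n \<omega>"
          by (rule regular_locate[OF elim(2)])
        then show False using inI elim(1) by metis
      qed
    qed
    then have "prob (exit_event I) = 0"
      using exit_event_measurable[OF I] by (simp add: prob_eq_0)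
    then show False using acc by (simp add: accessible_iff)
  qed
  then show ?thesis using that by blast
qed

lemma flow_along_jumps:
  fixes A :: "'n \<Rightarrow> real ^ 'd ^ 'd"
  assumes \<omega>: "regular \<omega>" "\<omega> \<in> space M"
  shows "flow A (\<sigma> \<omega>) (T (n + q) \<omega>)
    = word_flow A (map (\<lambda>l. (X (n + l) \<omega>, S (n + l) \<omega>)) [0..<q]) ** flow A (\<sigma> \<omega>) (T n \<omega>)"
proof (induction q)
  case (Suc q)
  have le: "T (n + q) \<omega> \<le> T (Suc (n + q)) \<omega>" by (rule regular_T_mono[OF \<omega>(1)]) simp
  have "flow A (\<sigma> \<omega>) (T (Suc (n + q)) \<omega>)
      = mat_exp ((T (Suc (n + q)) \<omega> - T (n + q) \<omega>) *\<^sub>R A (X (n + q) \<omega>)) ** flow A (\<sigma> \<omega>) (T (n + q) \<omega>)"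
    by (rule flow_piece[OF paths[OF \<omega>(2)] regular_T_nonneg[OF \<omega>(1)] le]) (rule regular_\<sigma>[OF \<omega>(1)])
  then show ?case using Suc by (simp add: word_flow_append matrix_mul_assoc)
qed simp

lemma T_add: "T (n + q) \<omega> = T n \<omega> + (\<Sum>l<q. S (n + l) \<omega>)"
  by (induction q) simp_all

text \<open>Along a path, an adapted norm grows at most at its rate between patterns and is halved by each
  completed pattern. Looking only at every \<open>q\<close>-th jump keeps the counted patterns disjoint; times are
  cut off at \<open>t\<close>.\<close>

lemma adapted_decay:
  fixes A :: "'n \<Rightarrow> real ^ 'd ^ 'd"
  assumes \<omega>: "regular \<omega>" "\<omega> \<in> space M" and t: "0 \<le> t"
    and p: "adapted A \<rho> p" and \<theta>: "\<theta> \<le> \<rho>" and K: "0 < K"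
    and Kp: "\<And>ws x. ws \<in> words UNIV \<Longrightarrow> p (word_flow A ws *v x) \<le> K * norm (word_flow A ws) * p x"
    and pat: "contracting_pattern A P I \<theta> K q w a \<epsilon>"
  shows "p (flow A (\<sigma> \<omega>) t *v x) \<le> exp (\<rho> * t) *
    (1 / 2) ^ card {\<beta>. \<beta> < m \<and> pattern_at q w a \<epsilon> (r + \<beta> * q) \<omega> \<and> T (r + \<beta> * q + q) \<omega> \<le> t} * p x"
proof -
  let ?\<Phi> = "flow A (\<sigma> \<omega>)"
  have \<sigma>: "\<sigma> \<omega> \<in> switching_signals" by (rule paths[OF \<omega>(2)])
  have p0: "0 \<le> p y" for y using p by (simp add: adapted_def)
  have move: "p (?\<Phi> v *v x) \<le> exp (\<rho> * (v - u)) * p (?\<Phi> u *v x)" if uv: "0 \<le> u" "u \<le> v" for u v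
  proof -
    obtain ws where ws: "ws \<in> words (\<sigma> \<omega> ` {u..<v})" "duration ws = v - u" "?\<Phi> v = word_flow A ws ** ?\<Phi> u"
      by (rule flow_word[OF \<sigma> uv])
    have "p (word_flow A ws *v (?\<Phi> u *v x)) \<le> exp (\<rho> * duration ws) * p (?\<Phi> u *v x)"
      using p words_mono[OF subset_UNIV ws(1)] unfolding adapted_def by blast
    then show ?thesis using ws(2,3) by (simp add: matrix_vector_mul_assoc)
  qed
  define \<tau> where "\<tau> \<beta> = min (T (r + \<beta> * q) \<omega>) t" for \<beta>
  define N where "N \<beta> = {\<beta>'. \<beta>' < \<beta> \<and> pattern_at q w a \<epsilon> (r + \<beta>' * q) \<omega> \<and> T (r + \<beta>' * q + q) \<omega> \<le> t}" for \<beta>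
  have fin: "finite (N \<beta>)" for \<beta> by (simp add: N_def)
  have \<tau>0: "0 \<le> \<tau> \<beta>" for \<beta> using t regular_T_nonneg[OF \<omega>(1)] by (simp add: \<tau>_def)
  have \<tau>_mono: "\<tau> \<beta> \<le> \<tau> (Suc \<beta>)" for \<beta>
    using regular_T_mono[OF \<omega>(1), of "r + \<beta> * q" "r + Suc \<beta> * q"] by (auto simp: \<tau>_def)
  have main: "p (?\<Phi> (\<tau> \<beta>) *v x) \<le> exp (\<rho> * \<tau> \<beta>) * (1 / 2) ^ card (N \<beta>) * p x" for \<beta>
  proof (induction \<beta>)
    case 0
    show ?case using move[of 0 "\<tau> 0"] \<tau>0[of 0] by (simp add: N_def flow_0[OF \<sigma>])
  next
    case (Suc \<beta>)
    let ?n = "r + \<beta> * q" and ?c = "(1 / 2) ^ card (N \<beta>) * p x"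
    have c0: "0 \<le> ?c" using p0 by simp
    have combine: "exp (\<rho> * (\<tau> (Suc \<beta>) - \<tau> \<beta>)) * p (?\<Phi> (\<tau> \<beta>) *v x) \<le> exp (\<rho> * \<tau> (Suc \<beta>)) * ?c"
    proof -
      have "exp (\<rho> * (\<tau> (Suc \<beta>) - \<tau> \<beta>)) * p (?\<Phi> (\<tau> \<beta>) *v x)
          \<le> exp (\<rho> * (\<tau> (Suc \<beta>) - \<tau> \<beta>)) * (exp (\<rho> * \<tau> \<beta>) * ?c)"
        using Suc by (intro mult_left_mono) (simp_all add: mult.assoc)
      also have "\<dots> = exp (\<rho> * (\<tau> (Suc \<beta>) - \<tau> \<beta>) + \<rho> * \<tau> \<beta>) * ?c"
        by (simp only: exp_add mult.assoc)
      also have "\<rho> * (\<tau> (Suc \<beta>) - \<tau> \<beta>) + \<rho> * \<tau> \<beta> = \<rho> * \<tau> (Suc \<beta>)" by (simp add: algebra_simps)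
      finally show ?thesis .
    qed
    show ?case
    proof (cases "pattern_at q w a \<epsilon> ?n \<omega> \<and> T (?n + q) \<omega> \<le> t")
      case False
      then have "N (Suc \<beta>) = N \<beta>" by (auto simp: N_def less_Suc_eq)
      then show ?thesis using order_trans[OF move[OF \<tau>0 \<tau>_mono] combine] by (simp add: mult.assoc)
    next
      case True
      have N: "card (N (Suc \<beta>)) = Suc (card (N \<beta>))"
      proof -
        have "N (Suc \<beta>) = insert \<beta> (N \<beta>)" using True by (auto simp: N_def less_Suc_eq)
        moreover have "\<beta> \<notin> N \<beta>" by (simp add: N_def)
        ultimately show ?thesis using fin by simp
      qed
      have Tle: "T ?n \<omega> \<le> t" using regular_T_mono[OF \<omega>(1), of ?n "?n + q"] True by simp
      have \<tau>: "\<tau> \<beta> = T ?n \<omega>" "\<tau> (Suc \<beta>) = T (?n + q) \<omega>" using Tle True by (simp_all add: \<tau>_def add.commute add.left_commute)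
      let ?s = "\<lambda>l. S (?n + l) \<omega>"
      let ?ws = "map (\<lambda>l. (w l, ?s l)) [0..<q]"
      have Xw: "X (?n + l) \<omega> = w l" "a l < ?s l" "?s l < a l + \<epsilon>" if "l < q" for l
        using True that by (auto simp: pattern_at_def)
      have ws_eq: "map (\<lambda>l. (X (?n + l) \<omega>, ?s l)) [0..<q] = ?ws" using Xw(1) by simp
      have dur: "(\<Sum>l<q. ?s l) = \<tau> (Suc \<beta>) - \<tau> \<beta>" unfolding \<tau> T_add by simp
      have ws: "?ws \<in> words UNIV"
        using regular_S_pos[OF \<omega>(1)] by (auto simp: words_def lists_eq_set less_imp_le)
      have "K * norm (word_flow A ?ws) \<le> exp (\<theta> * (\<Sum>l<q. ?s l)) / 2"
      proof -
        have "\<forall>l<q. a l < ?s l \<and> ?s l < a l + \<epsilon>" using Xw(2,3) by simp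
        then show ?thesis using pat unfolding contracting_pattern_def by (elim conjE allE[of _ ?s]) simp
      qed
      also have "\<dots> \<le> exp (\<rho> * (\<tau> (Suc \<beta>) - \<tau> \<beta>)) / 2"
        unfolding dur using mult_right_mono[OF \<theta>, of "\<tau> (Suc \<beta>) - \<tau> \<beta>"] \<tau>_mono[of \<beta>] by simp
      finally have half: "K * norm (word_flow A ?ws) \<le> exp (\<rho> * (\<tau> (Suc \<beta>) - \<tau> \<beta>)) / 2" .
      have "?\<Phi> (\<tau> (Suc \<beta>)) = word_flow A ?ws ** ?\<Phi> (\<tau> \<beta>)"
        unfolding \<tau> using flow_along_jumps[OF \<omega>, of A ?n q] unfolding ws_eq .
      then have "p (?\<Phi> (\<tau> (Suc \<beta>)) *v x) = p (word_flow A ?ws *v (?\<Phi> (\<tau> \<beta>) *v x))"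
        by (simp add: matrix_vector_mul_assoc)
      also have "\<dots> \<le> K * norm (word_flow A ?ws) * p (?\<Phi> (\<tau> \<beta>) *v x)" by (rule Kp[OF ws])
      also have "\<dots> \<le> exp (\<rho> * (\<tau> (Suc \<beta>) - \<tau> \<beta>)) / 2 * p (?\<Phi> (\<tau> \<beta>) *v x)"
        by (rule mult_right_mono[OF half p0])
      also have "\<dots> \<le> exp (\<rho> * \<tau> (Suc \<beta>)) * ?c / 2" using combine by simp
      also have "\<dots> = exp (\<rho> * \<tau> (Suc \<beta>)) * (1 / 2) ^ card (N (Suc \<beta>)) * p x" by (simp add: N)
      finally show ?thesis .
    qed
  qed
  have \<tau>t: "\<tau> m \<le> t" by (simp add: \<tau>_def)
  have "p (?\<Phi> t *v x) \<le> exp (\<rho> * (t - \<tau> m)) * p (?\<Phi> (\<tau> m) *v x)" by (rule move[OF \<tau>0 \<tau>t])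
  also have "\<dots> \<le> exp (\<rho> * (t - \<tau> m)) * (exp (\<rho> * \<tau> m) * (1 / 2) ^ card (N m) * p x)"
    by (intro mult_left_mono main) simp
  also have "\<dots> = exp (\<rho> * (t - \<tau> m) + \<rho> * \<tau> m) * (1 / 2) ^ card (N m) * p x"
    by (simp only: exp_add mult.assoc)
  also have "\<rho> * (t - \<tau> m) + \<rho> * \<tau> m = \<rho> * t" by (simp add: algebra_simps)
  finally show ?thesis by (simp add: N_def)
qed

definition completed :: "nat \<Rightarrow> (nat \<Rightarrow> 'n) \<Rightarrow> (nat \<Rightarrow> real) \<Rightarrow> real \<Rightarrow> real \<Rightarrow> nat \<Rightarrow> 'w set" where
  "completed q w a \<epsilon> t n = {\<omega> \<in> space M. pattern_at q w a \<epsilon> n \<omega> \<and> T (n + q) \<omega> \<le> t}"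

lemma completed_measurable [measurable]: "completed q w a \<epsilon> t n \<in> events"
  unfolding completed_def by measurable

text \<open>Averaging the previous estimate over the \<open>q\<close> possible offsets counts the patterns at all
  positions.\<close>

lemma expected_decay:
  fixes A :: "'n \<Rightarrow> real ^ 'd ^ 'd"
  assumes n: "is_norm nrm" and p: "adapted A \<rho> p" and \<theta>: "\<theta> \<le> \<rho>" and K: "0 < K"
    and Kp: "\<And>ws x. ws \<in> words UNIV \<Longrightarrow> p (word_flow A ws *v x) \<le> K * norm (word_flow A ws) * p x"
    and pC: "\<And>x. norm x \<le> p x" "\<And>x. p x \<le> C * norm x"
    and pat: "contracting_pattern A P I \<theta> K q w a \<epsilon>"
  obtains b where "\<And>t m. 0 < t \<Longrightarrow> expectation (\<lambda>\<omega>. ln (op_norm nrm (flow A (\<sigma> \<omega>) t)))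
      \<le> b + \<rho> * t - ln 2 / q * (\<Sum>n<m * q. prob (completed q w a \<epsilon> t n))"
proof -
  have q: "0 < q" using pat by (simp add: contracting_pattern_def)
  obtain \<kappa> where \<kappa>: "1 \<le> \<kappa>"
    "\<And>M B. (\<And>x. norm (M *v x) \<le> B * norm x) \<Longrightarrow> op_norm nrm M \<le> \<kappa> * B"
    by (rule op_norm_equivalent[OF n]) metis
  obtain c where c: "\<And>ws. ws \<in> words UNIV \<Longrightarrow> 0 < op_norm nrm (word_flow A ws)"
    by (rule op_norm_word_bounds[OF n, of A]) blast
  have C1: "1 \<le> C"
    using order_trans[OF pC, of "axis undefined 1 :: real ^ 'd"] by (simp add: norm_axis_1)
  define b where "b = ln (\<kappa> * C)"
  let ?L = "\<lambda>t \<omega>. ln (op_norm nrm (flow A (\<sigma> \<omega>) t))"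
  have pointwise: "?L t \<omega> \<le> b + \<rho> * t - ln 2 / q * (\<Sum>n<m * q. indicator (completed q w a \<epsilon> t n) \<omega>)"
    if t: "0 < t" and \<omega>: "regular \<omega>" "\<omega> \<in> space M" for t m \<omega>
  proof -
    define N where "N r = {\<beta>. \<beta> < m \<and> pattern_at q w a \<epsilon> (r + \<beta> * q) \<omega> \<and> T (r + \<beta> * q + q) \<omega> \<le> t}" for r
    have offset: "?L t \<omega> \<le> b + \<rho> * t - ln 2 * card (N r)" for r
    proof -
      let ?B = "C * exp (\<rho> * t) * (1 / 2) ^ card (N r)"
      have "norm (flow A (\<sigma> \<omega>) t *v x) \<le> ?B * norm x" for x
      proof -
        have "norm (flow A (\<sigma> \<omega>) t *v x) \<le> p (flow A (\<sigma> \<omega>) t *v x)" by (rule pC)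
        also have "\<dots> \<le> exp (\<rho> * t) * (1 / 2) ^ card (N r) * p x"
          unfolding N_def by (rule adapted_decay[OF \<omega> less_imp_le[OF t] p \<theta> K Kp pat])
        also have "\<dots> \<le> exp (\<rho> * t) * (1 / 2) ^ card (N r) * (C * norm x)"
          by (intro mult_left_mono pC) simp
        finally show ?thesis by (simp add: mult_ac)
      qed
      then have le: "op_norm nrm (flow A (\<sigma> \<omega>) t) \<le> \<kappa> * ?B" by (rule \<kappa>(2))
      obtain ws where "ws \<in> words UNIV" "duration ws = t" "flow A (\<sigma> \<omega>) t = word_flow A ws"
        by (rule flow_eq_word[OF paths[OF \<omega>(2)] less_imp_le[OF t]])
      then have pos: "0 < op_norm nrm (flow A (\<sigma> \<omega>) t)" using c by simp
      have "?L t \<omega> \<le> ln (\<kappa> * ?B)" using le pos by (subst ln_le_cancel_iff) linarith+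
      also have "\<kappa> * ?B = (\<kappa> * C) * exp (\<rho> * t) * (1 / 2) ^ card (N r)" by (simp only: mult.assoc)
      also have "ln \<dots> = b + \<rho> * t + card (N r) * ln (1 / 2)"
        using \<kappa>(1) C1 by (simp add: b_def ln_mult ln_realpow)
      finally show ?thesis by (simp add: ln_div mult.commute)
    qed
    have card_N: "real (card (N r)) = (\<Sum>\<beta><m. indicator (completed q w a \<epsilon> t (r + \<beta> * q)) \<omega>)" for r
    proof -
      have "(\<Sum>\<beta><m. indicator (completed q w a \<epsilon> t (r + \<beta> * q)) \<omega>) = (\<Sum>\<beta>\<in>N r. (1::real))"
        by (rule sum.mono_neutral_cong_right) (use \<omega>(2) in \<open>auto simp: N_def completed_def indicator_def\<close>)
      then show ?thesis by simp
    qed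
    have "real q * ?L t \<omega> \<le> (\<Sum>r<q. b + \<rho> * t - ln 2 * card (N r))"
      using sum_mono[of "{..<q}" "\<lambda>_. ?L t \<omega>", OF offset] by simp
    also have "\<dots> = q * (b + \<rho> * t) - ln 2 * (\<Sum>r<q. real (card (N r)))"
      by (simp add: sum_subtractf sum_distrib_left)
    also have "(\<Sum>r<q. real (card (N r))) = (\<Sum>\<beta><m. \<Sum>r<q. indicator (completed q w a \<epsilon> t (r + \<beta> * q)) \<omega>)"
      unfolding card_N by (rule sum.swap)
    also have "\<dots> = (\<Sum>\<beta><m. \<Sum>n\<in>{\<beta> * q..<\<beta> * q + q}. indicator (completed q w a \<epsilon> t n) \<omega>)"
    proof (rule sum.cong[OF refl])
      fix \<beta>
      show "(\<Sum>r<q. indicator (completed q w a \<epsilon> t (r + \<beta> * q)) \<omega>)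
          = (\<Sum>n\<in>{\<beta> * q..<\<beta> * q + q}. indicator (completed q w a \<epsilon> t n) \<omega> :: real)"
        using sum.shift_bounds_nat_ivl[of "\<lambda>n. indicator (completed q w a \<epsilon> t n) \<omega> :: real" 0 "\<beta> * q" q]
        by (simp add: lessThan_atLeast0 add.commute)
    qed
    also have "\<dots> = (\<Sum>n<m * q. indicator (completed q w a \<epsilon> t n) \<omega>)"
      by (rule sum.nat_group)
    finally show ?thesis using q by (simp add: field_simps)
  qed
  have "expectation (?L t) \<le> b + \<rho> * t - ln 2 / q * (\<Sum>n<m * q. prob (completed q w a \<epsilon> t n))"
    if t: "0 < t" for t m
  proof -
    let ?g = "\<lambda>\<omega>. b + \<rho> * t - ln 2 / q * (\<Sum>n<m * q. indicator (completed q w a \<epsilon> t n) \<omega>)"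
    have ind: "integrable M (indicator (completed q w a \<epsilon> t n) :: _ \<Rightarrow> real)" for n
      by (simp add: integrable_real_indicator emeasure_eq_measure)
    have int: "integrable M ?g"
      by (intro Bochner_Integration.integrable_diff integrable_mult_right Bochner_Integration.integrable_sum ind) simp
    have "expectation (?L t) \<le> expectation ?g"
    proof (rule integral_mono_AE[OF integrable_ln_op_norm_flow[OF n t] int])
      show "AE \<omega> in M. ?L t \<omega> \<le> ?g \<omega>"
        using AE_regular AE_space by eventually_elim (rule pointwise[OF t])
    qed
    also have "expectation ?g = b + \<rho> * t - ln 2 / q * (\<Sum>n<m * q. prob (completed q w a \<epsilon> t n))"
    proof -
      have "expectation ?g = expectation (\<lambda>\<omega>. b + \<rho> * t)
          - expectation (\<lambda>\<omega>. ln 2 / q * (\<Sum>n<m * q. indicator (completed q w a \<epsilon> t n) \<omega>))"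
        by (intro Bochner_Integration.integral_diff integrable_mult_right Bochner_Integration.integrable_sum ind) simp
      also have "expectation (\<lambda>\<omega>. ln 2 / q * (\<Sum>n<m * q. indicator (completed q w a \<epsilon> t n) \<omega>))
          = ln 2 / q * (\<Sum>n<m * q. prob (completed q w a \<epsilon> t n))"
        by (subst integral_mult_right_zero, subst Bochner_Integration.integral_sum[OF ind]) simp
      finally show ?thesis by (simp add: prob_space)
    qed
    finally show ?thesis .
  qed
  then show ?thesis using that by blast
qed

text \<open>A pattern started among the first few jumps is completed before time \<open>t\<close> unless the jumps are
  unusually slow, which Markov's inequality excludes with enough probability when the number of
  jumps considered is a small multiple of \<open>t\<close>.\<close>

lemma expected_completed_ge:
  assumes q: "0 < q" and \<epsilon>: "0 < \<epsilon>" and a: "\<forall>l<q. 0 \<le> a l"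
    and path: "\<forall>l. Suc l < q \<longrightarrow> P $ w l $ w (Suc l) \<noteq> 0"
    and I: "closed_class P I" and w0: "w 0 \<in> I" and i0: "i0 \<in> I" "0 < chain_law P \<nu> n0 i0"
  obtains \<gamma> b where "0 < \<gamma>"
    "\<And>t. 0 < t \<Longrightarrow> \<exists>m. \<gamma> * t - b \<le> (\<Sum>n<m * q. prob (completed q w a \<epsilon> t n))"
proof -
  obtain p where p: "0 < p" "\<And>n. p * chain_law P \<nu> n (w 0) \<le> prob {\<omega> \<in> space M. pattern_at q w a \<epsilon> n \<omega>}"
    using prob_pattern_ge[OF q \<epsilon> a path] by blast
  obtain c d where cd: "0 < c" "\<And>m. c * real m - d \<le> (\<Sum>n<m. chain_law P \<nu> n (w 0))"
    using chain_law_density[OF I w0 i0] by blast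
  \<comment> \<open>among the first \<open>\<eta> t q\<close> jumps, \<open>p c \<eta> q t\<close> patterns are expected and at most \<open>\<eta>\<^sup>2 q\<^sup>2 t / \<mu>\<close> of
    them come too late, up to constants; this \<open>\<eta>\<close> maximises the difference\<close>
  define \<eta> where "\<eta> = p * c * \<mu> / (2 * q)"
  have \<eta>: "0 < \<eta>" using p(1) cd(1) rate q by (simp add: \<eta>_def)
  have single: "p * chain_law P \<nu> n (w 0) - real (n + q) / (\<mu> * t) \<le> prob (completed q w a \<epsilon> t n)"
    if t: "0 < t" for t n
  proof -
    have "prob {\<omega> \<in> space M. pattern_at q w a \<epsilon> n \<omega>}
        \<le> prob (completed q w a \<epsilon> t n \<union> {\<omega> \<in> space M. t < T (n + q) \<omega>})"
      by (intro finite_measure_mono) (auto simp: completed_def)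
    also have "\<dots> \<le> prob (completed q w a \<epsilon> t n) + prob {\<omega> \<in> space M. t < T (n + q) \<omega>}"
      by (intro measure_Un_le) auto
    finally show ?thesis using p(2)[of n] prob_T_gt_le[OF t, of "n + q"] by linarith
  qed
  have "\<exists>m. (p * c)\<^sup>2 * \<mu> / 4 * t - (p * c * q + p * d + \<eta> * q\<^sup>2 / \<mu>) \<le> (\<Sum>n<m * q. prob (completed q w a \<epsilon> t n))"
    if t: "0 < t" for t
  proof -
    define m where "m = nat \<lfloor>\<eta> * t\<rfloor>"
    have m: "real m \<le> \<eta> * t" "\<eta> * t - 1 \<le> real m" using \<eta> t by (auto simp: m_def intro: less_imp_le)
    let ?N = "real (m * q)"
    have N: "?N \<le> \<eta> * t * q" "(\<eta> * t - 1) * q \<le> ?N"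
      using m q by (auto intro: mult_right_mono)
    have "(\<Sum>n<m * q. p * chain_law P \<nu> n (w 0) - real (n + q) / (\<mu> * t)) \<le> (\<Sum>n<m * q. prob (completed q w a \<epsilon> t n))"
      by (intro sum_mono single t)
    moreover have "(\<Sum>n<m * q. real (n + q) / (\<mu> * t)) \<le> ?N * ((?N + q) / (\<mu> * t))"
    proof -
      have "(\<Sum>n<m * q. real (n + q) / (\<mu> * t)) \<le> (\<Sum>n<m * q. (?N + q) / (\<mu> * t))"
      proof (rule sum_mono)
        fix n assume "n \<in> {..<m * q}"
        then have "real (n + q) \<le> ?N + q" by (metis add_le_mono1 lessThan_iff less_imp_le of_nat_add of_nat_le_iff)
        then show "real (n + q) / (\<mu> * t) \<le> (?N + q) / (\<mu> * t)"
          using rate t by (intro divide_right_mono) auto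
      qed
      then show ?thesis by simp
    qed
    moreover have "?N * ((?N + q) / (\<mu> * t)) \<le> (\<eta> * t * q) * ((\<eta> * t * q + q) / (\<mu> * t))"
      using N(1) \<eta> t rate by (intro mult_mono divide_right_mono) auto
    moreover have "p * (c * ((\<eta> * t - 1) * q) - d) \<le> (\<Sum>n<m * q. p * chain_law P \<nu> n (w 0))"
    proof -
      have "c * ((\<eta> * t - 1) * q) - d \<le> c * ?N - d" using N(2) cd(1) by simp
      also have "\<dots> \<le> (\<Sum>n<m * q. chain_law P \<nu> n (w 0))" by (rule cd(2))
      finally show ?thesis unfolding sum_distrib_left[symmetric] using p(1) by (intro mult_left_mono) auto
    qed
    ultimately have "p * (c * ((\<eta> * t - 1) * q) - d) - (\<eta> * t * q) * ((\<eta> * t * q + q) / (\<mu> * t))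
        \<le> (\<Sum>n<m * q. prob (completed q w a \<epsilon> t n))"
      by (simp only: sum_subtractf)
    moreover have "(\<eta> * t * q) * ((\<eta> * t * q + q) / (\<mu> * t)) = \<eta>\<^sup>2 * q\<^sup>2 / \<mu> * t + \<eta> * q\<^sup>2 / \<mu>"
      using t rate by (simp add: field_simps power2_eq_square)
    moreover have "p * (c * ((\<eta> * t - 1) * q) - d) = p * c * \<eta> * q * t - (p * c * q + p * d)"
      by (simp add: algebra_simps)
    moreover have "p * c * \<eta> * q * t - \<eta>\<^sup>2 * q\<^sup>2 / \<mu> * t = (p * c)\<^sup>2 * \<mu> / 4 * t"
      unfolding \<eta>_def using q rate by (simp add: field_simps power2_eq_square)
    ultimately show ?thesis by (intro exI[of _ m]) linarith
  qed
  moreover have "0 < (p * c)\<^sup>2 * \<mu> / 4" using p(1) cd(1) rate by simp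
  ultimately show ?thesis using that by blast
qed

text \<open>The order of choices is essential: \<open>K\<close>, then the pattern and its density \<open>\<gamma>\<close>, and only then \<open>\<delta>\<close>.\<close>

lemma lyap_prob_less:
  fixes A :: "'n \<Rightarrow> real ^ 'd ^ 'd"
  assumes n: "is_norm nrm" and g: "growth_bound A \<theta>"
    and I: "I \<in> closed_classes P" "accessible M \<sigma> transient I"
    and ws: "ws \<in> words I" "ws \<noteq> []" "spectral_radius (word_flow A ws) < exp (\<theta> * duration ws)"
  shows "lyap_prob nrm M \<sigma> A < ereal \<theta>"
proof -
  have cI: "closed_class P I" using I(1) by (simp add: closed_classes_def)
  obtain K where K: "0 < K" "\<And>p r ws x. adapted A r p \<Longrightarrow> r \<le> \<theta> + 1 \<Longrightarrow> ws \<in> words UNIV \<Longrightarrow>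
       p (word_flow A ws *v x) \<le> K * norm (word_flow A ws) * p x"
    by (rule adapted_uniform_bound[of A "\<theta> + 1"]) blast
  obtain q w a \<epsilon> where pat: "contracting_pattern A P I \<theta> K q w a \<epsilon>"
    by (rule contracting_pattern_exists[OF stochastic cI K(1) ws])
  obtain n0 i0 where i0: "i0 \<in> I" "0 < chain_law P \<nu> n0 i0" by (rule accessible_class_reached[OF I])
  have q: "0 < q" "0 < \<epsilon>" "\<forall>l<q. 0 \<le> a l" "\<forall>l. Suc l < q \<longrightarrow> P $ w l $ w (Suc l) \<noteq> 0" "w 0 \<in> I"
    using pat by (auto simp: contracting_pattern_def)
  obtain \<gamma> b where \<gamma>: "0 < \<gamma>"
    "\<And>t. 0 < t \<Longrightarrow> \<exists>m. \<gamma> * t - b \<le> (\<Sum>n<m * q. prob (completed q w a \<epsilon> t n))"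
    using expected_completed_ge[OF q(1-4) cI q(5) i0] by blast
  define G where "G = ln 2 / q * \<gamma>"
  have G: "0 < G" using \<gamma>(1) q(1) by (simp add: G_def)
  define \<delta> where "\<delta> = min 1 (G / 2)"
  have \<delta>: "0 < \<delta>" "\<delta> \<le> 1" "\<delta> \<le> G / 2" using G by (auto simp: \<delta>_def)
  obtain p C where p: "adapted A (\<theta> + \<delta>) p" "\<And>x. norm x \<le> p x" "\<And>x. p x \<le> C * norm x"
    using adapted_norm_exists[OF g \<delta>(1)] by blast
  have "\<theta> \<le> \<theta> + \<delta>" using \<delta>(1) by simp
  then obtain b' where b': "\<And>t m. 0 < t \<Longrightarrow> expectation (\<lambda>\<omega>. ln (op_norm nrm (flow A (\<sigma> \<omega>) t)))
      \<le> b' + (\<theta> + \<delta>) * t - ln 2 / q * (\<Sum>n<m * q. prob (completed q w a \<epsilon> t n))"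
    using expected_decay[OF n p(1) _ K(1) K(2)[OF p(1)] p(2,3) pat] \<delta>(2) by (metis add_left_mono)
  define B where "B = b' + ln 2 / q * b"
  have bound: "expectation (\<lambda>\<omega>. ln (op_norm nrm (flow A (\<sigma> \<omega>) t))) \<le> B + (\<theta> - G / 2) * t" if t: "0 < t" for t
  proof -
    obtain m where m: "\<gamma> * t - b \<le> (\<Sum>n<m * q. prob (completed q w a \<epsilon> t n))" using \<gamma>(2)[OF t] by blast
    have "ln 2 / q * (\<gamma> * t - b) \<le> ln 2 / q * (\<Sum>n<m * q. prob (completed q w a \<epsilon> t n))"
      using m q(1) by (intro mult_left_mono) auto
    moreover have "ln 2 / q * (\<gamma> * t - b) = G * t - ln 2 / q * b"
      by (simp only: G_def right_diff_distrib mult.assoc)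
    moreover have "\<delta> * t \<le> G / 2 * t" using \<delta>(3) t by (intro mult_right_mono) auto
    moreover have "(\<theta> + \<delta>) * t = \<theta> * t + \<delta> * t" "(\<theta> - G / 2) * t = \<theta> * t - G / 2 * t"
      by (simp_all only: distrib_right left_diff_distrib)
    ultimately show ?thesis using b'[OF t, of m] unfolding B_def by linarith
  qed
  have "lyap_prob nrm M \<sigma> A \<le> ereal (\<theta> - G / 4)"
    unfolding lyap_prob_def
  proof (rule Limsup_bounded)
    show "\<forall>\<^sub>F t in at_top. ereal (1 / t * expectation (\<lambda>\<omega>. ln (op_norm nrm (flow A (\<sigma> \<omega>) t)))) \<le> ereal (\<theta> - G / 4)"
      using eventually_gt_at_top[of 0] eventually_ge_at_top[of "4 * B / G"]
    proof eventually_elim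
      case (elim t)
      have "B \<le> G / 4 * t" using elim(2) G by (simp add: field_simps)
      then have "expectation (\<lambda>\<omega>. ln (op_norm nrm (flow A (\<sigma> \<omega>) t))) \<le> (\<theta> - G / 4) * t"
        using bound[OF elim(1)] by (simp add: algebra_simps)
      then show ?case using elim(1) by (simp add: field_simps)
    qed
  qed
  also have "\<dots> < ereal \<theta>" using G by simp
  finally show ?thesis .
qed

end

section \<open>The equivalence\<close>

lemma word_as_exp_prod:
  assumes "ws \<in> words I" "ws \<noteq> []"
  obtains k i t where "1 \<le> k" "\<forall>j\<in>{1..k}. i j \<in> I \<and> 0 \<le> t j"
    "exp_prod A i t k = word_flow A ws" "(\<Sum>j=1..k. t j) = duration ws"
proof -
  define k i t where "k = length ws" and "i = (\<lambda>j. fst (ws ! (j - 1)))" and "t = (\<lambda>j. snd (ws ! (j - 1)))"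
  have eq: "map (\<lambda>j. (i j, t j)) [1..<Suc k] = ws"
    by (rule nth_equalityI) (simp_all add: k_def i_def t_def del: upt_Suc)
  have "i j \<in> I \<and> 0 \<le> t j" if j: "j \<in> {1..k}" for j
  proof -
    have "ws ! (j - 1) \<in> set ws" using j by (intro nth_mem) (auto simp: k_def)
    then have "ws ! (j - 1) \<in> I \<times> {0..}" using assms(1) by (auto simp: words_def lists_eq_set)
    then show ?thesis by (auto simp: i_def t_def)
  qed
  moreover have "1 \<le> k" using assms(2) by (cases ws) (auto simp: k_def)
  ultimately show ?thesis
    using that[of k i t] exp_prod_eq_word_flow[of A i t k] duration_upt[of i t k] unfolding eq by simp
qed

theorem theorem3p1:
  fixes P :: "real ^ 'n ^ 'n" and \<nu> :: "real ^ 'n" and \<mu> :: real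
    and A :: "'n \<Rightarrow> real ^ 'd ^ 'd"
    and nrm :: "real ^ 'd \<Rightarrow> real"
    and M :: "'w measure" and \<sigma> :: "'w \<Rightarrow> real \<Rightarrow> 'n"
  assumes "stochastic_matrix P"
    and "probability_vector \<nu>"
    and "\<mu> > 0"
    and "is_norm nrm"
    and "markov_process M \<nu> \<mu> P \<sigma>"
  shows "lyap_det nrm A = lyap_prob nrm M \<sigma> A \<longleftrightarrow>
    (\<forall>I\<in>recurrence_classes P. accessible M \<sigma> (transient_states P) I \<longrightarrow>
      (\<forall>(k::nat) (i::nat \<Rightarrow> 'n) (t::nat \<Rightarrow> real).
        1 \<le> k \<and> (\<forall>j\<in>{1..k}. i j \<in> I \<and> 0 \<le> t j) \<longrightarrow>
        spectral_radius (exp_prod A i t k) =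
          exp (real_of_ereal (lyap_det nrm A) * (\<Sum>j=1..k. t j))))"
proof -
  obtain X S where X: "jump_chain M \<nu> P X" and S: "holding_times M \<mu> S"
    and indep: "prob_space.indep_set M
          {(\<lambda>\<omega> k. X k \<omega>) -` B \<inter> space M | B. B \<in> sets (PiM (UNIV :: nat set) (\<lambda>_. count_space UNIV))}
          {(\<lambda>\<omega> k. S k \<omega>) -` B \<inter> space M | B. B \<in> sets (PiM (UNIV :: nat set) (\<lambda>_. borel))}"
    and real: "AE \<omega> in M. \<forall>k t. (\<Sum>j<k. S j \<omega>) \<le> t \<and> t < (\<Sum>j\<le>k. S j \<omega>) \<longrightarrow> \<sigma> \<omega> t = X k \<omega>"
    using assms(5) unfolding markov_process_def by blast
  have ps: "prob_space M" using assms(5) by (simp add: markov_process_def)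
  interpret markov_realisation M \<nu> \<mu> P \<sigma> X S
  proof (intro markov_realisation.intro markov_realisation_axioms.intro ps assms(1-3) X S indep real)
    show "\<omega> \<in> space M \<Longrightarrow> \<sigma> \<omega> \<in> switching_signals" for \<omega>
      using assms(5) by (simp add: markov_process_def)
    show "0 \<le> t \<Longrightarrow> (\<lambda>\<omega>. \<sigma> \<omega> t) \<in> measurable M (count_space UNIV)" for t
      using assms(5) by (simp add: markov_process_def)
  qed
  obtain \<theta> where \<theta>: "lyap_det nrm A = ereal \<theta>" "growth_bound A \<theta>" by (rule lyap_det_finite[OF assms(4)])
  have classes: "recurrence_classes P = closed_classes P" "transient_states P = transient"
    using recurrence_classes_eq[OF assms(1)] transient_states_eq[OF assms(1)] by simp_all
  show ?thesis
    unfolding classes \<theta>(1) real_of_ereal.simps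
  proof
    assume eq: "ereal \<theta> = lyap_prob nrm M \<sigma> A"
    show "\<forall>I\<in>closed_classes P. accessible M \<sigma> transient I \<longrightarrow>
      (\<forall>k i t. 1 \<le> k \<and> (\<forall>j\<in>{1..k}. i j \<in> I \<and> 0 \<le> t j) \<longrightarrow>
        spectral_radius (exp_prod A i t k) = exp (\<theta> * (\<Sum>j=1..k. t j)))"
    proof (intro ballI impI allI)
      fix I and k :: nat and i :: "nat \<Rightarrow> 'n" and t :: "nat \<Rightarrow> real"
      assume I: "I \<in> closed_classes P" "accessible M \<sigma> transient I"
        and kit: "1 \<le> k \<and> (\<forall>j\<in>{1..k}. i j \<in> I \<and> 0 \<le> t j)"
      define ws where "ws = map (\<lambda>j. (i j, t j)) [1..<Suc k]"
      have ws: "ws \<in> words I" "ws \<noteq> []" using kit by (auto simp: ws_def words_def lists_eq_set)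
      have "\<not> spectral_radius (word_flow A ws) < exp (\<theta> * duration ws)"
        using lyap_prob_less[OF assms(4) \<theta>(2) I ws] eq by auto
      moreover have "spectral_radius (word_flow A ws) \<le> exp (\<theta> * duration ws)"
        by (rule spectral_radius_le_growth[OF \<theta>(2) words_mono[OF subset_UNIV ws(1)]])
      ultimately show "spectral_radius (exp_prod A i t k) = exp (\<theta> * (\<Sum>j=1..k. t j))"
        unfolding exp_prod_eq_word_flow ws_def[symmetric] duration_upt[of i t k, symmetric] by simp
    qed
  next
    assume b: "\<forall>I\<in>closed_classes P. accessible M \<sigma> transient I \<longrightarrow>
      (\<forall>k i t. 1 \<le> k \<and> (\<forall>j\<in>{1..k}. i j \<in> I \<and> 0 \<le> t j) \<longrightarrow>
        spectral_radius (exp_prod A i t k) = exp (\<theta> * (\<Sum>j=1..k. t j)))"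
    have "ereal \<theta> \<le> lyap_prob nrm M \<sigma> A"
    proof (rule lyap_prob_ge[OF assms(4)])
      fix I ws assume I: "I \<in> closed_classes P" "accessible M \<sigma> transient I" and ws: "ws \<in> words I" "ws \<noteq> []"
      obtain k i t where kit: "1 \<le> k" "\<forall>j\<in>{1..k}. i j \<in> I \<and> 0 \<le> t j"
        "exp_prod A i t k = word_flow A ws" "(\<Sum>j=1..k. t j) = duration ws"
        by (rule word_as_exp_prod[OF ws])
      then show "spectral_radius (word_flow A ws) = exp (\<theta> * duration ws)" using b I by metis
    qed
    moreover have "lyap_prob nrm M \<sigma> A \<le> ereal \<theta>" using lyap_prob_le_lyap_det[OF assms(4)] \<theta>(1) by metis
    ultimately show "ereal \<theta> = lyap_prob nrm M \<sigma> A" by simp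
  qed
qed

end
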